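(* Let $\Bbbk$ be a field, let $X$ be a finite set, and let $I\subseteq\Bbbk[X]$ be the Stanley--Reisner ideal of a simplicial complex $\Delta$ with vertex set $X$ and $f$-vector $f(\Delta)$. For every $s\in\mathbb{N}$, the ideal $\mathcal{P}_s(I)$ of principal $s$-jets of $I$ is the Stanley--Reisner ideal of a simplicial complex $\Gamma_s$ with vertex set $\mathcal{J}_s(X)$ and $f$-vector $$f(\Gamma_s)=f(\Delta)L_s,$$ where $L_s$ is the order $s$ lifting matrix. In particular: (a) if $\Bbbk[X]/I$ has Krull dimension $d$, then $\Bbbk[\mathcal{J}_s(X)]/\mathcal{P}_s(I)$ has Krull dimension $(s+1)d$; (b) $\Bbbk[\mathcal{J}_s(X)]/\mathcal{P}_s(I)$ has the same multiplicity $f_{d-1}(\Delta)$ as $\Bbbk[X]/I$.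
   Context: $\mathbb{N}$ includes $0$. $\Bbbk[X]$ is the standard graded polynomial ring with the elements of $X$ as variables. A simplicial complex $\Delta$ with vertex set $X$ is a family of subsets of $X$ (faces) closed under taking subsets and containing $\varnothing$. Its Stanley--Reisner ideal $I$ is the squarefree monomial ideal such that the faces of $\Delta$ are exactly the supports (sets of variables dividing the monomial) of the squarefree monomials not in $I$. The $f$-vector is the row vector $f(\Delta)=(f_{-1}(\Delta),f_0(\Delta),f_1(\Delta),\dots)$, extended by infinitely many zeros, where $f_i(\Delta)$ is the number of faces of cardinality $i+1$. The multiplicity is the usual Hilbert--Samuel multiplicity of a standard graded algebra; for $\Bbbk[X]/I$ of Krull dimension $d$ it is known to equal $f_{d-1}(\Delta)$. Lifting matrix: for $j,k\in\mathbb{N}$ put $$\ell_s(j,k)=\sum_{a\in\mathbb{Z}_+^j,\ a_1+\dots+a_j=k}\ \prod_{h=1}^j\binom{s+1}{a_h}$$ ($\mathbb{Z}_+$ the positive integers; for $j=0$, $\ell_s(0,0)=1$ and $\ell_s(0,k)=0$ for $k>0$). $L_s$ is the infinite matrix with entry $\ell_s(j,k)$ in row $j\ge0$ and column $k\ge 0$. Thus $f(\Gamma_s)=f(\Delta)L_s$ means $f_{k}(\Gamma_s)=\sum_{j\ge-1}f_j(\Delta)\,\ell_s(j+1,k+1)$ for all $k\ge-1$. For $s\in\mathbb{N}$ let $\mathcal{J}_s(X)=\bigcup_{x\in X}\{x_0,\dots,x_s\}$ (new distinct variables). Let $\phi_s\colon\Bbbk[X]\to\Bbbk[\mathcal{J}_s(X)][t]/\langle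 t^{s+1}\rangle$ be the $\Bbbk$-algebra homomorphism with $\phi_s(x)=\sum_{j=0}^s x_jt^j$. For an ideal $J=\langle g_1,\dots,g_r\rangle$ of $\Bbbk[X]$, the ideal of $s$-jets $\mathcal{J}_s(J)\subseteq\Bbbk[\mathcal{J}_s(X)]$ is generated by the $g_{i,j}$ determined by $\phi_s(g_i)=\sum_{j=0}^s g_{i,j}t^j$. Ideal of principal $s$-jets: for an ideal $I$ of $\Bbbk[X]$, let $Z$ be the vanishing locus of $I$ in $\mathbb{A}^{|X|}_\Bbbk=\operatorname{Spec}\Bbbk[X]$ with its reduced structure, $Z_{\text{sing}}$ its singular locus, and write $\mathbb{I}(\cdot)$ for the ideal of polynomials vanishing on a subset of affine space (so $\mathbb{I}(Z)=\sqrt I$). The jet scheme $\mathcal{J}_s(\mathbb{A}^{|X|}_\Bbbk)$ is $\operatorname{Spec}\Bbbk[\mathcal{J}_s(X)]$, $\mathcal{J}_s(Z)$ is the vanishing locus in it of $\mathcal{J}_s(\mathbb{I}(Z))$, and $\pi_s\colon\mathcal{J}_s(\mathbb{A}^{|X|}_\Bbbk)\to\mathbb{A}^{|X|}_\Bbbk$ is the projection corresponding to $x\mapsto x_0$. Then $\mathcal{P}_s(I)=\mathbb{I}\bigl(\overline{\mathcal{J}_s(Z)\setminus\pi_s^{-1}(Z_{\text{sing}})}\bigr)\subseteq\Bbbk[\mathcal{J}_s(X)]$, the bar denoting Zariski closure. *)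

theory Defs
  imports
    "HOL-Algebra.Ring_Divisibility"
    "HOL-Algebra.Ideal_Product"
    "HOL-Library.Poly_Mapping"
    "HOL-Library.Extended_Real"
    "HOL-Computational_Algebra.Polynomial"
begin

section \<open>Polynomial rings\<close>

text \<open>
  Power products with variables in a type are finitely supported exponent functions, polynomials
  are finitely supported coefficient functions on power products. The polynomial ring on a set
  \<open>X\<close> of variables (possibly empty, hence not a type) is the subring of polynomials involving
  only variables from \<open>X\<close>.
\<close>

type_synonym ('x, 'k) mpoly = "('x \<Rightarrow>\<^sub>0 nat) \<Rightarrow>\<^sub>0 'k"

definition mpoly_ring :: "'x set \<Rightarrow> ('x, 'k::comm_ring_1) mpoly ring" where
  "mpoly_ring X =
     \<lparr>carrier = {p. \<forall>m \<in> Poly_Mapping.keys p. Poly_Mapping.keys m \<subseteq> X},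
      mult = (*), one = 1, zero = 0, add = (+)\<rparr>"

definition mconst :: "'k \<Rightarrow> ('x, 'k::zero) mpoly" where
  "mconst c = Poly_Mapping.single 0 c"

definition power_product :: "('x \<Rightarrow>\<^sub>0 nat) \<Rightarrow> ('x, 'k::comm_ring_1) mpoly" where
  "power_product m = Poly_Mapping.single m 1"

definition mvar :: "'x \<Rightarrow> ('x, 'k::comm_ring_1) mpoly" where
  "mvar x = power_product (Poly_Mapping.single x 1)"

text \<open>Coefficients are mapped by \<open>c\<close>, variables by \<open>v\<close>.\<close>

definition mpoly_eval ::
  "('k \<Rightarrow> 'r) \<Rightarrow> ('x \<Rightarrow> 'r) \<Rightarrow> ('x, 'k::zero) mpoly \<Rightarrow> 'r::comm_semiring_1" where
  "mpoly_eval c v p =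
     (\<Sum>m \<in> Poly_Mapping.keys p. c (Poly_Mapping.lookup p m) *
        (\<Prod>x \<in> Poly_Mapping.keys m. v x ^ Poly_Mapping.lookup m x))"


section \<open>Simplicial complexes and Stanley--Reisner ideals\<close>

definition simplicial_complex :: "'x set \<Rightarrow> 'x set set \<Rightarrow> bool" where
  "simplicial_complex X \<Delta> \<longleftrightarrow> \<Delta> \<subseteq> Pow X \<and> {} \<in> \<Delta> \<and> (\<forall>F \<in> \<Delta>. \<forall>G. G \<subseteq> F \<longrightarrow> G \<in> \<Delta>)"

definition squarefree_on :: "'x set \<Rightarrow> ('x \<Rightarrow>\<^sub>0 nat) \<Rightarrow> bool" where
  "squarefree_on X m \<longleftrightarrow>
     Poly_Mapping.keys m \<subseteq> X \<and> (\<forall>x. Poly_Mapping.lookup m x \<le> 1)"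

definition squarefree_monomial_ideal :: "'x set \<Rightarrow> ('x, 'k::comm_ring_1) mpoly set \<Rightarrow> bool" where
  "squarefree_monomial_ideal X I \<longleftrightarrow>
     (\<exists>M. (\<forall>m \<in> M. squarefree_on X m) \<and> I = genideal (mpoly_ring X) (power_product ` M))"

definition stanley_reisner_ideal ::
  "'x set \<Rightarrow> 'x set set \<Rightarrow> ('x, 'k::comm_ring_1) mpoly set \<Rightarrow> bool" where
  "stanley_reisner_ideal X \<Delta> I \<longleftrightarrow>
     squarefree_monomial_ideal X I \<and>
     \<Delta> = {Poly_Mapping.keys m | m. squarefree_on X m \<and> power_product m \<notin> I}"

text \<open>
  Indices are shifted by one to start at \<open>0\<close>: the entry at \<open>j\<close> is the number \<open>f\<^sub>j\<^sub>-\<^sub>1\<close> of faces of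
  cardinality \<open>j\<close>, which matches the row index of the lifting matrix.
\<close>

definition f_vector :: "'x set set \<Rightarrow> nat \<Rightarrow> nat" where
  "f_vector \<Delta> j = card {F \<in> \<Delta>. card F = j}"

definition lifting_matrix :: "nat \<Rightarrow> nat \<Rightarrow> nat \<Rightarrow> nat" where
  "lifting_matrix s j k =
     (\<Sum>a \<in> {a :: nat list. length a = j \<and> (\<forall>h \<in> set a. 0 < h) \<and> sum_list a = k}.
        prod_list (map (\<lambda>h. (s + 1) choose h) a))"

text \<open>
  \<^const>\<open>Sum_any\<close> is the sum over all indices of a finitely supported family; the entries of an
  \<open>f\<close>-vector of a finite complex vanish from some point on.
\<close>

definition row_times_matrix :: "(nat \<Rightarrow> nat) \<Rightarrow> (nat \<Rightarrow> nat \<Rightarrow> nat) \<Rightarrow> nat \<Rightarrow> nat" where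
  "row_times_matrix v M k = Sum_any (\<lambda>j. v j * M j k)"


section \<open>Krull dimension, length and multiplicity\<close>

text \<open>Supremum of the lengths \<open>n\<close> of strict chains \<open>C\<^sub>0 \<subset> \<dots> \<subset> C\<^sub>n\<close> in a family of sets.\<close>

definition chain_length :: "'a set set \<Rightarrow> enat" where
  "chain_length \<F> =
     (SUP n \<in> {n. \<exists>C. (\<forall>i \<le> n. C i \<in> \<F>) \<and> (\<forall>i < n. C i \<subset> C (Suc i))}. enat n)"

definition krull_dim :: "('a, 'm) ring_scheme \<Rightarrow> enat" where
  "krull_dim R = chain_length {P. primeideal P R}"

text \<open>
  Length of a commutative ring as a module over itself. For an ideal \<open>J\<close> of \<open>A\<close> this gives the
  length of the \<open>A\<close>-module \<open>A/J\<close>, whose submodules are the ideals of the ring \<open>A/J\<close>.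
\<close>

definition ring_length :: "('a, 'm) ring_scheme \<Rightarrow> enat" where
  "ring_length R = chain_length {J. ideal J R}"

primrec ideal_power :: "('a, 'm) ring_scheme \<Rightarrow> 'a set \<Rightarrow> nat \<Rightarrow> 'a set" where
  "ideal_power R J 0 = carrier R"
| "ideal_power R J (Suc n) = ideal_prod R J (ideal_power R J n)"

text \<open>
  Hilbert--Samuel multiplicity of \<open>A\<close>, of dimension \<open>d\<close>, with respect to the ideal \<open>\<mm>\<close>: the
  limit of \<open>d! \<cdot> length (A/\<mm>\<^sup>n) / n\<^sup>d\<close>. It is a relation so that existence of the limit (and
  finiteness of the dimension) is part of the assertion.
\<close>

definition has_multiplicity :: "('a, 'm) ring_scheme \<Rightarrow> 'a set \<Rightarrow> real \<Rightarrow> bool" where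
  "has_multiplicity A \<mm> e \<longleftrightarrow>
     (\<exists>d. krull_dim A = enat d \<and>
        (\<lambda>n. ereal (fact d / real n ^ d) * ereal_of_enat (ring_length (A Quot ideal_power A \<mm> n)))
          \<longlonglongrightarrow> ereal e)"

text \<open>
  For a standard graded quotient \<open>\<bbbk>[X]/I\<close>, the ideal \<open>\<mm>\<close> is the ideal generated by the classes of
  the variables.
\<close>

definition has_graded_multiplicity ::
  "'x set \<Rightarrow> ('x, 'k::comm_ring_1) mpoly set \<Rightarrow> real \<Rightarrow> bool" where
  "has_graded_multiplicity X I e \<longleftrightarrow>
     (let R = mpoly_ring X; A = R Quot I
      in has_multiplicity A (genideal A ((\<lambda>x. I +>\<^bsub>R\<^esub> mvar x) ` X)) e)"


section \<open>Localization and regular local rings\<close>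

text \<open>
  The fraction \<open>a/s\<close> in the localization of \<open>R\<close> at a prime \<open>P\<close>, as the class of all pairs
  \<open>(b, t)\<close> with \<open>u (t a - s b) = 0\<close> for some \<open>u \<notin> P\<close>.
\<close>

definition fraction ::
  "('a, 'm) ring_scheme \<Rightarrow> 'a set \<Rightarrow> 'a \<Rightarrow> 'a \<Rightarrow> ('a \<times> 'a) set" where
  "fraction R P a s =
     {(b, t). b \<in> carrier R \<and> t \<in> carrier R - P \<and>
        (\<exists>u \<in> carrier R - P. u \<otimes>\<^bsub>R\<^esub> (t \<otimes>\<^bsub>R\<^esub> a) = u \<otimes>\<^bsub>R\<^esub> (s \<otimes>\<^bsub>R\<^esub> b))}"

definition localization ::
  "('a, 'm) ring_scheme \<Rightarrow> 'a set \<Rightarrow> ('a \<times> 'a) set ring" where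
  "localization R P =
     \<lparr>carrier = {fraction R P a s | a s. a \<in> carrier R \<and> s \<in> carrier R - P},
      mult = (\<lambda>C D. \<Union>(a, s) \<in> C. \<Union>(b, t) \<in> D. fraction R P (a \<otimes>\<^bsub>R\<^esub> b) (s \<otimes>\<^bsub>R\<^esub> t)),
      one = fraction R P \<one>\<^bsub>R\<^esub> \<one>\<^bsub>R\<^esub>,
      zero = fraction R P \<zero>\<^bsub>R\<^esub> \<one>\<^bsub>R\<^esub>,
      add = (\<lambda>C D. \<Union>(a, s) \<in> C. \<Union>(b, t) \<in> D.
               fraction R P ((a \<otimes>\<^bsub>R\<^esub> t) \<oplus>\<^bsub>R\<^esub> (b \<otimes>\<^bsub>R\<^esub> s)) (s \<otimes>\<^bsub>R\<^esub> t))\<rparr>"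

definition regular_local_ring :: "('a, 'm) ring_scheme \<Rightarrow> bool" where
  "regular_local_ring R \<longleftrightarrow>
     cring R \<and> noetherian_ring R \<and>
     (\<exists>\<mm>. {J. maximalideal J R} = {\<mm>} \<and>
        (\<exists>S \<subseteq> carrier R. finite S \<and> \<mm> = genideal R S \<and> krull_dim R = enat (card S)))"


section \<open>Spectra\<close>

definition spec :: "('a, 'm) ring_scheme \<Rightarrow> 'a set set" where
  "spec R = {P. primeideal P R}"

definition vanishing_locus :: "('a, 'm) ring_scheme \<Rightarrow> 'a set \<Rightarrow> 'a set set" where
  "vanishing_locus R J = {P \<in> spec R. J \<subseteq> P}"

text \<open>A ring element vanishes at a point \<open>P\<close> of the spectrum iff it lies in \<open>P\<close>.\<close>

definition vanishing_ideal :: "('a, 'm) ring_scheme \<Rightarrow> 'a set set \<Rightarrow> 'a set" where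
  "vanishing_ideal R Z = {f \<in> carrier R. \<forall>P \<in> Z. f \<in> P}"

definition zariski_closure :: "('a, 'm) ring_scheme \<Rightarrow> 'a set set \<Rightarrow> 'a set set" where
  "zariski_closure R Z = \<Inter>{vanishing_locus R J | J. ideal J R \<and> Z \<subseteq> vanishing_locus R J}"

text \<open>
  For a closed subset \<open>Z\<close> of the spectrum with its reduced structure: the points whose local ring
  on \<open>Z\<close>, the localization of \<open>R/\<I>(Z)\<close> at \<open>P/\<I>(Z)\<close>, is not regular.
\<close>

definition singular_locus :: "('a, 'm) ring_scheme \<Rightarrow> 'a set set \<Rightarrow> 'a set set" where
  "singular_locus R Z =
     {P \<in> Z. let J = vanishing_ideal R Z
             in \<not> regular_local_ring (localization (R Quot J) ((\<lambda>f. J +>\<^bsub>R\<^esub> f) ` P))}"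


section \<open>Jets\<close>

text \<open>The variable \<open>x\<^sub>j\<close> is the pair \<open>(x, j)\<close>.\<close>

definition jet_vars :: "nat \<Rightarrow> 'x set \<Rightarrow> ('x \<times> nat) set" where
  "jet_vars s X = X \<times> {..s}"

text \<open>
  The polynomial in \<open>t\<close> obtained by substituting \<open>x\<^sub>0 + x\<^sub>1 t + \<dots> + x\<^sub>s t\<^sup>s\<close> for each variable \<open>x\<close>.
  Working modulo \<open>t\<^sup>s\<^sup>+\<^sup>1\<close> means using only its coefficients at \<open>t\<^sup>j\<close> for \<open>j \<le> s\<close>.
\<close>

definition jet_subst :: "nat \<Rightarrow> ('x, 'k::comm_ring_1) mpoly \<Rightarrow> ('x \<times> nat, 'k) mpoly poly" where
  "jet_subst s = mpoly_eval (\<lambda>c. [:mconst c:]) (\<lambda>x. \<Sum>j\<le>s. Polynomial.monom (mvar (x, j)) j)"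

text \<open>
  The ideal of \<open>s\<close>-jets is computed from a finite generating set; it does not depend on which
  one is chosen.
\<close>

definition jet_ideal ::
  "nat \<Rightarrow> 'x set \<Rightarrow> ('x, 'k::comm_ring_1) mpoly set \<Rightarrow> ('x \<times> nat, 'k) mpoly set" where
  "jet_ideal s X J =
     (let G = (SOME G. finite G \<and> G \<subseteq> carrier (mpoly_ring X) \<and> J = genideal (mpoly_ring X) G)
      in genideal (mpoly_ring (jet_vars s X)) {Polynomial.coeff (jet_subst s g) j | g j. g \<in> G \<and> j \<le> s})"

text \<open>
  The projection on spectra, the preimage of a prime under the embedding \<open>x \<mapsto> x\<^sub>0\<close>.
\<close>

definition jet_projection ::
  "'x set \<Rightarrow> ('x \<times> nat, 'k::comm_ring_1) mpoly set \<Rightarrow> ('x, 'k) mpoly set" where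
  "jet_projection X Q =
     {f \<in> carrier (mpoly_ring X). mpoly_eval mconst (\<lambda>x. mvar (x, 0)) f \<in> Q}"

definition principal_jet_ideal ::
  "nat \<Rightarrow> 'x set \<Rightarrow> ('x, 'k::comm_ring_1) mpoly set \<Rightarrow> ('x \<times> nat, 'k) mpoly set" where
  "principal_jet_ideal s X I =
     (let R = mpoly_ring X;
          T = mpoly_ring (jet_vars s X);
          Z = vanishing_locus R I;
          jets_Z = vanishing_locus T (jet_ideal s X (vanishing_ideal R Z))
      in vanishing_ideal T
           (zariski_closure T {Q \<in> jets_Z. jet_projection X Q \<notin> singular_locus R Z}))"

end

theory Submission
  imports Defs
begin

text \<open>
  Write \<open>I\<close> as the span of the monomials whose support is not a face, that is, as the intersection
  of the primes \<open>P\<^sub>F = (x : x \<notin> F)\<close>. The generic point of a component is regular, and its jets give the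
  prime \<open>(x\<^sub>j : x \<notin> F)\<close>. Conversely, let \<open>P\<close> be a regular point and \<open>U\<close> the set of variables not
  vanishing at \<open>P\<close>. If \<open>A\<close> is the union of \<open>U\<close> and its link vertices, then \<open>A\<close> is a face, so only one
  component passes through \<open>P\<close>, and for \<open>x \<notin> A\<close> the jets of the monomial \<open>x \<cdot> \<Prod>U \<in> I\<close> force all \<open>x\<^sub>j\<close>
  to vanish over \<open>P\<close>. Hence the ideal of principal jets is spanned by the monomials whose support
  does not project to a face, and face numbers, dimension and multiplicity are obtained by counting.

  That \<open>A\<close> is a face when \<open>P\<close> is regular uses that a prime of \<open>\<bbbk>[X]\<close> at the end of a chain of length
  \<open>n\<close> needs at least \<open>n\<close> local generators. Instead of Krull's height theorem this is proved by
  counting: passing to a larger prime lowers the degree of growth of the dimension of \<open>\<bbbk>[X]/P\<close> in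
  bounded degree, while Taylor expansion at \<open>P\<close> to order \<open>N\<close> shows that \<open>|X|\<close> is at most the number
  of local generators plus the degree of growth.
\<close>

section \<open>Polynomials and monomials\<close>

text \<open>Regularity of the local ring at \<open>P\<close> provides two things measured by the
  same \<open>n\<close>: at most \<open>n\<close> generators of its maximal ideal, and a chain of
  primes of length \<open>n\<close> inside \<open>P\<close>. The chain bounds the growth left at
  \<open>P\<close> after starting from the component through its bottom prime, and saving a single
  generator then violates the count by exactly one.

  The counting of strict chains is done once and used twice. With the nonzero constants as
  multipliers it is the dimension theory of vector spaces; with the complement of \<open>P\<close>
  as multipliers it bounds lengths over the local ring at \<open>P\<close>.

  Taylor coefficients are Hasse derivatives: they carry no factorials, so the top coefficient of a
  nonzero polynomial remains a nonzero constant in every characteristic. The bounded degree is a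
  bound on each exponent, which makes the number of monomials exactly
  \<open>(N + 1) ^ card X\<close>; impossible polynomial inequalities in \<open>N\<close> are
  refuted by inserting the constant of the inequality for \<open>N\<close>.\<close>

abbreviation keys :: "('a \<Rightarrow>\<^sub>0 'b::zero) \<Rightarrow> 'a set" where
  "keys \<equiv> Poly_Mapping.keys"

abbreviation lookup :: "('a \<Rightarrow>\<^sub>0 'b::zero) \<Rightarrow> 'a \<Rightarrow> 'b" where
  "lookup \<equiv> Poly_Mapping.lookup"

definition polys :: "'x set \<Rightarrow> ('x, 'k::zero) mpoly set" where
  "polys X = {p. \<forall>m\<in>keys p. keys m \<subseteq> X}"

lemma carrier_mpoly_ring [simp]: "carrier (mpoly_ring X) = polys X"
  and mult_mpoly_ring [simp]: "mult (mpoly_ring X) = (*)"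
  and add_mpoly_ring [simp]: "add (mpoly_ring X) = (+)"
  and one_mpoly_ring [simp]: "one (mpoly_ring X) = 1"
  and zero_mpoly_ring [simp]: "zero (mpoly_ring X) = 0"
  by (simp_all add: mpoly_ring_def polys_def)

lemma keys_add_nat: "keys (a + b :: 'x \<Rightarrow>\<^sub>0 nat) = keys a \<union> keys b"
  by (auto simp: in_keys_iff lookup_add)

lemma keys_minus_subset: "keys (p - q :: 'a \<Rightarrow>\<^sub>0 'k::ab_group_add) \<subseteq> keys p \<union> keys q"
  by (auto simp: in_keys_iff lookup_minus)

lemma polys_0 [simp]: "0 \<in> polys X"
  by (simp add: polys_def)

lemma polys_1 [simp]: "1 \<in> polys X"
  by (simp add: polys_def)

lemma polys_add: "p \<in> polys X \<Longrightarrow> q \<in> polys X \<Longrightarrow> p + q \<in> polys X"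
  using Poly_Mapping.keys_add[of p q] by (auto simp: polys_def)

lemma polys_uminus: "p \<in> polys X \<Longrightarrow> - p \<in> polys X" for p :: "('x, 'k::ab_group_add) mpoly"
  by (auto simp: polys_def)

lemma polys_diff: "p \<in> polys X \<Longrightarrow> q \<in> polys X \<Longrightarrow> p - q \<in> polys X"
  for p :: "('x, 'k::ab_group_add) mpoly"
  using keys_minus_subset[of p q] by (auto simp: polys_def)

lemma polys_mult: "p \<in> polys X \<Longrightarrow> q \<in> polys X \<Longrightarrow> p * q \<in> polys X"
  using Poly_Mapping.keys_mult[of p q] by (fastforce simp: polys_def keys_add_nat)

lemma polys_sum: "(\<And>i. i \<in> A \<Longrightarrow> f i \<in> polys X) \<Longrightarrow> sum f A \<in> polys X"
  by (induction A rule: infinite_finite_induct) (auto intro: polys_add)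

lemma polys_prod: "(\<And>i. i \<in> A \<Longrightarrow> f i \<in> polys X) \<Longrightarrow> prod f A \<in> polys X"
  for f :: "'i \<Rightarrow> ('x, 'k::comm_ring_1) mpoly"
  by (induction A rule: infinite_finite_induct) (auto intro: polys_mult)

lemma polys_power: "p \<in> polys X \<Longrightarrow> p ^ n \<in> polys X" for p :: "('x, 'k::comm_ring_1) mpoly"
  by (induction n) (auto intro: polys_mult)

lemma polys_single: "keys m \<subseteq> X \<Longrightarrow> Poly_Mapping.single m c \<in> polys X"
  by (auto simp: polys_def)

lemma polys_mconst [simp]: "mconst c \<in> polys X"
  by (auto simp: polys_def mconst_def)

lemma polys_power_product: "keys m \<subseteq> X \<Longrightarrow> power_product m \<in> polys X"
  by (auto simp: power_product_def polys_single)

lemma polys_mvar: "x \<in> X \<Longrightarrow> mvar x \<in> polys X"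
  by (auto simp: mvar_def polys_power_product)

lemmas polys_closed = polys_add polys_uminus polys_diff polys_mult polys_sum polys_prod
  polys_power polys_single polys_power_product polys_mvar

lemma mconst_0 [simp]: "mconst 0 = 0"
  and mconst_1 [simp]: "mconst 1 = 1"
  by (simp_all add: mconst_def)

lemma mconst_add: "mconst (a + b) = mconst a + mconst b" for a :: "'k::comm_ring_1"
  by (simp add: mconst_def Poly_Mapping.single_add)

lemma mconst_uminus: "mconst (- a) = - mconst a" for a :: "'k::comm_ring_1"
  by (simp add: mconst_def single_uminus)

lemma mconst_mult: "mconst (a * b) = mconst a * mconst b" for a :: "'k::comm_ring_1"
  by (simp add: mconst_def mult_single)

lemma mconst_eq_0_iff [simp]: "mconst a = 0 \<longleftrightarrow> a = 0"
  by (metis mconst_0 mconst_def lookup_single_eq)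

lemma lookup_mconst_mult: "lookup (mconst c * p) m = c * lookup p m"
  for p :: "('x, 'k::comm_ring_1) mpoly"
  unfolding mconst_def mult_map_scale_conv_mult[symmetric]
  by (simp add: Poly_Mapping.map.rep_eq when_def)

lemma keys_mconst_mult: "keys (mconst c * p) \<subseteq> keys p" for p :: "('x, 'k::comm_ring_1) mpoly"
  by (auto simp: in_keys_iff lookup_mconst_mult)

lemma single_eq_mconst_mult: "Poly_Mapping.single m c = mconst c * power_product m"
  for c :: "'k::comm_ring_1"
  by (simp add: mconst_def power_product_def mult_single)

lemma power_product_add: "power_product (a + b) = power_product a * power_product b"
  by (simp add: power_product_def mult_single)

lemma power_product_0 [simp]: "power_product 0 = 1"
  by (simp add: power_product_def)

lemma keys_power_product [simp]: "keys (power_product m :: ('x, 'k::comm_ring_1) mpoly) = {m}"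
  by (simp add: power_product_def)

lemma mpoly_eq_sum: "p = (\<Sum>m\<in>keys p. mconst (lookup p m) * power_product m)"
  for p :: "('x, 'k::comm_ring_1) mpoly"
proof (rule poly_mapping_eqI)
  fix k
  have "lookup (\<Sum>m\<in>keys p. mconst (lookup p m) * power_product m) k
      = (\<Sum>m\<in>keys p. if k = m then lookup p k else 0)"
    unfolding lookup_sum
    by (intro sum.cong) (auto simp: lookup_mconst_mult power_product_def lookup_single when_def)
  also have "\<dots> = lookup p k"
    by (simp add: in_keys_iff)
  finally show "lookup p k = lookup (\<Sum>m\<in>keys p. mconst (lookup p m) * power_product m) k" ..
qed

text \<open>The index sets \<open>A\<close> and \<open>B\<close> may exceed the supports, so that
  chosen exponents such as \<open>0\<close> or the target \<open>m\<close> can be included whether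
  or not their coefficients vanish.\<close>

lemma lookup_mult_finite:
  fixes p q :: "'a::comm_monoid_add \<Rightarrow>\<^sub>0 'k::comm_semiring_1"
  assumes "finite A" "finite B" "keys p \<subseteq> A" "keys q \<subseteq> B"
  shows "lookup (p * q) m = (\<Sum>(a, b)\<in>{(a, b). a \<in> A \<and> b \<in> B \<and> a + b = m}. lookup p a * lookup q b)"
proof -
  have "lookup (p * q) m = (\<Sum>(a, b)\<in>{(a, b). a \<in> A \<and> b \<in> B}. lookup p a * lookup q b when m = a + b)"
  proof -
    have "lookup (p * q) m = (\<Sum>(a, b). lookup p a * lookup q b when m = a + b)"
      unfolding times_poly_mapping.rep_eq
      by (rule prod_fun_unfold_prod) (simp_all)
    also have "\<dots> = (\<Sum>(a, b)\<in>A \<times> B. lookup p a * lookup q b when m = a + b)"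
    proof (rule Sum_any.expand_superset)
      have zero: "lookup p a * lookup q b = 0" if "(a, b) \<notin> A \<times> B" for a b
      proof -
        from that have "a \<notin> keys p \<or> b \<notin> keys q" using assms(3,4) by auto
        then show ?thesis by (auto simp: in_keys_iff)
      qed
      show "{x. (case x of (a, b) \<Rightarrow> lookup p a * lookup q b when m = a + b) \<noteq> 0} \<subseteq> A \<times> B"
      proof
        fix x assume "x \<in> {x. (case x of (a, b) \<Rightarrow> lookup p a * lookup q b when m = a + b) \<noteq> 0}"
        then show "x \<in> A \<times> B"
          using zero[of "fst x" "snd x"] by (cases x) (auto simp: when_def split: if_splits)
      qed
    qed (use assms in simp)
    also have "A \<times> B = {(a, b). a \<in> A \<and> b \<in> B}" by auto
    finally show ?thesis .
  qed
  also have "\<dots> = (\<Sum>(a, b)\<in>{(a, b). a \<in> A \<and> b \<in> B \<and> a + b = m}. lookup p a * lookup q b)"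
  proof (rule sum.mono_neutral_cong_right)
    have "{(a, b). a \<in> A \<and> b \<in> B} = A \<times> B" by auto
    then show "finite {(a, b). a \<in> A \<and> b \<in> B}" using assms by simp
  qed (auto simp: when_def split: if_splits)
  finally show ?thesis .
qed

section \<open>The polynomial ring on a set of variables, its ideals and primes\<close>

lemma cring_mpoly_ring: "cring (mpoly_ring X)"
proof (intro cringI abelian_groupI comm_monoidI)
  fix x assume "x \<in> carrier (mpoly_ring X)"
  then show "\<exists>y\<in>carrier (mpoly_ring X). y \<oplus>\<^bsub>mpoly_ring X\<^esub> x = \<zero>\<^bsub>mpoly_ring X\<^esub>"
    by (intro bexI[of _ "- x"]) (auto intro: polys_closed)
qed (auto intro: polys_closed simp: algebra_simps)

lemma ring_mpoly_ring: "ring (mpoly_ring X)"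
  using cring_mpoly_ring by (rule cring.axioms)

lemma a_inv_mpoly_ring:
  fixes x :: "('x, 'k::comm_ring_1) mpoly"
  assumes x: "x \<in> polys X"
  shows "a_inv (mpoly_ring X) x = - x"
proof -
  interpret cring "mpoly_ring X :: ('x, 'k::comm_ring_1) mpoly ring" by (rule cring_mpoly_ring)
  have "\<ominus>\<^bsub>mpoly_ring X\<^esub> x = - x"
    by (rule minus_equality) (use x in \<open>auto intro: polys_closed\<close>)
  then show ?thesis .
qed

lemma idealI_mpoly:
  fixes J :: "('x, 'k::comm_ring_1) mpoly set"
  assumes "J \<subseteq> polys X" "0 \<in> J" "\<And>a b. a \<in> J \<Longrightarrow> b \<in> J \<Longrightarrow> a + b \<in> J"
    "\<And>r a. r \<in> polys X \<Longrightarrow> a \<in> J \<Longrightarrow> r * a \<in> J"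
  shows "ideal J (mpoly_ring X)"
proof -
  interpret cring "mpoly_ring X :: ('x, 'k::comm_ring_1) mpoly ring" by (rule cring_mpoly_ring)
  have inv: "inv\<^bsub>add_monoid (mpoly_ring X)\<^esub> a = - a" if "a \<in> polys X" for a :: "('x, 'k) mpoly"
    using a_inv_mpoly_ring[OF that] by (simp add: a_inv_def)
  have neg: "- a \<in> J" if "a \<in> J" for a
    using assms(4)[OF polys_uminus[OF polys_1] that] by simp
  show ?thesis
  proof (rule idealI[OF ring_mpoly_ring])
    show "subgroup J (add_monoid (mpoly_ring X))"
      by (rule subgroup.intro) (use assms inv neg in auto)
    show "x \<otimes>\<^bsub>mpoly_ring X\<^esub> a \<in> J" "a \<otimes>\<^bsub>mpoly_ring X\<^esub> x \<in> J"
      if "a \<in> J" "x \<in> carrier (mpoly_ring X)" for a x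
      using assms(4)[of x a] that by (simp_all add: mult.commute[of a x])
  qed
qed

lemma ideal_mpoly_iff:
  "ideal J (mpoly_ring X) \<longleftrightarrow> J \<subseteq> polys X \<and> 0 \<in> J \<and> (\<forall>a\<in>J. \<forall>b\<in>J. a + b \<in> J)
     \<and> (\<forall>r\<in>polys X. \<forall>a\<in>J. r * a \<in> J)"
proof
  assume J: "ideal J (mpoly_ring X)"
  have "0 \<in> J" "a + b \<in> J" if "a \<in> J" "b \<in> J" for a b
    using additive_subgroup.zero_closed[OF ideal.axioms(1)[OF J]]
      additive_subgroup.a_closed[OF ideal.axioms(1)[OF J] that] by simp_all
  then show "J \<subseteq> polys X \<and> 0 \<in> J \<and> (\<forall>a\<in>J. \<forall>b\<in>J. a + b \<in> J) \<and> (\<forall>r\<in>polys X. \<forall>a\<in>J. r * a \<in> J)"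
    using ideal.Icarr[OF J] additive_subgroup.zero_closed[OF ideal.axioms(1)[OF J]]
      ideal.I_l_closed[OF J] by auto
qed (auto intro!: idealI_mpoly)

lemma
  assumes "ideal J (mpoly_ring X)"
  shows ideal_mpoly_subset: "J \<subseteq> polys X"
    and ideal_mpoly_0: "0 \<in> J"
    and ideal_mpoly_add: "a \<in> J \<Longrightarrow> b \<in> J \<Longrightarrow> a + b \<in> J"
    and ideal_mpoly_mult: "r \<in> polys X \<Longrightarrow> a \<in> J \<Longrightarrow> r * a \<in> J"
  using assms by (auto simp: ideal_mpoly_iff)

lemma ideal_mpoly_uminus: "ideal J (mpoly_ring X) \<Longrightarrow> a \<in> J \<Longrightarrow> - a \<in> J"
  using ideal_mpoly_mult[of J X "- 1" a] polys_uminus[of 1 X] by simp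

lemma ideal_mpoly_diff: "ideal J (mpoly_ring X) \<Longrightarrow> a \<in> J \<Longrightarrow> b \<in> J \<Longrightarrow> a - b \<in> J"
  using ideal_mpoly_add[of J X a "- b"] ideal_mpoly_uminus[of J X b] by simp

lemma ideal_mpoly_sum: "ideal J (mpoly_ring X) \<Longrightarrow> (\<And>i. i \<in> A \<Longrightarrow> f i \<in> J) \<Longrightarrow> sum f A \<in> J"
  by (induction A rule: infinite_finite_induct) (auto intro: ideal_mpoly_0 ideal_mpoly_add)

lemma ideal_mpoly_cancel:
  assumes "ideal J (mpoly_ring X)" "b \<in> J" "a + b \<in> J"
  shows "a \<in> J"
  using ideal_mpoly_diff[OF assms(1,3,2)] by simp

lemma ideal_carrier_iff: "ideal J (mpoly_ring X) \<Longrightarrow> J = polys X \<longleftrightarrow> 1 \<in> J"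
  using ideal_mpoly_mult[of J X _ 1] ideal_mpoly_subset[of J X] by fastforce

lemma primeideal_mpoly_iff:
  "primeideal P (mpoly_ring X) \<longleftrightarrow> ideal P (mpoly_ring X) \<and> 1 \<notin> P \<and>
     (\<forall>a\<in>polys X. \<forall>b\<in>polys X. a * b \<in> P \<longrightarrow> a \<in> P \<or> b \<in> P)"
  using ideal_carrier_iff[of P X] cring_mpoly_ring[of X]
  by (auto simp: primeideal_def primeideal_axioms_def)

lemma
  assumes "primeideal P (mpoly_ring X)"
  shows primeideal_mpoly_ideal: "ideal P (mpoly_ring X)"
    and primeideal_mpoly_1: "1 \<notin> P"
    and primeideal_mpoly_mult: "a \<in> polys X \<Longrightarrow> b \<in> polys X \<Longrightarrow> a * b \<in> P \<Longrightarrow> a \<in> P \<or> b \<in> P"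
  using assms by (auto simp: primeideal_mpoly_iff)

lemma primeideal_mpoly_prod:
  assumes P: "primeideal P (mpoly_ring X)" and "finite A" "\<And>i. i \<in> A \<Longrightarrow> f i \<in> polys X - P"
  shows "prod f A \<in> polys X - P"
  using assms(2,3)
  by (induction A rule: finite_induct)
     (use primeideal_mpoly_1[OF P] primeideal_mpoly_mult[OF P] in \<open>auto intro: polys_closed\<close>)

lemma genideal_mpoly_ideal: "S \<subseteq> polys X \<Longrightarrow> ideal (genideal (mpoly_ring X) S) (mpoly_ring X)"
  by (rule ring.genideal_ideal[OF ring_mpoly_ring]) simp

lemma genideal_mpoly_self: "S \<subseteq> polys X \<Longrightarrow> S \<subseteq> genideal (mpoly_ring X) S"
  by (rule ring.genideal_self[OF ring_mpoly_ring]) simp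

lemma genideal_mpoly_minimal: "ideal J (mpoly_ring X) \<Longrightarrow> S \<subseteq> J \<Longrightarrow> genideal (mpoly_ring X) S \<subseteq> J"
  by (rule ring.genideal_minimal[OF ring_mpoly_ring])

text \<open>This replaces a term order: the type of variables carries no order.\<close>

lemma ex_unique_sum:
  fixes A B :: "('x \<Rightarrow>\<^sub>0 nat) set"
  assumes "finite Y" "finite A" "finite B" "A \<noteq> {}" "B \<noteq> {}"
    and "\<And>a a' x. a \<in> A \<Longrightarrow> a' \<in> A \<Longrightarrow> x \<notin> Y \<Longrightarrow> lookup a x = lookup a' x"
    and "\<And>b b' x. b \<in> B \<Longrightarrow> b' \<in> B \<Longrightarrow> x \<notin> Y \<Longrightarrow> lookup b x = lookup b' x"
  shows "\<exists>a\<in>A. \<exists>b\<in>B. \<forall>a'\<in>A. \<forall>b'\<in>B. a' + b' = a + b \<longrightarrow> a' = a \<and> b' = b"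
  using assms
proof (induction Y arbitrary: A B rule: finite_induct)
  case empty
  then have "a' = a" if "a \<in> A" "a' \<in> A" for a a'
    using that by (intro poly_mapping_eqI) blast
  moreover from empty have "b' = b" if "b \<in> B" "b' \<in> B" for b b'
    using that by (intro poly_mapping_eqI) blast
  ultimately show ?case
    using empty by blast
next
  case (insert y Y)
  \<comment> \<open>One stage of a lexicographic comparison: a pair with the same sum as two
    elements of maximal \<open>y\<close>-exponent must itself have maximal
    \<open>y\<close>-exponents. On the selected elements the \<open>y\<close>-exponent is constant,
    so the induction hypothesis for \<open>Y\<close> applies.\<close>
  define top where "top C = {a\<in>C. lookup a y = Max ((\<lambda>a. lookup a y) ` C)}" for C :: "('x \<Rightarrow>\<^sub>0 nat) set"
  have top_ne: "top C \<noteq> {}" if "finite C" "C \<noteq> {}" for C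
  proof -
    have "Max ((\<lambda>a. lookup a y) ` C) \<in> (\<lambda>a. lookup a y) ` C" using that by (intro Max_in) auto
    then show ?thesis by (force simp: top_def)
  qed
  have le: "lookup a y \<le> Max ((\<lambda>a. lookup a y) ` C)" if "finite C" "a \<in> C" for a C
    using that by simp
  have "\<exists>a\<in>top A. \<exists>b\<in>top B. \<forall>a'\<in>top A. \<forall>b'\<in>top B. a' + b' = a + b \<longrightarrow> a' = a \<and> b' = b"
  proof (rule insert.IH)
    show "lookup a x = lookup a' x" if "a \<in> top A" "a' \<in> top A" "x \<notin> Y" for a a' x
      using that insert.prems(5)[of a a' x] by (cases "x = y") (auto simp: top_def)
    show "lookup a x = lookup a' x" if "a \<in> top B" "a' \<in> top B" "x \<notin> Y" for a a' x
      using that insert.prems(6)[of a a' x] by (cases "x = y") (auto simp: top_def)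
  qed (use insert.prems top_ne in \<open>auto simp: top_def\<close>)
  then obtain a b where ab: "a \<in> top A" "b \<in> top B"
    and uniq: "\<And>a' b'. a' \<in> top A \<Longrightarrow> b' \<in> top B \<Longrightarrow> a' + b' = a + b \<Longrightarrow> a' = a \<and> b' = b"
    by blast
  have "a' = a \<and> b' = b" if "a' \<in> A" "b' \<in> B" "a' + b' = a + b" for a' b'
  proof (rule uniq)
    have "lookup a' y + lookup b' y = lookup a y + lookup b y"
      using that(3) by (metis lookup_add)
    then show "a' \<in> top A" "b' \<in> top B"
      using ab that le[OF insert.prems(1) that(1)] le[OF insert.prems(2) that(2)] by (auto simp: top_def)
  qed fact
  with ab show ?case by (auto simp: top_def)
qed

section \<open>Ideals prescribed by supports of monomials\<close>

definition face_ideal :: "'x set \<Rightarrow> 'x set \<Rightarrow> ('x, 'k::comm_ring_1) mpoly set" where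
  "face_ideal X F = {p \<in> polys X. \<forall>m\<in>keys p. \<not> keys m \<subseteq> F}"

definition nonface_ideal :: "'x set \<Rightarrow> 'x set set \<Rightarrow> ('x, 'k::comm_ring_1) mpoly set" where
  "nonface_ideal X \<Delta> = {p \<in> polys X. \<forall>m\<in>keys p. keys m \<notin> \<Delta>}"

text \<open>Several ideals below are prescribed by the exponents allowed to occur; what remains to
  be checked for them is that multiplication by a monomial keeps an exponent in
  \<open>M\<close>.\<close>

lemma ideal_monomials:
  fixes X :: "'x set"
  assumes "\<And>a b. keys a \<subseteq> X \<Longrightarrow> keys b \<subseteq> X \<Longrightarrow> a \<in> M \<Longrightarrow> b + a \<in> M"
  shows "ideal {p :: ('x, 'k::comm_ring_1) mpoly. p \<in> polys X \<and> keys p \<subseteq> M} (mpoly_ring X)"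
proof (rule idealI_mpoly)
  fix r a :: "('x, 'k) mpoly"
  assume r: "r \<in> polys X" and a: "a \<in> {p. p \<in> polys X \<and> keys p \<subseteq> M}"
  have "keys (r * a) \<subseteq> M"
  proof
    fix m assume "m \<in> keys (r * a)"
    then obtain c b where "m = c + b" "c \<in> keys r" "b \<in> keys a"
      using Poly_Mapping.keys_mult[of r a] by blast
    then show "m \<in> M" using assms[of b c] r a by (auto simp: polys_def)
  qed
  with r a show "r * a \<in> {p. p \<in> polys X \<and> keys p \<subseteq> M}" by (auto intro: polys_mult)
next
  fix a b :: "('x, 'k) mpoly"
  assume "a \<in> {p. p \<in> polys X \<and> keys p \<subseteq> M}" "b \<in> {p. p \<in> polys X \<and> keys p \<subseteq> M}"
  then show "a + b \<in> {p. p \<in> polys X \<and> keys p \<subseteq> M}"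
    using Poly_Mapping.keys_add[of a b] by (auto intro: polys_add)
qed auto

lemma ideal_nonface_ideal:
  fixes X :: "'x set"
  assumes "\<And>F G. F \<in> \<Delta> \<Longrightarrow> G \<subseteq> F \<Longrightarrow> G \<in> \<Delta>"
  shows "ideal (nonface_ideal X \<Delta> :: ('x, 'k::comm_ring_1) mpoly set) (mpoly_ring X)"
proof -
  have eq: "nonface_ideal X \<Delta> = {p :: ('x, 'k) mpoly. p \<in> polys X \<and> keys p \<subseteq> {m. keys m \<notin> \<Delta>}}"
    by (auto simp: nonface_ideal_def)
  have "b + a \<in> {m. keys m \<notin> \<Delta>}" if "a \<in> {m. keys m \<notin> \<Delta>}" for a b :: "'x \<Rightarrow>\<^sub>0 nat"
    using assms[of "keys a \<union> keys b" "keys a"] that by (auto simp: keys_add_nat Un_commute)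
  then show ?thesis unfolding eq by (intro ideal_monomials)
qed

lemma face_ideal_eq_nonface_ideal: "face_ideal X F = nonface_ideal X (Pow F)"
  by (auto simp: face_ideal_def nonface_ideal_def)

lemma ideal_face_ideal: "ideal (face_ideal X F) (mpoly_ring X)"
  unfolding face_ideal_eq_nonface_ideal by (rule ideal_nonface_ideal) auto

text \<open>Modulo the ideal only terms supported in \<open>F\<close> remain. Two nonzero such parts
  have a pair of exponents whose sum arises in no other way, and its coefficient in the product is a
  product of nonzero elements of an integral domain.\<close>

lemma primeideal_face_ideal:
  fixes X F :: "'x set"
  assumes "finite X"
  shows "primeideal (face_ideal X F :: ('x, 'k::idom) mpoly set) (mpoly_ring X)"
  unfolding primeideal_mpoly_iff
proof (intro conjI ballI impI)
  show "1 \<notin> (face_ideal X F :: ('x, 'k) mpoly set)"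
    by (simp add: face_ideal_def)
  fix f g :: "('x, 'k) mpoly"
  assume f: "f \<in> polys X" and g: "g \<in> polys X" and fg: "f * g \<in> face_ideal X F"
  show "f \<in> face_ideal X F \<or> g \<in> face_ideal X F"
  proof (rule ccontr)
    assume neg: "\<not> ?thesis"
    define A where "A = {m\<in>keys f. keys m \<subseteq> F}"
    define B where "B = {m\<in>keys g. keys m \<subseteq> F}"
    have "\<exists>a\<in>A. \<exists>b\<in>B. \<forall>a'\<in>A. \<forall>b'\<in>B. a' + b' = a + b \<longrightarrow> a' = a \<and> b' = b"
    proof (rule ex_unique_sum[OF assms])
      have "lookup a x = 0" if "a \<in> A \<or> a \<in> B" "x \<notin> X" for a x
        using f g that by (auto simp: A_def B_def polys_def in_keys_iff subset_iff)
      then show "\<And>a a' x. a \<in> A \<Longrightarrow> a' \<in> A \<Longrightarrow> x \<notin> X \<Longrightarrow> lookup a x = lookup a' x"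
        "\<And>a a' x. a \<in> B \<Longrightarrow> a' \<in> B \<Longrightarrow> x \<notin> X \<Longrightarrow> lookup a x = lookup a' x" by auto
    qed (use neg f g in \<open>auto simp: A_def B_def face_ideal_def\<close>)
    then obtain a b where ab: "a \<in> A" "b \<in> B"
      and uniq: "\<And>a' b'. a' \<in> A \<Longrightarrow> b' \<in> B \<Longrightarrow> a' + b' = a + b \<Longrightarrow> a' = a \<and> b' = b" by blast
    \<comment> \<open>Terms not supported in \<open>F\<close> cannot interfere: the support of a sum
      of exponents is the union of the supports.\<close>
    have "a' = a \<and> b' = b" if "a' \<in> keys f" "b' \<in> keys g" "a' + b' = a + b" for a' b'
    proof (rule uniq)
      have "keys a' \<union> keys b' = keys a \<union> keys b" using that(3) by (metis keys_add_nat)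
      then show "a' \<in> A" "b' \<in> B" using ab that by (auto simp: A_def B_def)
    qed fact
    then have "{(a', b'). a' \<in> keys f \<and> b' \<in> keys g \<and> a' + b' = a + b} = {(a, b)}"
      using ab by (auto simp: A_def B_def)
    then have "lookup (f * g) (a + b) = lookup f a * lookup g b"
      by (subst lookup_mult_finite[of "keys f" "keys g"]) auto
    then have "a + b \<in> keys (f * g)"
      using ab by (auto simp: A_def B_def in_keys_iff)
    moreover have "keys (a + b) \<subseteq> F"
      using ab by (auto simp: A_def B_def keys_add_nat)
    ultimately show False using fg by (auto simp: face_ideal_def)
  qed
qed (rule ideal_face_ideal)

section \<open>Strict chains, relative dimension and growth\<close>

text \<open>A Jordan--Hoelder argument: each step of the chain \<open>G\<close> has length at most one up to
  multiplication by \<open>U\<close>, and the \<open>U\<close>-saturated members of \<open>K\<close> are told apart by the set of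
  steps of \<open>G\<close> at which they have an element with invertible leading coefficient.\<close>

lemma composition_jumps:
  fixes G K :: "nat \<Rightarrow> 'a::comm_ring_1 set"
  assumes K_diff: "\<And>i a b. i \<le> c \<Longrightarrow> a \<in> K i \<Longrightarrow> b \<in> K i \<Longrightarrow> a - b \<in> K i"
    and K_mult: "\<And>i u f. i \<le> c \<Longrightarrow> u \<in> U \<Longrightarrow> f \<in> K i \<Longrightarrow> u * f \<in> K i"
    and K_sat: "\<And>i u f. i \<le> c \<Longrightarrow> u \<in> U \<Longrightarrow> f \<in> G M \<Longrightarrow> u * f \<in> K i \<Longrightarrow> f \<in> K i"
    and K_Suc: "\<And>i. i < c \<Longrightarrow> K i \<subseteq> K (Suc i)"
    and bot: "G 0 \<subseteq> K 0" and top: "K c \<subseteq> G M"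
    and G_diff: "\<And>s a b. s \<le> M \<Longrightarrow> a \<in> G s \<Longrightarrow> b \<in> G s \<Longrightarrow> a - b \<in> G s"
    and G_mult: "\<And>s u f. s \<le> M \<Longrightarrow> u \<in> U \<Longrightarrow> f \<in> G s \<Longrightarrow> u * f \<in> G s"
    and step: "\<And>s f. s < M \<Longrightarrow> f \<in> G (Suc s) \<Longrightarrow> \<exists>u\<in>U. \<exists>a\<in>insert 0 U. u * f - a * w s \<in> G s"
    and G_mono: "\<And>s. s < M \<Longrightarrow> G s \<subseteq> G (Suc s)"
  shows "card {i. i < c \<and> K i \<noteq> K (Suc i)} \<le> M"
proof -
  \<comment> \<open>\<open>S L\<close> records the steps \<open>s\<close> at which \<open>L\<close>
    has an element of \<open>G (Suc s)\<close> whose coefficient at \<open>w s\<close> counts as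
    invertible, that is, belongs to \<open>U\<close>.\<close>
  define S where "S L = {s. s < M \<and> (\<exists>f\<in>L \<inter> G (Suc s). \<exists>u\<in>U. \<exists>a\<in>U. u * f - a * w s \<in> G s)}" for L
  have S_mono: "S L \<subseteq> S L'" if "L \<subseteq> L'" for L L'
    using that unfolding S_def by blast
  have K_mono: "K i \<subseteq> K j" if "i \<le> j" "j \<le> c" for i j
    using that
  proof (induction j rule: dec_induct)
    case (step n)
    then show ?case using K_Suc[of n] by auto
  qed simp
  have S_strict: "S (K i) \<subset> S (K (Suc i))" if i: "i < c" and ne: "K i \<noteq> K (Suc i)" for i
  proof -
    have strict: "K i \<subset> K (Suc i)" using K_Suc[OF i] ne by blast
    have "S (K i) \<noteq> S (K (Suc i))"
    proof
      assume eq: "S (K i) = S (K (Suc i))"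
      \<comment> \<open>With no new step, elements of \<open>K (Suc i)\<close> are brought into
        \<open>K i\<close> along the filtration: a leading term at \<open>w s\<close> is cancelled
        by an element of \<open>K i\<close> with a leading term there, and saturation removes the
        multipliers.\<close>
      have "K (Suc i) \<inter> G s \<subseteq> K i" if "s \<le> M" for s
        using that
      proof (induction s)
        case 0
        then show ?case using bot K_mono[of 0 i] i by auto
      next
        case (Suc s)
        show ?case
        proof
          fix f assume f: "f \<in> K (Suc i) \<inter> G (Suc s)"
          then obtain u a where u: "u \<in> U" and a: "a \<in> insert 0 U" and g: "u * f - a * w s \<in> G s"
            using step[of s f] Suc.prems by (meson IntD2 Suc_le_eq)
          have fM: "f \<in> G M" using f top K_mono[of "Suc i" c] i by auto
          show "f \<in> K i"
          proof (cases "a = 0")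
            case True
            then have "u * f \<in> K (Suc i) \<inter> G s" using g u f i K_mult[of "Suc i" u f] by auto
            then have "u * f \<in> K i" using Suc by auto
            then show ?thesis using K_sat[of i u f] u fM i by auto
          next
            case False
            then have aU: "a \<in> U" using a by simp
            then have "s \<in> S (K (Suc i))" unfolding S_def using f u g Suc.prems by auto
            then have "s \<in> S (K i)" by (simp add: eq)
            then obtain h u' a' where h: "h \<in> K i" "h \<in> G (Suc s)" and u': "u' \<in> U" and a': "a' \<in> U"
              and g': "u' * h - a' * w s \<in> G s" unfolding S_def by auto
            \<comment> \<open>Cross-multiplication by the two leading coefficients eliminates
              \<open>w s\<close>.\<close>
            have "a' * (u * f - a * w s) - a * (u' * h - a' * w s) \<in> G s"
              using Suc.prems g g' aU a' G_mult G_diff by auto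
            then have "a' * (u * f) - a * (u' * h) \<in> G s" by (simp add: algebra_simps)
            moreover have hi: "a * (u' * h) \<in> K i" using h u' aU i K_mult[of i] by auto
            moreover have "a' * (u * f) - a * (u' * h) \<in> K (Suc i)"
              using f u a' i K_mult[of "Suc i"] K_diff[of "Suc i"] hi strict by auto
            ultimately have "a' * (u * f) - a * (u' * h) \<in> K i" using Suc by auto
            moreover have "0 - a * (u' * h) \<in> K i"
              using K_diff[of i, OF _ K_diff[of i, OF _ hi hi] hi] i by simp
            ultimately have "(a' * (u * f) - a * (u' * h)) - (0 - a * (u' * h)) \<in> K i"
              by (rule K_diff[OF less_imp_le[OF i]])
            then have af: "a' * (u * f) \<in> K i" by simp
            have "u * f \<in> G M" using G_mult[of M u f] u fM by auto
            then have "u * f \<in> K i" using af K_sat[of i a' "u * f"] a' i by auto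
            then show ?thesis using K_sat[of i u f] u fM i by auto
          qed
        qed
      qed
      from this[of M] top K_mono[of "Suc i" c] i strict show False by auto
    qed
    with S_mono strict show ?thesis by auto
  qed
  \<comment> \<open>Each strict step of \<open>K\<close> adds an element to \<open>S (K i)\<close>,
    which stays inside the \<open>M\<close> steps of \<open>G\<close>.\<close>
  have "card {j. j < i \<and> K j \<noteq> K (Suc j)} \<le> card (S (K i))" if "i \<le> c" for i
    using that
  proof (induction i)
    case (Suc i)
    have fin: "finite (S (K (Suc i)))" by (simp add: S_def)
    show ?case
    proof (cases "K i = K (Suc i)")
      case True
      then have "{j. j < Suc i \<and> K j \<noteq> K (Suc j)} = {j. j < i \<and> K j \<noteq> K (Suc j)}"
        by (auto simp: less_Suc_eq)
      then show ?thesis using True Suc by simp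
    next
      case False
      then have "{j. j < Suc i \<and> K j \<noteq> K (Suc j)} = insert i {j. j < i \<and> K j \<noteq> K (Suc j)}"
        by (auto simp: less_Suc_eq)
      moreover have "card (S (K i)) < card (S (K (Suc i)))"
        using S_strict[OF _ False] Suc.prems fin by (auto intro: psubset_card_mono)
      ultimately show ?thesis using Suc by simp
    qed
  qed simp
  then have "card {i. i < c \<and> K i \<noteq> K (Suc i)} \<le> card (S (K c))" by simp
  also have "\<dots> \<le> card {..<M}" by (rule card_mono) (auto simp: S_def)
  finally show ?thesis by simp
qed

lemma composition_bound:
  fixes G K :: "nat \<Rightarrow> 'a::comm_ring_1 set"
  assumes "\<And>i a b. i \<le> c \<Longrightarrow> a \<in> K i \<Longrightarrow> b \<in> K i \<Longrightarrow> a - b \<in> K i"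
    and "\<And>i u f. i \<le> c \<Longrightarrow> u \<in> U \<Longrightarrow> f \<in> K i \<Longrightarrow> u * f \<in> K i"
    and "\<And>i u f. i \<le> c \<Longrightarrow> u \<in> U \<Longrightarrow> f \<in> G M \<Longrightarrow> u * f \<in> K i \<Longrightarrow> f \<in> K i"
    and strict: "\<And>i. i < c \<Longrightarrow> K i \<subset> K (Suc i)"
    and "G 0 \<subseteq> K 0" and "K c \<subseteq> G M"
    and "\<And>s a b. s \<le> M \<Longrightarrow> a \<in> G s \<Longrightarrow> b \<in> G s \<Longrightarrow> a - b \<in> G s"
    and "\<And>s u f. s \<le> M \<Longrightarrow> u \<in> U \<Longrightarrow> f \<in> G s \<Longrightarrow> u * f \<in> G s"
    and "\<And>s f. s < M \<Longrightarrow> f \<in> G (Suc s) \<Longrightarrow> \<exists>u\<in>U. \<exists>a\<in>insert 0 U. u * f - a * w s \<in> G s"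
    and "\<And>s. s < M \<Longrightarrow> G s \<subseteq> G (Suc s)"
  shows "c \<le> M"
proof -
  have "{i. i < c \<and> K i \<noteq> K (Suc i)} = {..<c}" using strict by auto
  moreover have "card {i. i < c \<and> K i \<noteq> K (Suc i)} \<le> M"
    by (rule composition_jumps[OF assms(1-3) psubset_imp_subset[OF strict] assms(5-)])
  ultimately show ?thesis by simp
qed

section \<open>Dimension of a set of polynomials modulo a subspace\<close>

definition lin_subspace :: "('x, 'k::field) mpoly set \<Rightarrow> bool" where
  "lin_subspace W \<longleftrightarrow> 0 \<in> W \<and> (\<forall>a\<in>W. \<forall>b\<in>W. a + b \<in> W) \<and> (\<forall>c. \<forall>a\<in>W. mconst c * a \<in> W)"

lemma
  assumes "lin_subspace W"
  shows lin_subspace_0: "0 \<in> W"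
    and lin_subspace_add: "a \<in> W \<Longrightarrow> b \<in> W \<Longrightarrow> a + b \<in> W"
    and lin_subspace_mconst: "a \<in> W \<Longrightarrow> mconst c * a \<in> W"
  using assms by (auto simp: lin_subspace_def)

lemma lin_subspace_uminus: "lin_subspace W \<Longrightarrow> a \<in> W \<Longrightarrow> - a \<in> W"
  using lin_subspace_mconst[of W a "- 1"] by (simp add: mconst_uminus)

lemma lin_subspace_diff: "lin_subspace W \<Longrightarrow> a \<in> W \<Longrightarrow> b \<in> W \<Longrightarrow> a - b \<in> W"
  using lin_subspace_add[of W a "- b"] lin_subspace_uminus[of W b] by simp

lemma lin_subspace_sum: "lin_subspace W \<Longrightarrow> (\<And>i. i \<in> A \<Longrightarrow> f i \<in> W) \<Longrightarrow> sum f A \<in> W"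
  by (induction A rule: infinite_finite_induct) (auto intro: lin_subspace_0 lin_subspace_add)

lemma lin_subspace_mconst_cancel:
  assumes "lin_subspace W" "c \<noteq> 0" "mconst c * a \<in> W"
  shows "a \<in> W"
proof -
  have "mconst (inverse c) * (mconst c * a) \<in> W"
    using assms lin_subspace_mconst by blast
  then show ?thesis using assms(2) by (simp add: mult.assoc[symmetric] mconst_mult[symmetric])
qed

lemma lin_subspace_cancel:
  assumes "lin_subspace W" "b \<in> W" "a + b \<in> W"
  shows "a \<in> W"
  using lin_subspace_diff[OF assms(1,3,2)] by simp

lemma lin_subspace_ideal: "ideal J (mpoly_ring X) \<Longrightarrow> lin_subspace J"
  unfolding lin_subspace_def by (auto simp: ideal_mpoly_iff)

lemma lin_subspace_Int: "lin_subspace V \<Longrightarrow> lin_subspace W \<Longrightarrow> lin_subspace (V \<inter> W)"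
  by (auto simp: lin_subspace_def)

definition lin_comb :: "nat \<Rightarrow> (nat \<Rightarrow> 'k::field) \<Rightarrow> (nat \<Rightarrow> ('x, 'k) mpoly) \<Rightarrow> ('x, 'k) mpoly" where
  "lin_comb n c v = (\<Sum>i<n. mconst (c i) * v i)"

definition lin_indep_mod :: "('x, 'k::field) mpoly set \<Rightarrow> nat \<Rightarrow> (nat \<Rightarrow> ('x, 'k) mpoly) \<Rightarrow> bool" where
  "lin_indep_mod W n v \<longleftrightarrow> (\<forall>c. lin_comb n c v \<in> W \<longrightarrow> (\<forall>i<n. c i = 0))"

definition lin_span_mod :: "('x, 'k::field) mpoly set \<Rightarrow> nat \<Rightarrow> (nat \<Rightarrow> ('x, 'k) mpoly) \<Rightarrow> ('x, 'k) mpoly set" where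
  "lin_span_mod W n v = {f. \<exists>c. f - lin_comb n c v \<in> W}"

lemma lin_comb_add: "lin_comb n c v + lin_comb n d v = lin_comb n (\<lambda>i. c i + d i) v"
  by (simp add: lin_comb_def mconst_add algebra_simps sum.distrib)

lemma mconst_lin_comb: "mconst a * lin_comb n c v = lin_comb n (\<lambda>i. a * c i) v"
  by (simp add: lin_comb_def mconst_mult sum_distrib_left mult.assoc)

lemma lin_comb_in: "lin_subspace W \<Longrightarrow> (\<And>i. i < n \<Longrightarrow> v i \<in> W) \<Longrightarrow> lin_comb n c v \<in> W"
  unfolding lin_comb_def by (intro lin_subspace_sum lin_subspace_mconst) auto

lemma lin_subspace_span_mod: "lin_subspace (lin_span_mod W n v)" if W: "lin_subspace W"
  unfolding lin_subspace_def
proof (intro conjI ballI allI)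
  have "(0::('a, 'b) mpoly) - lin_comb n (\<lambda>_. 0) v \<in> W"
    using lin_subspace_0[OF W] by (simp add: lin_comb_def)
  then show "0 \<in> lin_span_mod W n v" unfolding lin_span_mod_def by blast
next
  fix a b assume "a \<in> lin_span_mod W n v" "b \<in> lin_span_mod W n v"
  then obtain c d where "a - lin_comb n c v \<in> W" "b - lin_comb n d v \<in> W"
    by (auto simp: lin_span_mod_def)
  then have "(a + b) - lin_comb n (\<lambda>i. c i + d i) v \<in> W"
    using lin_subspace_add[OF W, of "a - lin_comb n c v" "b - lin_comb n d v"]
    by (simp add: lin_comb_add[symmetric] algebra_simps)
  then show "a + b \<in> lin_span_mod W n v" by (auto simp: lin_span_mod_def)
next
  fix a e assume "a \<in> lin_span_mod W n v"
  then obtain c where "a - lin_comb n c v \<in> W"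
    by (auto simp: lin_span_mod_def)
  then have "mconst e * a - lin_comb n (\<lambda>i. e * c i) v \<in> W"
    using lin_subspace_mconst[OF W, of "a - lin_comb n c v" e]
    by (simp add: mconst_lin_comb[symmetric] algebra_simps)
  then show "mconst e * a \<in> lin_span_mod W n v" by (auto simp: lin_span_mod_def)
qed

lemma lin_span_mod_superset: "lin_subspace W \<Longrightarrow> W \<subseteq> lin_span_mod W n v"
  unfolding lin_span_mod_def lin_comb_def by (auto intro!: exI[of _ "\<lambda>_. 0"])

lemma lin_span_mod_Suc:
  assumes "lin_subspace W"
  shows "f \<in> lin_span_mod W (Suc n) v \<longleftrightarrow> (\<exists>a. f - mconst a * v n \<in> lin_span_mod W n v)"
proof
  assume "f \<in> lin_span_mod W (Suc n) v"
  then obtain c where "f - lin_comb (Suc n) c v \<in> W" by (auto simp: lin_span_mod_def)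
  then have "(f - mconst (c n) * v n) - lin_comb n c v \<in> W"
    by (simp add: lin_comb_def algebra_simps)
  then show "\<exists>a. f - mconst a * v n \<in> lin_span_mod W n v" by (auto simp: lin_span_mod_def)
next
  assume "\<exists>a. f - mconst a * v n \<in> lin_span_mod W n v"
  then obtain a c where c: "f - mconst a * v n - lin_comb n c v \<in> W" by (auto simp: lin_span_mod_def)
  have "lin_comb n (c(n := a)) v = lin_comb n c v" by (auto simp: lin_comb_def)
  then have "f - lin_comb (Suc n) (c(n := a)) v \<in> W"
    using c by (simp add: lin_comb_def algebra_simps)
  then show "f \<in> lin_span_mod W (Suc n) v" by (auto simp: lin_span_mod_def)
qed

lemma lin_span_mod_0: "lin_span_mod W 0 v = W"
  by (auto simp: lin_span_mod_def lin_comb_def)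

lemma lin_span_mod_gen: "lin_subspace W \<Longrightarrow> i < n \<Longrightarrow> v i \<in> lin_span_mod W n v"
proof (induction n)
  case (Suc n)
  show ?case
  proof (cases "i = n")
    case True
    have "v n - mconst 1 * v n \<in> lin_span_mod W n v"
      using lin_subspace_0[OF lin_subspace_span_mod[OF Suc.prems(1)]] by simp
    then show ?thesis using True lin_span_mod_Suc[OF Suc.prems(1)] by blast
  next
    case False
    then have "v i - mconst 0 * v n \<in> lin_span_mod W n v" using Suc by simp
    then show ?thesis using lin_span_mod_Suc[OF Suc.prems(1)] by blast
  qed
qed simp

lemma lin_comb_in_span: "lin_subspace W \<Longrightarrow> lin_comb n c v \<in> lin_span_mod W n v"
  by (intro lin_comb_in lin_subspace_span_mod lin_span_mod_gen)

text \<open>The chain count with the nonzero constants as multipliers: saturation is then division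
  by a scalar, and the spans of the initial segments of \<open>w\<close> form the filtration
  \<open>G\<close>.\<close>

lemma chain_le_span:
  assumes W: "lin_subspace W" and sub: "\<And>i. i \<le> c \<Longrightarrow> lin_subspace (K i)"
    and strict: "\<And>i. i < c \<Longrightarrow> K i \<subset> K (Suc i)" and bot: "W \<subseteq> K 0" and top: "K c \<subseteq> lin_span_mod W M w"
  shows "c \<le> M"
proof (rule composition_bound[where U = "{mconst c |c. c \<noteq> 0}" and G = "\<lambda>s. lin_span_mod W s w" and K = K and w = w])
  fix s f assume "f \<in> lin_span_mod W (Suc s) w"
  then obtain a where "f - mconst a * w s \<in> lin_span_mod W s w" using lin_span_mod_Suc[OF W] by blast
  then show "\<exists>u\<in>{mconst c |c. c \<noteq> 0}. \<exists>a\<in>insert 0 {mconst c |c. c \<noteq> 0}. u * f - a * w s \<in> lin_span_mod W s w"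
    by (intro bexI[of _ "mconst 1"] bexI[of _ "mconst a"]) (auto intro: exI[of _ 1])
next
  fix s show "lin_span_mod W s w \<subseteq> lin_span_mod W (Suc s) w"
    using lin_span_mod_Suc[OF W, of _ s w] by (auto intro!: exI[of _ 0])
qed (use lin_subspace_span_mod[OF W] sub strict bot top in
      \<open>auto simp: lin_span_mod_0 intro: lin_subspace_diff lin_subspace_mconst lin_subspace_mconst_cancel\<close>)

text \<open>In place of an exchange argument: the initial segments of an independent family span a
  strict chain of subspaces, whose length is already bounded.\<close>

lemma lin_indep_mod_le_span:
  assumes W: "lin_subspace W" and ind: "lin_indep_mod W n v"
    and span: "\<And>i. i < n \<Longrightarrow> v i \<in> lin_span_mod W M w"
  shows "n \<le> M"
proof (rule chain_le_span[OF W, where K = "\<lambda>j. lin_span_mod W j v" and w = w])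
  fix i assume i: "i < n"
  have "v i \<notin> lin_span_mod W i v"
  proof
    assume "v i \<in> lin_span_mod W i v"
    then obtain c where c: "v i - lin_comb i c v \<in> W" by (auto simp: lin_span_mod_def)
    \<comment> \<open>Moving the combination of earlier vectors to the other side gives a relation
      whose coefficient at \<open>i\<close> is \<open>1\<close>.\<close>
    define d where "d j = (if j = i then 1 else if j < i then - c j else 0)" for j
    have "lin_comb n d v = (\<Sum>j\<in>{..<Suc i}. mconst (d j) * v j)"
      unfolding lin_comb_def using i by (intro sum.mono_neutral_right) (auto simp: d_def)
    also have "\<dots> = v i - lin_comb i c v"
      by (simp add: d_def lin_comb_def mconst_uminus sum_negf)
    finally have "d i = 0" using ind c i unfolding lin_indep_mod_def by metis
    then show False by (simp add: d_def)
  qed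
  moreover have "lin_span_mod W i v \<subseteq> lin_span_mod W (Suc i) v"
    using lin_span_mod_Suc[OF W, of _ i v] by (auto intro!: exI[of _ 0])
  ultimately show "lin_span_mod W i v \<subset> lin_span_mod W (Suc i) v"
    using lin_span_mod_gen[OF W, of i "Suc i" v] by auto
next
  show "lin_span_mod W n v \<subseteq> lin_span_mod W M w"
  proof
    fix f assume "f \<in> lin_span_mod W n v"
    then obtain c where "f - lin_comb n c v \<in> W" by (auto simp: lin_span_mod_def)
    moreover have "lin_comb n c v \<in> lin_span_mod W M w"
      using span by (intro lin_comb_in lin_subspace_span_mod W)
    ultimately have "(f - lin_comb n c v) + lin_comb n c v \<in> lin_span_mod W M w"
      using lin_span_mod_superset[OF W, of M w] by (intro lin_subspace_add[OF lin_subspace_span_mod[OF W]]) auto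
    then show "f \<in> lin_span_mod W M w" by simp
  qed
qed (simp_all add: lin_span_mod_0 lin_subspace_span_mod[OF W])

lemma lin_indep_mod_extend:
  assumes W: "lin_subspace W" and ind: "lin_indep_mod W n v" and f: "f \<notin> lin_span_mod W n v"
  shows "lin_indep_mod W (Suc n) (v(n := f))"
  unfolding lin_indep_mod_def
proof (intro allI impI)
  fix c i assume c: "lin_comb (Suc n) c (v(n := f)) \<in> W" and i: "i < Suc n"
  have eq: "lin_comb (Suc n) c (v(n := f)) = mconst (c n) * f + lin_comb n c v"
    by (simp add: lin_comb_def)
  let ?S = "lin_span_mod W n v"
  have "mconst (c n) * f \<in> ?S"
    using c eq lin_comb_in_span[OF W] lin_span_mod_superset[OF W] lin_subspace_span_mod[OF W]
    by (metis lin_subspace_cancel subsetD)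
  then have "c n = 0"
    using f lin_subspace_mconst_cancel[OF lin_subspace_span_mod[OF W]] by blast
  with c eq ind i show "c i = 0" unfolding lin_indep_mod_def by (auto simp: less_Suc_eq)
qed

definition indep_sizes :: "('x, 'k::field) mpoly set \<Rightarrow> ('x, 'k) mpoly set \<Rightarrow> nat set" where
  "indep_sizes W V = {n. \<exists>v. (\<forall>i<n. v i \<in> V) \<and> lin_indep_mod W n v}"

text \<open>For a subspace \<open>W\<close> this is the dimension of the image of the span of
  \<open>V\<close> in the quotient by \<open>W\<close>. The \<open>Max\<close> is informative for a
  finite set of sizes, hence the separate \<open>finite_rel_dim\<close>.\<close>

definition rel_dim :: "('x, 'k::field) mpoly set \<Rightarrow> ('x, 'k) mpoly set \<Rightarrow> nat" where
  "rel_dim W V = Max (indep_sizes W V)"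

lemma indep_sizes_0: "0 \<in> indep_sizes W V"
  by (simp add: indep_sizes_def lin_indep_mod_def)

lemma indep_sizes_le: "n \<in> indep_sizes W V \<Longrightarrow> n \<le> M"
  if "lin_subspace W" "V \<subseteq> lin_span_mod W M w"
  using that lin_indep_mod_le_span[of W n _ M w] by (auto simp: indep_sizes_def)

definition finite_rel_dim :: "('x, 'k::field) mpoly set \<Rightarrow> ('x, 'k) mpoly set \<Rightarrow> bool" where
  "finite_rel_dim W V \<longleftrightarrow> finite (indep_sizes W V)"

lemma finite_rel_dimI: "lin_subspace W \<Longrightarrow> V \<subseteq> lin_span_mod W M w \<Longrightarrow> finite_rel_dim W V"
  unfolding finite_rel_dim_def
  by (rule finite_subset[of _ "{..M}"]) (auto dest: indep_sizes_le)

lemma rel_dim_le: "lin_subspace W \<Longrightarrow> V \<subseteq> lin_span_mod W M w \<Longrightarrow> rel_dim W V \<le> M"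
  unfolding rel_dim_def
  using finite_rel_dimI[of W V M w] indep_sizes_0[of W V]
  by (subst Max_le_iff) (auto simp: finite_rel_dim_def dest: indep_sizes_le)

lemma rel_dim_ge:
  "finite_rel_dim W V \<Longrightarrow> lin_indep_mod W n v \<Longrightarrow> (\<And>i. i < n \<Longrightarrow> v i \<in> V) \<Longrightarrow> n \<le> rel_dim W V"
  unfolding rel_dim_def finite_rel_dim_def by (rule Max_ge) (auto simp: indep_sizes_def)

lemma rel_dim_attained:
  assumes "finite_rel_dim W V"
  obtains v where "\<And>i. i < rel_dim W V \<Longrightarrow> v i \<in> V" "lin_indep_mod W (rel_dim W V) v"
proof -
  have "rel_dim W V \<in> indep_sizes W V"
    unfolding rel_dim_def using assms indep_sizes_0[of W V] by (intro Max_in) (auto simp: finite_rel_dim_def)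
  then show ?thesis using that by (auto simp: indep_sizes_def)
qed

text \<open>An independent family of maximal size spans, since otherwise a missed element of
  \<open>V\<close> would extend it.\<close>

lemma rel_dim_basis:
  assumes "lin_subspace W" "finite_rel_dim W V"
  obtains v where "\<And>i. i < rel_dim W V \<Longrightarrow> v i \<in> V" "V \<subseteq> lin_span_mod W (rel_dim W V) v"
proof -
  obtain v where v: "\<And>i. i < rel_dim W V \<Longrightarrow> v i \<in> V" "lin_indep_mod W (rel_dim W V) v"
    using rel_dim_attained[OF assms(2)] by blast
  have "f \<in> lin_span_mod W (rel_dim W V) v" if f: "f \<in> V" for f
  proof (rule ccontr)
    assume "f \<notin> lin_span_mod W (rel_dim W V) v"
    then have "lin_indep_mod W (Suc (rel_dim W V)) (v(rel_dim W V := f))"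
      using lin_indep_mod_extend[OF assms(1) v(2)] by blast
    then have "Suc (rel_dim W V) \<le> rel_dim W V"
      by (rule rel_dim_ge[OF assms(2)]) (use v(1) f in auto)
    then show False by simp
  qed
  with v(1) that show ?thesis by blast
qed

lemma rel_dim_trivial: "V \<subseteq> W \<Longrightarrow> rel_dim W V = 0"
proof -
  assume "V \<subseteq> W"
  have "indep_sizes W V = {0}"
  proof (intro equalityI subsetI)
    fix n assume "n \<in> indep_sizes W V"
    then obtain v where v: "\<forall>i<n. v i \<in> V" "lin_indep_mod W n v" by (auto simp: indep_sizes_def)
    have "n = 0"
    proof (rule ccontr)
      assume n: "n \<noteq> 0"
      have "lin_comb n (\<lambda>i. if i = 0 then 1 else 0) v = (\<Sum>i\<in>{0::nat}. mconst 1 * v 0)"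
        unfolding lin_comb_def by (rule sum.mono_neutral_cong_right) (use n in auto)
      then have "lin_comb n (\<lambda>i. if i = 0 then 1 else 0) v \<in> W"
        using v n \<open>V \<subseteq> W\<close> by auto
      then have "(if (0::nat) = 0 then (1::'b) else 0) = 0"
        using v(2) n unfolding lin_indep_mod_def by blast
      then show False by simp
    qed
    then show "n \<in> {0}" by simp
  qed (use indep_sizes_0 in auto)
  then show ?thesis by (simp add: rel_dim_def)
qed

lemma rel_dim_Suc_0: "finite_rel_dim W V \<Longrightarrow> lin_subspace W \<Longrightarrow> f \<in> V \<Longrightarrow> f \<notin> W \<Longrightarrow> 1 \<le> rel_dim W V"
  by (rule rel_dim_ge[of _ _ _ "\<lambda>_. f"])
     (auto simp: lin_indep_mod_def lin_comb_def dest: lin_subspace_mconst_cancel)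

text \<open>Two spanning families are concatenated: one of \<open>V\<close> modulo \<open>W\<close>,
  and one of \<open>W \<inter> V\<close> modulo \<open>W'\<close>. By the kernel condition,
  \<open>\<phi>\<close> carries independence modulo \<open>W'\<close> inside
  \<open>W \<inter> V\<close> to independence modulo \<open>P\<close>, which bounds the size of the
  second family.\<close>

lemma rel_dim_functional:
  assumes W: "lin_subspace W" and W': "lin_subspace W'" and P: "lin_subspace P" and V: "lin_subspace V"
    and fin: "finite_rel_dim W V" "finite_rel_dim W' V" "finite_rel_dim P V'"
    and phi: "\<And>f. f \<in> V \<Longrightarrow> \<phi> f \<in> V'" "\<And>n c v. \<phi> (lin_comb n c v) = lin_comb n c (\<lambda>i. \<phi> (v i))"
    and ker: "\<And>f. f \<in> W \<Longrightarrow> f \<in> V \<Longrightarrow> \<phi> f \<in> P \<Longrightarrow> f \<in> W'"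
  shows "rel_dim W' V \<le> rel_dim W V + rel_dim P V'"
proof -
  let ?h = "rel_dim W V" let ?k = "rel_dim W' (W \<inter> V)"
  have "indep_sizes W' (W \<inter> V) \<subseteq> indep_sizes W' V" by (auto simp: indep_sizes_def)
  then have fin': "finite_rel_dim W' (W \<inter> V)"
    using fin(2) finite_subset unfolding finite_rel_dim_def by blast
  obtain v where v: "\<And>i. i < ?h \<Longrightarrow> v i \<in> V" "V \<subseteq> lin_span_mod W ?h v"
    using rel_dim_basis[OF W fin(1)] by blast
  obtain w where w: "\<And>i. i < ?k \<Longrightarrow> w i \<in> W \<inter> V" "W \<inter> V \<subseteq> lin_span_mod W' ?k w"
    using rel_dim_basis[OF W' fin'] by blast
  have "?k \<le> rel_dim P V'"
  proof -
    obtain u where u: "\<And>i. i < ?k \<Longrightarrow> u i \<in> W \<inter> V" "lin_indep_mod W' ?k u"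
      using rel_dim_attained[OF fin'] by blast
    have "lin_indep_mod P ?k (\<lambda>i. \<phi> (u i))"
      unfolding lin_indep_mod_def
    proof (intro allI impI)
      fix c i assume c: "lin_comb ?k c (\<lambda>i. \<phi> (u i)) \<in> P" and i: "i < ?k"
      have "lin_comb ?k c u \<in> W \<inter> V" using u(1) by (intro lin_comb_in lin_subspace_Int W V)
      then have "lin_comb ?k c u \<in> W'" using ker[of "lin_comb ?k c u"] c phi(2)[of ?k c u] by simp
      then show "c i = 0" using u(2) i unfolding lin_indep_mod_def by blast
    qed
    then show ?thesis using u(1) phi(1) by (intro rel_dim_ge[OF fin(3)]) auto
  qed
  moreover have "rel_dim W' V \<le> ?h + ?k"
  proof (rule rel_dim_le[OF W'])
    let ?z = "\<lambda>i. if i < ?h then v i else w (i - ?h)"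
    show "V \<subseteq> lin_span_mod W' (?h + ?k) ?z"
    proof
      fix f assume f: "f \<in> V"
      then obtain c where c: "f - lin_comb ?h c v \<in> W" using v(2) by (auto simp: lin_span_mod_def)
      have "lin_comb ?h c v \<in> V" using v(1) by (intro lin_comb_in V)
      then have "f - lin_comb ?h c v \<in> W \<inter> V" using c f V lin_subspace_diff by blast
      then obtain d where d: "f - lin_comb ?h c v - lin_comb ?k d w \<in> W'"
        using w(2) by (auto simp: lin_span_mod_def)
      have "lin_comb (?h + ?k) (\<lambda>i. if i < ?h then c i else d (i - ?h)) ?z = lin_comb ?h c v + lin_comb ?k d w"
        unfolding lin_comb_def lessThan_atLeast0
        by (subst sum.atLeastLessThan_concat[of 0 ?h "?h + ?k", symmetric])
           (auto intro!: arg_cong2[where f = "(+)"] sum.reindex_bij_witness[of _ "\<lambda>i. i + ?h" "\<lambda>i. i - ?h"])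
      then show "f \<in> lin_span_mod W' (?h + ?k) ?z"
        using d unfolding lin_span_mod_def by (auto intro!: exI[of _ "\<lambda>i. if i < ?h then c i else d (i - ?h)"]
          simp: algebra_simps)
    qed
  qed
  ultimately show ?thesis by simp
qed

section \<open>Total degree and boxes of exponents\<close>

definition mdeg :: "('x \<Rightarrow>\<^sub>0 nat) \<Rightarrow> nat" where
  "mdeg m = (\<Sum>x\<in>keys m. lookup m x)"

lemma mdeg_superset: "finite A \<Longrightarrow> keys m \<subseteq> A \<Longrightarrow> mdeg m = (\<Sum>x\<in>A. lookup m x)"
  unfolding mdeg_def by (rule sum.mono_neutral_left) (auto simp: in_keys_iff)

lemma mdeg_add: "mdeg (a + b) = mdeg a + mdeg b"
proof -
  have "mdeg (a + b) = (\<Sum>x\<in>keys a \<union> keys b. lookup a x + lookup b x)"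
    by (subst mdeg_superset[of "keys a \<union> keys b"]) (auto simp: keys_add_nat lookup_add)
  also have "\<dots> = mdeg a + mdeg b"
    by (simp add: sum.distrib mdeg_superset[of "keys a \<union> keys b", symmetric])
  finally show ?thesis .
qed

lemma mdeg_0 [simp]: "mdeg 0 = 0"
  by (simp add: mdeg_def)

lemma mdeg_eq_0_iff: "mdeg m = 0 \<longleftrightarrow> m = 0"
proof
  assume "mdeg m = 0"
  then have "lookup m x = 0" if "x \<in> keys m" for x using that by (simp add: mdeg_def)
  then show "m = 0" by (intro poly_mapping_eqI) (auto simp: in_keys_iff)
qed simp

lemma lookup_le_mdeg: "lookup m x \<le> mdeg m"
proof (cases "x \<in> keys m")
  case True
  then show ?thesis unfolding mdeg_def by (intro member_le_sum) auto
qed (simp add: in_keys_iff)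

lemma mdeg_single [simp]: "mdeg (Poly_Mapping.single x n) = n"
  by (cases "n = 0") (auto simp: mdeg_def)

text \<open>Bounding every exponent separately gives a set of exponents that is a product of
  intervals, so it is counted exactly; divisors of a monomial stay in its box.\<close>

definition box :: "'x set \<Rightarrow> nat \<Rightarrow> ('x \<Rightarrow>\<^sub>0 nat) set" where
  "box X N = {m. keys m \<subseteq> X \<and> (\<forall>x. lookup m x \<le> N)}"

lemma bij_betw_box:
  assumes "finite X"
  shows "bij_betw (\<lambda>m. restrict (lookup m) X) (box X N) (PiE X (\<lambda>_. {..N}))"
proof (rule bij_betw_imageI, rule inj_onI)
  fix m m' assume m: "m \<in> box X N" "m' \<in> box X N" and eq: "restrict (lookup m) X = restrict (lookup m') X"
  show "m = m'"
  proof (rule poly_mapping_eqI)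
    fix x show "lookup m x = lookup m' x"
    proof (cases "x \<in> X")
      case False
      then have "x \<notin> keys m" "x \<notin> keys m'" using m by (auto simp: box_def)
      then show ?thesis by (simp add: in_keys_iff)
    qed (use fun_cong[OF eq, of x] in simp)
  qed
next
  have "g \<in> (\<lambda>m. restrict (lookup m) X) ` box X N" if g: "g \<in> PiE X (\<lambda>_. {..N})" for g
  proof -
  define m where "m = Abs_poly_mapping (\<lambda>x. if x \<in> X then g x else 0)"
  have "finite {x. (if x \<in> X then g x else 0) \<noteq> 0}" using assms by (rule rev_finite_subset) auto
  then have lm: "lookup m = (\<lambda>x. if x \<in> X then g x else 0)" by (simp add: m_def)
  have "m \<in> box X N" using g by (auto simp: box_def in_keys_iff lm split: if_splits)
  moreover have "restrict (lookup m) X x = g x" for x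
    using PiE_arb[OF g, of x] by (cases "x \<in> X") (simp_all add: lm)
  then have "restrict (lookup m) X = g" by (rule ext)
  ultimately show ?thesis by blast
  qed
  then show "(\<lambda>m. restrict (lookup m) X) ` box X N = PiE X (\<lambda>_. {..N})"
    by (auto simp: box_def)
qed

lemma finite_box: "finite X \<Longrightarrow> finite (box X N)"
  using bij_betw_finite[OF bij_betw_box[of X N]] by (simp add: finite_PiE)

lemma card_box: "finite X \<Longrightarrow> card (box X N) = (N + 1) ^ card X"
  using bij_betw_same_card[OF bij_betw_box[of X N]] by (simp add: card_PiE)

definition box_polys :: "'x set \<Rightarrow> nat \<Rightarrow> ('x, 'k::zero) mpoly set" where
  "box_polys X N = {p. keys p \<subseteq> box X N}"

lemma box_polys_subset: "box_polys X N \<subseteq> polys X"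
  by (auto simp: box_polys_def box_def polys_def)

lemma box_mono: "M \<le> N \<Longrightarrow> box X M \<subseteq> box X N"
  unfolding box_def by (auto intro: le_trans)

lemma box_polys_mono: "M \<le> N \<Longrightarrow> box_polys X M \<subseteq> box_polys X N"
  unfolding box_polys_def using box_mono[of M N X] by blast

lemma one_in_box_polys: "1 \<in> box_polys X N"
  by (simp add: box_polys_def box_def)

lemma polys_in_box_polys:
  assumes "p \<in> polys X"
  obtains N where "p \<in> box_polys X N"
proof -
  have "p \<in> box_polys X (Max (mdeg ` keys p))"
  proof -
    have "lookup m x \<le> Max (mdeg ` keys p)" if "m \<in> keys p" for m x
      using lookup_le_mdeg[of m x] that by (meson Max_ge finite_imageI finite_keys imageI le_trans)
    then show ?thesis using assms by (auto simp: box_polys_def box_def polys_def)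
  qed
  then show ?thesis using that by blast
qed

lemma box_polys_mult:
  fixes p q :: "('x, 'k::comm_ring_1) mpoly"
  assumes "p \<in> box_polys X M" "q \<in> box_polys X N"
  shows "p * q \<in> box_polys X (M + N)"
proof -
  have "m \<in> box X (M + N)" if m: "m \<in> keys (p * q)" for m
  proof -
    obtain a b where "m = a + b" "a \<in> keys p" "b \<in> keys q"
      using m Poly_Mapping.keys_mult[of p q] by auto
    then show ?thesis
      using assms by (auto simp: box_polys_def box_def keys_add_nat lookup_add subset_iff intro!: add_mono)
  qed
  then show ?thesis by (auto simp: box_polys_def)
qed

lemma lin_subspace_monomials: "lin_subspace {p :: ('x, 'k::field) mpoly. keys p \<subseteq> M}"
  unfolding lin_subspace_def
  using Poly_Mapping.keys_add keys_mconst_mult by (fastforce simp: subset_iff)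

lemma lin_subspace_box_polys: "lin_subspace (box_polys X N)"
  unfolding box_polys_def by (rule lin_subspace_monomials)

lemma lin_subspace_zero: "lin_subspace {0}"
  by (simp add: lin_subspace_def)

text \<open>After expansion of \<open>p\<close> into monomials, those in \<open>W\<close> are
  harmless and the others are among the enumerated \<open>f i\<close>.\<close>

lemma in_span_monomials:
  fixes p :: "('x, 'k::field) mpoly"
  assumes W: "lin_subspace W" and f: "\<And>m. m \<in> A \<Longrightarrow> \<exists>i<n. f i = m"
    and p: "\<And>m. m \<in> keys p \<Longrightarrow> m \<in> A \<or> power_product m \<in> W"
  shows "p \<in> lin_span_mod W n (\<lambda>i. power_product (f i))"
proof -
  have "power_product m \<in> lin_span_mod W n (\<lambda>i. power_product (f i))" if "m \<in> keys p" for m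
    using p[OF that] f[of m] lin_span_mod_gen[OF W, of _ n "\<lambda>i. power_product (f i)"]
      lin_span_mod_superset[OF W] by auto
  then have "(\<Sum>m\<in>keys p. mconst (lookup p m) * power_product m) \<in> lin_span_mod W n (\<lambda>i. power_product (f i))"
    by (intro lin_subspace_sum lin_subspace_mconst lin_subspace_span_mod[OF W])
  then show ?thesis by (subst mpoly_eq_sum)
qed

lemma ex_enumeration:
  assumes "finite A"
  obtains f :: "nat \<Rightarrow> 'a" where "bij_betw f {..<card A} A"
  using ex_bij_betw_nat_finite[OF assms] by (auto simp: lessThan_atLeast0)

lemma bij_betw_lessThanD: "bij_betw f {..<n} A \<Longrightarrow> m \<in> A \<Longrightarrow> \<exists>i<n. f i = m" for n :: nat
  unfolding bij_betw_def by (metis imageE lessThan_iff)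

lemma finite_rel_dim_box:
  assumes "finite X" "lin_subspace W"
  shows "finite_rel_dim W (box_polys X N)"
proof -
  obtain f where f: "bij_betw f {..<card (box X N)} (box X N)"
    using ex_enumeration[OF finite_box[OF assms(1)]] by blast
  have "box_polys X N \<subseteq> lin_span_mod W (card (box X N)) (\<lambda>i. power_product (f i))"
  proof
    fix p :: "('a, 'b) mpoly" assume "p \<in> box_polys X N"
    then show "p \<in> lin_span_mod W (card (box X N)) (\<lambda>i. power_product (f i))"
      by (intro in_span_monomials[where A = "box X N"] assms bij_betw_lessThanD[OF f]) (auto simp: box_polys_def)
  qed
  then show ?thesis by (rule finite_rel_dimI[OF assms(2)])
qed

lemma rel_dim_zero_box:
  assumes "finite X"
  shows "(N + 1) ^ card X \<le> rel_dim {0} (box_polys X N :: ('x, 'k::field) mpoly set)"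
proof -
  let ?n = "card (box X N)"
  obtain f where f: "bij_betw f {..<?n} (box X N)"
    using ex_enumeration[OF finite_box[OF assms]] by blast
  have "?n \<le> rel_dim {0} (box_polys X N :: ('x, 'k) mpoly set)"
  proof (rule rel_dim_ge[OF finite_rel_dim_box[OF assms lin_subspace_zero]])
    show "lin_indep_mod {0} ?n (\<lambda>i. power_product (f i) :: ('x, 'k) mpoly)"
      unfolding lin_indep_mod_def
    proof (intro allI impI)
      fix c :: "nat \<Rightarrow> 'k" and i
      assume c: "lin_comb ?n c (\<lambda>i. power_product (f i)) \<in> {0}" and i: "i < ?n"
      have "lookup (lin_comb ?n c (\<lambda>i. power_product (f i))) (f i) = (\<Sum>j<?n. if i = j then c j else 0)"
        unfolding lin_comb_def lookup_sum using f i
        by (intro sum.cong)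
           (auto simp: lookup_mconst_mult power_product_def lookup_single when_def bij_betw_def inj_on_def)
      with c i show "c i = 0" by simp
    qed
    show "power_product (f i) \<in> (box_polys X N :: ('x, 'k) mpoly set)" if "i < ?n" for i
      using bij_betwE[OF f] that by (auto simp: box_polys_def)
  qed
  then show ?thesis by (simp add: card_box[OF assms])
qed

lemma rel_dim_box_mono:
  assumes "finite X" "lin_subspace W" "M \<le> N"
  shows "rel_dim W (box_polys X M) \<le> rel_dim W (box_polys X N)"
proof -
  obtain v where "\<And>i. i < rel_dim W (box_polys X M) \<Longrightarrow> v i \<in> box_polys X M"
    "lin_indep_mod W (rel_dim W (box_polys X M)) v"
    using rel_dim_attained[OF finite_rel_dim_box[OF assms(1,2)]] by blast
  then show ?thesis
    using box_polys_mono[OF assms(3), of X] by (intro rel_dim_ge[OF finite_rel_dim_box[OF assms(1,2)]]) auto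
qed

text \<open>An upper bound in the style of Gelfand-Kirillov dimension: for a prime \<open>P\<close>
  it stands in for the dimension of \<open>k[X]/P\<close>.\<close>

definition growth_le :: "'x set \<Rightarrow> ('x, 'k::field) mpoly set \<Rightarrow> nat \<Rightarrow> bool" where
  "growth_le X P d \<longleftrightarrow> (\<exists>C. \<forall>N. rel_dim P (box_polys X N) \<le> C * (N + 1) ^ d)"

text \<open>Modulo the face ideal only monomials supported in \<open>F\<close> survive, and a box on
  \<open>F\<close> contains \<open>(N + 1) ^ card F\<close> of them.\<close>

lemma growth_le_face_ideal:
  assumes "finite X" "F \<subseteq> X"
  shows "growth_le X (face_ideal X F :: ('x, 'k::field) mpoly set) (card F)"
  unfolding growth_le_def
proof (intro exI allI)
  fix N
  let ?W = "face_ideal X F :: ('x, 'k) mpoly set"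
  have W: "lin_subspace ?W" by (rule lin_subspace_ideal[OF ideal_face_ideal])
  have F: "finite F" using assms finite_subset by blast
  obtain f where f: "bij_betw f {..<card (box F N)} (box F N)"
    using ex_enumeration[OF finite_box[OF F]] by blast
  have "box_polys X N \<subseteq> lin_span_mod ?W (card (box F N)) (\<lambda>i. power_product (f i))"
  proof
    fix p :: "('x, 'k) mpoly" assume p: "p \<in> box_polys X N"
    show "p \<in> lin_span_mod ?W (card (box F N)) (\<lambda>i. power_product (f i))"
    proof (rule in_span_monomials[where A = "box F N", OF W])
      show "\<exists>i<card (box F N). f i = m" if "m \<in> box F N" for m
        using bij_betw_lessThanD[OF f that] .
      show "m \<in> box F N \<or> power_product m \<in> ?W" if "m \<in> keys p" for m
        using p that by (auto simp: box_polys_def box_def face_ideal_def polys_power_product)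
    qed
  qed
  then have "rel_dim ?W (box_polys X N) \<le> card (box F N)" by (rule rel_dim_le[OF W])
  then show "rel_dim ?W (box_polys X N) \<le> 1 * (N + 1) ^ card F" by (simp add: card_box[OF F])
qed

text \<open>Multiplication by \<open>f\<close> is injective on \<open>k[X]/P\<close>, and its image
  dies in \<open>k[X]/Q\<close>. Hence an independent family modulo \<open>Q\<close> and
  \<open>f\<close> times an independent family modulo \<open>P\<close> remain independent together
  modulo \<open>P\<close>; the shift \<open>e\<close> accounts for the exponents of
  \<open>f\<close>.\<close>

lemma rel_dim_growth:
  assumes "finite X" and P: "primeideal P (mpoly_ring X)" and Q: "ideal Q (mpoly_ring X)" and "P \<subseteq> Q"
    and f: "f \<in> Q" "f \<notin> P" "f \<in> box_polys X e"
  shows "rel_dim Q (box_polys X (N + e)) + rel_dim P (box_polys X N) \<le> rel_dim P (box_polys X (N + e))"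
proof -
  have lP: "lin_subspace P" and lQ: "lin_subspace Q"
    using P Q by (auto intro: lin_subspace_ideal primeideal_mpoly_ideal)
  note fin = finite_rel_dim_box[OF assms(1)]
  let ?h = "rel_dim Q (box_polys X (N + e))" let ?k = "rel_dim P (box_polys X N)"
  obtain v where v: "\<And>i. i < ?h \<Longrightarrow> v i \<in> box_polys X (N + e)" "lin_indep_mod Q ?h v"
    using rel_dim_attained[OF fin[OF lQ]] by blast
  obtain w where w: "\<And>i. i < ?k \<Longrightarrow> w i \<in> box_polys X N" "lin_indep_mod P ?k w"
    using rel_dim_attained[OF fin[OF lP]] by blast
  let ?z = "\<lambda>i. if i < ?h then v i else f * w (i - ?h)"
  show ?thesis
  proof (rule rel_dim_ge[OF fin[OF lP]])
    show "?z i \<in> box_polys X (N + e)" if "i < ?h + ?k" for i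
      using that v(1)[of i] box_polys_mult[OF w(1)[of "i - ?h"] f(3)] by (auto simp: mult.commute)
    show "lin_indep_mod P (?h + ?k) ?z"
      unfolding lin_indep_mod_def
    proof (intro allI impI)
      fix c i assume c: "lin_comb (?h + ?k) c ?z \<in> P" and i: "i < ?h + ?k"
      let ?d = "\<lambda>i. c (i + ?h)"
      have eq: "lin_comb (?h + ?k) c ?z = lin_comb ?h c v + f * lin_comb ?k ?d w"
        unfolding lin_comb_def lessThan_atLeast0 sum_distrib_left
        by (subst sum.atLeastLessThan_concat[of 0 ?h "?h + ?k", symmetric])
           (auto intro!: arg_cong2[where f = "(+)"] sum.reindex_bij_witness[of _ "\<lambda>i. i + ?h" "\<lambda>i. i - ?h"])
      have wk: "lin_comb ?k ?d w \<in> polys X"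
        using lin_comb_in[OF lin_subspace_box_polys, of ?k w X N ?d] w(1) box_polys_subset[of X N] by blast
      have fX: "f \<in> polys X" using f(3) box_polys_subset by blast
      have "f * lin_comb ?k ?d w \<in> Q" using ideal_mpoly_mult[OF Q wk f(1)] by (simp add: mult.commute)
      then have "lin_comb ?h c v \<in> Q"
        using c assms(4) eq lin_subspace_cancel[OF lQ, of "f * lin_comb ?k ?d w"] by auto
      then have c0: "c j = 0" if "j < ?h" for j using v(2) that unfolding lin_indep_mod_def by blast
      then have "lin_comb ?h c v = 0" by (simp add: lin_comb_def)
      then have "f * lin_comb ?k ?d w \<in> P" using c eq by simp
      then have "lin_comb ?k ?d w \<in> P" using primeideal_mpoly_mult[OF P fX wk] f(2) by blast
      then have "c (j + ?h) = 0" if "j < ?k" for j using w(2) that unfolding lin_indep_mod_def by blast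
      from c0 this[of "i - ?h"] i show "c i = 0" by (cases "i < ?h") auto
    qed
  qed
qed

text \<open>Iterating the recursion \<open>N + 1\<close> times from \<open>N\<close> bounds
  \<open>(N + 1) * g N\<close> by \<open>h\<close> at an argument linear in \<open>N\<close>;
  dividing by \<open>N + 1\<close> lowers the exponent by one.\<close>

lemma growth_step:
  fixes g h :: "nat \<Rightarrow> nat"
  assumes "\<And>N. g (N + e) + h N \<le> h (N + e)" and mono: "\<And>M N. M \<le> N \<Longrightarrow> g M \<le> g N"
    and h: "\<And>N. h N \<le> C * (N + 1) ^ d" and g: "\<And>N. 1 \<le> g N"
  shows "0 < d \<and> g N \<le> C * (e + 1) ^ d * (N + 1) ^ (d - 1)"
proof -
  have "k * g N \<le> h (N + k * e)" for k N
  proof (induction k)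
    case (Suc k)
    have "g N \<le> g (N + k * e + e)" by (rule mono) simp
    then show ?case using Suc assms(1)[of "N + k * e"] by (simp add: algebra_simps)
  qed simp
  from this[of "N + 1" for N] h[of "N + (N + 1) * e" for N]
  have "(N + 1) * g N \<le> C * (N + (N + 1) * e + 1) ^ d" for N by (rule order_trans)
  moreover have "N + (N + 1) * e + 1 = (e + 1) * (N + 1)" for N by (simp add: algebra_simps)
  ultimately have le: "(N + 1) * g N \<le> C * (e + 1) ^ d * (N + 1) ^ d" for N
    by (metis mult.assoc power_mult_distrib)
  \<comment> \<open>For \<open>d = 0\<close> the bound at \<open>N = C\<close> reads
    \<open>(C + 1) * g C \<le> C\<close>, which \<open>g C \<ge> 1\<close> excludes.\<close>
  have d: "0 < d"
  proof (rule ccontr)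
    assume "\<not> 0 < d"
    then have "(C + 1) * g C \<le> C" using le[of C] by simp
    moreover have "(C + 1) * 1 \<le> (C + 1) * g C" using g[of C] by (intro mult_le_mono2)
    ultimately show False by simp
  qed
  have "(N + 1) * g N \<le> (N + 1) * (C * (e + 1) ^ d * (N + 1) ^ (d - 1))"
    using le[of N] power_minus_mult[OF d, of "N + 1"] by (metis mult.assoc mult.commute)
  then show ?thesis using d by (simp only: mult_le_cancel1)
qed

text \<open>Any element of a larger prime outside the smaller one feeds \<open>growth_step\<close>,
  so each strict inclusion costs one degree. The conjunct \<open>n \<le> d\<close> ensures that the
  subtraction on \<open>nat\<close> is not truncated.\<close>

lemma growth_chain:
  assumes fin: "finite X" and prime: "\<And>i. i \<le> n \<Longrightarrow> primeideal (Q i) (mpoly_ring X)"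
    and strict: "\<And>i. i < n \<Longrightarrow> Q i \<subset> Q (Suc i)" and "growth_le X (Q 0) d"
  shows "n \<le> d \<and> growth_le X (Q n) (d - n)"
  using prime strict
proof (induction n)
  case 0
  then show ?case using assms(4) by simp
next
  case (Suc n)
  then have IH: "n \<le> d" "growth_le X (Q n) (d - n)" by auto
  then obtain C where C: "\<And>N. rel_dim (Q n) (box_polys X N) \<le> C * (N + 1) ^ (d - n)"
    by (auto simp: growth_le_def)
  have P: "primeideal (Q n) (mpoly_ring X)" and Q: "primeideal (Q (Suc n)) (mpoly_ring X)"
    using Suc.prems by auto
  note lQ = lin_subspace_ideal[OF primeideal_mpoly_ideal[OF Q]]
  obtain f where f: "f \<in> Q (Suc n)" "f \<notin> Q n" using Suc.prems(2)[of n] by auto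
  then have "f \<in> polys X" using ideal_mpoly_subset[OF primeideal_mpoly_ideal[OF Q]] by blast
  then obtain e where e: "f \<in> box_polys X e" by (rule polys_in_box_polys)
  have "0 < d - n \<and> rel_dim (Q (Suc n)) (box_polys X N) \<le> C * (e + 1) ^ (d - n) * (N + 1) ^ (d - n - 1)" for N
  proof (rule growth_step[where h = "\<lambda>N. rel_dim (Q n) (box_polys X N)"])
    show "rel_dim (Q (Suc n)) (box_polys X (N + e)) + rel_dim (Q n) (box_polys X N)
        \<le> rel_dim (Q n) (box_polys X (N + e))" for N
      using Suc.prems(2)[of n] f e by (intro rel_dim_growth[OF fin P primeideal_mpoly_ideal[OF Q]]) auto
    show "rel_dim (Q (Suc n)) (box_polys X M) \<le> rel_dim (Q (Suc n)) (box_polys X N)" if "M \<le> N" for M N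
      using rel_dim_box_mono[OF fin lQ that] .
    show "1 \<le> rel_dim (Q (Suc n)) (box_polys X N)" for N
      using rel_dim_Suc_0[OF finite_rel_dim_box[OF fin lQ] lQ one_in_box_polys primeideal_mpoly_1[OF Q]] .
  qed (rule C)
  then show ?case unfolding growth_le_def by (metis Suc_leI diff_Suc_eq_diff_pred diff_commute zero_less_diff diff_Suc_1 diff_diff_left add.commute plus_1_eq_Suc)
qed

section \<open>Substitution and Taylor expansion\<close>

definition coeff_hom :: "('k::comm_ring_1 \<Rightarrow> 'r::comm_ring_1) \<Rightarrow> bool" where
  "coeff_hom c \<longleftrightarrow> c 0 = 0 \<and> c 1 = 1 \<and> (\<forall>a b. c (a + b) = c a + c b) \<and> (\<forall>a b. c (a * b) = c a * c b)"

definition monomial_eval :: "('x \<Rightarrow> 'r::comm_ring_1) \<Rightarrow> ('x \<Rightarrow>\<^sub>0 nat) \<Rightarrow> 'r" where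
  "monomial_eval v m = (\<Prod>x\<in>keys m. v x ^ lookup m x)"

lemma monomial_eval_superset:
  "finite A \<Longrightarrow> keys m \<subseteq> A \<Longrightarrow> monomial_eval v m = (\<Prod>x\<in>A. v x ^ lookup m x)"
  unfolding monomial_eval_def by (rule prod.mono_neutral_left) (auto simp: in_keys_iff)

lemma monomial_eval_add: "monomial_eval v (a + b) = monomial_eval v a * monomial_eval v b"
proof -
  have "monomial_eval v (a + b) = (\<Prod>x\<in>keys a \<union> keys b. v x ^ lookup a x * v x ^ lookup b x)"
    by (subst monomial_eval_superset[of "keys a \<union> keys b"]) (auto simp: keys_add_nat lookup_add power_add)
  also have "\<dots> = monomial_eval v a * monomial_eval v b"
    by (simp add: prod.distrib monomial_eval_superset[of "keys a \<union> keys b", symmetric])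
  finally show ?thesis .
qed

lemma monomial_eval_0 [simp]: "monomial_eval v 0 = 1"
  by (simp add: monomial_eval_def)

lemma monomial_eval_single [simp]: "monomial_eval v (Poly_Mapping.single x n) = v x ^ n"
  by (cases "n = 0") (auto simp: monomial_eval_def)

lemma monomial_induct [case_names zero single]:
  assumes "P 0" and "\<And>m x. P m \<Longrightarrow> P (m + Poly_Mapping.single x 1)"
  shows "P (m :: 'x \<Rightarrow>\<^sub>0 nat)"
proof (induction "mdeg m" arbitrary: m rule: less_induct)
  case less
  show ?case
  proof (cases "m = 0")
    case False
    then obtain x where x: "lookup m x \<noteq> 0" by (metis lookup_zero poly_mapping_eqI)
    have "m - Poly_Mapping.single x 1 + Poly_Mapping.single x 1 = m"
    proof (rule poly_mapping_eqI)
      fix y show "lookup (m - Poly_Mapping.single x 1 + Poly_Mapping.single x 1) y = lookup m y"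
        using x by (cases "y = x") (auto simp: lookup_add lookup_minus lookup_single)
    qed
    moreover from this have "mdeg (m - Poly_Mapping.single x 1) + 1 = mdeg m"
      by (metis mdeg_add mdeg_single)
    ultimately show ?thesis
      using assms(2)[of "m - Poly_Mapping.single x 1" x] less[of "m - Poly_Mapping.single x 1"] by simp
  qed (simp add: assms(1))
qed

lemma monomial_eval_mvar: "monomial_eval mvar m = power_product m"
  by (induction m rule: monomial_induct) (simp_all add: monomial_eval_add power_product_add mvar_def)

lemma mpoly_eval_eq: "mpoly_eval c v p = (\<Sum>m\<in>keys p. c (lookup p m) * monomial_eval v m)"
  by (simp add: mpoly_eval_def monomial_eval_def)

lemma mpoly_eval_superset:
  assumes "coeff_hom c" "finite A" "keys p \<subseteq> A"
  shows "mpoly_eval c v p = (\<Sum>m\<in>A. c (lookup p m) * monomial_eval v m)"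
  unfolding mpoly_eval_eq
  by (rule sum.mono_neutral_left) (use assms in \<open>auto simp: in_keys_iff coeff_hom_def\<close>)

lemma mpoly_eval_0 [simp]: "mpoly_eval c v 0 = (0 :: 'r::comm_ring_1)"
  by (simp add: mpoly_eval_eq)

lemma mpoly_eval_add:
  assumes "coeff_hom c"
  shows "mpoly_eval c v (p + q) = mpoly_eval c v p + mpoly_eval c v q"
proof -
  let ?A = "keys p \<union> keys q"
  have "mpoly_eval c v (p + q) = (\<Sum>m\<in>?A. c (lookup (p + q) m) * monomial_eval v m)"
    by (rule mpoly_eval_superset[OF assms _ Poly_Mapping.keys_add]) simp
  also have "\<dots> = (\<Sum>m\<in>?A. c (lookup p m) * monomial_eval v m) + (\<Sum>m\<in>?A. c (lookup q m) * monomial_eval v m)"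
    using assms by (simp add: coeff_hom_def lookup_add distrib_right sum.distrib)
  finally show ?thesis
    by (simp add: mpoly_eval_superset[OF assms, of ?A])
qed

lemma mpoly_eval_sum: "coeff_hom c \<Longrightarrow> mpoly_eval c v (sum f A) = (\<Sum>i\<in>A. mpoly_eval c v (f i))"
  by (induction A rule: infinite_finite_induct) (auto simp: mpoly_eval_add)

lemma mpoly_eval_single: "coeff_hom c \<Longrightarrow> mpoly_eval c v (Poly_Mapping.single m a) = c a * monomial_eval v m"
  by (cases "a = 0") (auto simp: mpoly_eval_eq coeff_hom_def)

lemma mpoly_eval_power_product: "coeff_hom c \<Longrightarrow> mpoly_eval c v (power_product m) = monomial_eval v m"
  by (simp add: power_product_def mpoly_eval_single coeff_hom_def)

lemma mpoly_eval_mconst: "coeff_hom c \<Longrightarrow> mpoly_eval c v (mconst a) = c a"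
  by (simp add: mconst_def mpoly_eval_single)

lemma mpoly_eval_mvar: "coeff_hom c \<Longrightarrow> mpoly_eval c v (mvar x) = v x"
  by (simp add: mvar_def mpoly_eval_power_product)

lemma mpoly_eq_sum_single: "p = (\<Sum>m\<in>keys p. Poly_Mapping.single m (lookup p m))"
  for p :: "('x, 'k::comm_ring_1) mpoly"
  using mpoly_eq_sum[of p] by (simp add: single_eq_mconst_mult)

lemma mpoly_eval_mult:
  assumes c: "coeff_hom c"
  shows "mpoly_eval c v (p * q) = mpoly_eval c v p * mpoly_eval c v q"
proof -
  have "p * q = (\<Sum>m\<in>keys p. \<Sum>n\<in>keys q. Poly_Mapping.single (m + n) (lookup p m * lookup q n))"
    by (subst mpoly_eq_sum_single[of p], subst mpoly_eq_sum_single[of q])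
       (simp add: sum_product mult_single)
  then have "mpoly_eval c v (p * q)
      = (\<Sum>m\<in>keys p. \<Sum>n\<in>keys q. c (lookup p m * lookup q n) * monomial_eval v (m + n))"
    by (simp add: mpoly_eval_sum[OF c] mpoly_eval_single[OF c])
  also have "\<dots> = mpoly_eval c v p * mpoly_eval c v q"
    using c by (simp add: mpoly_eval_eq sum_product coeff_hom_def monomial_eval_add ac_simps)
  finally show ?thesis .
qed

lemma mpoly_eval_1: "coeff_hom c \<Longrightarrow> mpoly_eval c v 1 = 1"
  using mpoly_eval_power_product[of c v 0] by simp

lemma coeff_hom_mconst: "coeff_hom mconst"
  by (simp add: coeff_hom_def mconst_add mconst_mult)

lemma coeff_hom_comp: "coeff_hom c \<Longrightarrow> coeff_hom d \<Longrightarrow> coeff_hom (\<lambda>x. d (c x))"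
  by (simp add: coeff_hom_def)

text \<open>The outer variables are the increments \<open>T\<close> in the expansion of \<open>f(x + T)\<close>.\<close>

definition taylor :: "('x, 'k::comm_ring_1) mpoly \<Rightarrow> ('x, ('x, 'k) mpoly) mpoly" where
  "taylor = mpoly_eval (\<lambda>a. mconst (mconst a)) (\<lambda>x. mconst (mvar x) + mvar x)"

lemma coeff_hom_mconst_mconst: "coeff_hom (\<lambda>a. mconst (mconst a))"
  by (rule coeff_hom_comp[OF coeff_hom_mconst coeff_hom_mconst])

lemma taylor_add: "taylor (p + q) = taylor p + taylor q"
  and taylor_sum: "taylor (sum f A) = (\<Sum>i\<in>A. taylor (f i))"
  and taylor_mult: "taylor (p * q) = taylor p * taylor q"
  and taylor_mconst: "taylor (mconst a) = mconst (mconst a)"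
  and taylor_mvar: "taylor (mvar x) = mconst (mvar x) + mvar x"
  unfolding taylor_def
  by (rule mpoly_eval_add mpoly_eval_sum mpoly_eval_mult mpoly_eval_mconst mpoly_eval_mvar,
      rule coeff_hom_mconst_mconst)+

text \<open>Linearity over the ground field is what allows a Taylor coefficient to serve as the map
  \<open>\<phi>\<close> in \<open>rel_dim_functional\<close>.\<close>

lemma lookup_taylor_lin_comb:
  "lookup (taylor (lin_comb n c v)) b = lin_comb n c (\<lambda>i. lookup (taylor (v i)) b)"
  by (simp add: lin_comb_def taylor_sum taylor_mult taylor_mconst lookup_sum lookup_mconst_mult)

section \<open>Exponents occurring in Taylor expansions\<close>

definition mle :: "('x \<Rightarrow>\<^sub>0 nat) \<Rightarrow> ('x \<Rightarrow>\<^sub>0 nat) \<Rightarrow> bool" where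
  "mle a b \<longleftrightarrow> (\<forall>x. lookup a x \<le> lookup b x)"

lemma mle_add: "mle a b \<Longrightarrow> mle c d \<Longrightarrow> mle (a + c) (b + d)"
  by (auto simp: mle_def lookup_add intro: add_mono)

lemma mle_add_eq: "mle a b \<Longrightarrow> mle c d \<Longrightarrow> a + c = b + d \<Longrightarrow> a = b \<and> c = d"
proof -
  assume le: "mle a b" "mle c d" and eq: "a + c = b + d"
  have "lookup a x = lookup b x \<and> lookup c x = lookup d x" for x
    using le arg_cong[OF eq, of "\<lambda>p. lookup p x"] by (auto simp: mle_def lookup_add dest!: spec[of _ x])
  then show ?thesis by (auto intro: poly_mapping_eqI)
qed

lemma mle_mdeg: "mle a b \<Longrightarrow> mdeg b \<le> mdeg a \<Longrightarrow> a = b"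
proof -
  assume le: "mle a b" and deg: "mdeg b \<le> mdeg a"
  have "b = a + (b - a)"
    using le by (intro poly_mapping_eqI) (auto simp: mle_def lookup_add lookup_minus)
  moreover from this have "mdeg b = mdeg a + mdeg (b - a)" by (metis mdeg_add)
  ultimately show ?thesis using deg mdeg_eq_0_iff[of "b - a"] by simp
qed

lemma mle_box: "mle a m \<Longrightarrow> m \<in> box X N \<Longrightarrow> a \<in> box X N"
proof -
  assume le: "mle a m" and m: "m \<in> box X N"
  have "keys a \<subseteq> keys m"
  proof
    fix x assume "x \<in> keys a"
    then show "x \<in> keys m" using le by (simp add: mle_def in_keys_iff) (metis gr_zeroI le_zero_eq)
  qed
  then show ?thesis using le m by (auto simp: box_def mle_def intro: le_trans)
qed

text \<open>The multiplicative invariant of the expansion of \<open>x^m\<close> as a product of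
  factors \<open>x + T\<close>. It is stated for arbitrary \<open>q\<close> so that it can be
  carried through products.\<close>

definition taylor_bounded :: "('x \<Rightarrow>\<^sub>0 nat) \<Rightarrow> ('x, ('x, 'k::comm_ring_1) mpoly) mpoly \<Rightarrow> bool" where
  "taylor_bounded m q \<longleftrightarrow> (\<forall>b\<in>keys q. mle b m \<and> (\<forall>k\<in>keys (lookup q b). mle k m)) \<and> lookup q m = 1"

lemma taylor_bounded_mult:
  assumes p: "taylor_bounded m p" and q: "taylor_bounded n q"
  shows "taylor_bounded (m + n) (p * q)"
proof -
  have look: "lookup (p * q) b = (\<Sum>(a, c)\<in>{(a, c). a \<in> keys p \<and> c \<in> keys q \<and> a + c = b}. lookup p a * lookup q c)" for b
    by (rule lookup_mult_finite) auto
  have "mle b (m + n) \<and> (\<forall>k\<in>keys (lookup (p * q) b). mle k (m + n))" if b: "b \<in> keys (p * q)" for b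
  proof
    obtain a c where "b = a + c" "a \<in> keys p" "c \<in> keys q"
      using b Poly_Mapping.keys_mult[of p q] by auto
    then show "mle b (m + n)" using p q by (auto simp: taylor_bounded_def intro: mle_add)
    show "\<forall>k\<in>keys (lookup (p * q) b). mle k (m + n)"
    proof
      fix k assume "k \<in> keys (lookup (p * q) b)"
      then obtain a c where ac: "a \<in> keys p" "c \<in> keys q" "k \<in> keys (lookup p a * lookup q c)"
        unfolding look using Poly_Mapping.keys_sum by (fastforce simp: subset_iff)
      then obtain k1 k2 where "k = k1 + k2" "k1 \<in> keys (lookup p a)" "k2 \<in> keys (lookup q c)"
        using Poly_Mapping.keys_mult[of "lookup p a" "lookup q c"] by auto
      then show "mle k (m + n)" using p q ac by (auto simp: taylor_bounded_def intro: mle_add)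
    qed
  qed
  moreover have "lookup (p * q) (m + n) = 1"
  proof -
    have "lookup p m = 1" "lookup q n = 1" using p q by (auto simp: taylor_bounded_def)
    then have "m \<in> keys p" "n \<in> keys q" by (auto simp: in_keys_iff)
    moreover have "a = m \<and> c = n" if "a \<in> keys p" "c \<in> keys q" "a + c = m + n" for a c
      using mle_add_eq[of a m c n] p q that by (auto simp: taylor_bounded_def)
    ultimately have "{(a, c). a \<in> keys p \<and> c \<in> keys q \<and> a + c = m + n} = {(m, n)}"
      by blast
    then show ?thesis unfolding look using p q by (simp add: taylor_bounded_def)
  qed
  ultimately show ?thesis by (auto simp: taylor_bounded_def)
qed

lemma taylor_bounded_taylor: "taylor_bounded m (taylor (power_product m :: ('a, 'b::comm_ring_1) mpoly))"
proof (induction m rule: monomial_induct)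
  case zero
  have "taylor 1 = (1 :: ('a, ('a, 'b) mpoly) mpoly)"
    unfolding taylor_def by (rule mpoly_eval_1[OF coeff_hom_mconst_mconst])
  then show ?case by (auto simp: taylor_bounded_def mle_def)
next
  case (single m x)
  let ?s = "Poly_Mapping.single x (1::nat)"
  have s0: "?s \<noteq> 0" by (metis lookup_single_eq lookup_zero one_neq_zero)
  have "taylor_bounded ?s (mconst (mvar x) + mvar x :: ('a, ('a, 'b) mpoly) mpoly)"
  proof -
    let ?q = "mconst (mvar x) + mvar x :: ('a, ('a, 'b) mpoly) mpoly"
    have look: "lookup ?q b = (if b = 0 then mvar x else 0) + (if b = ?s then 1 else 0)" for b
      by (auto simp: lookup_add mconst_def mvar_def power_product_def lookup_single when_def)
    have le: "mle 0 ?s" "mle ?s ?s" by (auto simp: mle_def)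
    have "b = 0 \<or> b = ?s" if "b \<in> keys ?q" for b
      using that look[of b] by (auto simp: in_keys_iff split: if_splits)
    moreover have "keys (lookup ?q 0) \<subseteq> {?s}" "keys (lookup ?q ?s) \<subseteq> {0}" "lookup ?q ?s = 1"
      unfolding look using s0 by (simp_all add: mvar_def del: One_nat_def)
    ultimately show ?thesis
      using le unfolding taylor_bounded_def by blast
  qed
  then have "taylor_bounded ?s (taylor (mvar x :: ('a, 'b) mpoly))" by (simp only: taylor_mvar)
  then have "taylor_bounded (m + ?s) (taylor (power_product m :: ('a, 'b) mpoly) * taylor (mvar x))"
    by (rule taylor_bounded_mult[OF single])
  then show ?case by (simp add: power_product_add taylor_mult mvar_def)
qed

lemma
  shows taylor_power_product_top: "lookup (taylor (power_product m :: ('x, 'k::comm_ring_1) mpoly)) m = 1"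
    and taylor_power_product_mle: "lookup (taylor (power_product m :: ('x, 'k) mpoly)) b \<noteq> 0 \<Longrightarrow> mle b m"
    and taylor_power_product_coeff_mle:
      "k \<in> keys (lookup (taylor (power_product m :: ('x, 'k) mpoly)) b) \<Longrightarrow> mle k m"
proof -
  have *: "taylor_bounded m (taylor (power_product m :: ('x, 'k) mpoly))" by (rule taylor_bounded_taylor)
  then show "lookup (taylor (power_product m :: ('x, 'k) mpoly)) m = 1"
    by (simp add: taylor_bounded_def)
  show "mle b m" if "lookup (taylor (power_product m :: ('x, 'k) mpoly)) b \<noteq> 0"
  proof -
    have "b \<in> keys (taylor (power_product m :: ('x, 'k) mpoly))" using that by (simp add: in_keys_iff)
    then show ?thesis using * by (simp add: taylor_bounded_def)
  qed
  show "mle k m" if k: "k \<in> keys (lookup (taylor (power_product m :: ('x, 'k) mpoly)) b)"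
  proof -
    have "lookup (taylor (power_product m :: ('x, 'k) mpoly)) b \<noteq> 0" using k by auto
    then have "b \<in> keys (taylor (power_product m :: ('x, 'k) mpoly))" by (simp add: in_keys_iff)
    then show ?thesis using * k by (simp add: taylor_bounded_def)
  qed
qed

lemma lookup_taylor:
  "lookup (taylor p) b = (\<Sum>m\<in>keys p. mconst (lookup p m) * lookup (taylor (power_product m)) b)"
proof -
  have "taylor p = (\<Sum>m\<in>keys p. mconst (mconst (lookup p m)) * taylor (power_product m))"
  proof -
    have "taylor p = taylor (\<Sum>m\<in>keys p. mconst (lookup p m) * power_product m)"
      by (rule arg_cong[OF mpoly_eq_sum[of p], where f = taylor])
    also have "\<dots> = (\<Sum>m\<in>keys p. mconst (mconst (lookup p m)) * taylor (power_product m))"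
      by (simp only: taylor_sum taylor_mult taylor_mconst)
    finally show ?thesis .
  qed
  then show ?thesis by (simp only: lookup_sum lookup_mconst_mult)
qed

lemma keys_taylor:
  fixes p :: "('x, 'k::comm_ring_1) mpoly"
  assumes b: "b \<in> keys (taylor p)"
  shows "\<exists>m\<in>keys p. mle b m"
proof (rule ccontr)
  assume neg: "\<not> ?thesis"
  have "lookup (taylor (power_product m :: ('x, 'k) mpoly)) b = 0" if "m \<in> keys p" for m
    using neg that taylor_power_product_mle[of m b, where 'k = 'k] by blast
  then have "(\<Sum>m\<in>keys p. mconst (lookup p m) * lookup (taylor (power_product m :: ('x, 'k) mpoly)) b) = 0"
    by (intro sum.neutral) simp
  then have "lookup (taylor p) b = 0" by (rule trans[OF lookup_taylor])
  then show False using b by (simp add: in_keys_iff)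
qed

lemma taylor_box:
  assumes "p \<in> box_polys X N"
  shows "keys (taylor p) \<subseteq> box X N" "lookup (taylor p) b \<in> box_polys X N"
proof -
  show "keys (taylor p) \<subseteq> box X N"
  proof
    fix b assume "b \<in> keys (taylor p)"
    then obtain m where "m \<in> keys p" "mle b m" using keys_taylor by blast
    then show "b \<in> box X N" using assms mle_box[of b m X N] by (auto simp: box_polys_def)
  qed
  have "k \<in> box X N" if k: "k \<in> keys (lookup (taylor p) b)" for k
  proof -
    have "k \<in> (\<Union>m\<in>keys p. keys (mconst (lookup p m) * lookup (taylor (power_product m)) b))"
      by (rule subsetD[OF Poly_Mapping.keys_sum]) (use k in \<open>simp only: lookup_taylor[symmetric]\<close>)
    then obtain m where m: "m \<in> keys p" "k \<in> keys (lookup (taylor (power_product m :: ('a, 'b) mpoly)) b)"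
      using keys_mconst_mult by blast
    then have "mle k m" using taylor_power_product_coeff_mle by blast
    then show ?thesis using m(1) assms mle_box[of k m X N] by (auto simp: box_polys_def)
  qed
  then show "lookup (taylor p) b \<in> box_polys X N" by (auto simp: box_polys_def)
qed

lemma taylor_polys: "p \<in> polys X \<Longrightarrow> lookup (taylor p) b \<in> polys X"
  by (meson polys_in_box_polys taylor_box(2) box_polys_subset subsetD)

text \<open>At an exponent \<open>m\<close> of maximal degree no other term of \<open>p\<close>
  contributes, because only multiples of \<open>m\<close> could. The coefficient is that of
  \<open>p\<close> with no factorial in front, so it is nonzero in every characteristic.\<close>

lemma taylor_top:
  assumes "p \<noteq> 0"
  obtains m where "m \<in> keys p" "lookup (taylor p) m = mconst (lookup p m)"
proof -
  define d where "d = Max (mdeg ` keys p)"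
  have ne: "keys p \<noteq> {}" using assms by simp
  then have "d \<in> mdeg ` keys p" unfolding d_def by (intro Max_in) auto
  then obtain m where m: "m \<in> keys p" "d = mdeg m" by auto
  have "lookup (taylor (power_product n :: ('a, 'b) mpoly)) m = 0" if "n \<in> keys p" "n \<noteq> m" for n
  proof (rule ccontr)
    assume "lookup (taylor (power_product n :: ('a, 'b) mpoly)) m \<noteq> 0"
    then have "mle m n" by (rule taylor_power_product_mle)
    moreover have "mdeg n \<le> mdeg m" unfolding m(2)[symmetric] d_def using that by simp
    ultimately show False using mle_mdeg that(2) by blast
  qed
  then have "lookup (taylor p) m = (\<Sum>n\<in>{m}. mconst (lookup p n) * lookup (taylor (power_product n)) m)"
    using m(1) by (subst lookup_taylor) (intro sum.mono_neutral_right, auto)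
  then show ?thesis using that[OF m(1)] by (simp add: taylor_power_product_top)
qed

lemma lookup_mult_0: "lookup (p * q) 0 = lookup p 0 * lookup q 0"
  for p q :: "('x, 'r::comm_ring_1) mpoly"
proof -
  have zero: "a = 0 \<and> b = 0" if "a + b = 0" for a b :: "'x \<Rightarrow>\<^sub>0 nat"
  proof -
    have "mdeg a + mdeg b = 0" using arg_cong[OF that, of mdeg] by (simp only: mdeg_add mdeg_0)
    then show ?thesis by (simp add: mdeg_eq_0_iff)
  qed
  have "lookup (p * q) 0 = (\<Sum>(a, b)\<in>{(a, b). a \<in> insert 0 (keys p) \<and> b \<in> insert 0 (keys q) \<and> a + b = 0}. lookup p a * lookup q b)"
    by (rule lookup_mult_finite) auto
  also have "{(a, b). a \<in> insert 0 (keys p) \<and> b \<in> insert 0 (keys q) \<and> a + b = 0} = {(0, 0)}"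
    by (auto dest!: zero)
  finally show ?thesis by simp
qed

lemma taylor_0: "lookup (taylor p) 0 = p"
proof -
  have "lookup (taylor (power_product m)) 0 = (power_product m :: ('a, 'b) mpoly)" for m
  proof (induction m rule: monomial_induct)
    case zero
    have "taylor 1 = (1 :: ('a, ('a, 'b) mpoly) mpoly)"
      unfolding taylor_def by (rule mpoly_eval_1[OF coeff_hom_mconst_mconst])
    then show ?case by simp
  next
    case (single m x)
    have "Poly_Mapping.single x (1::nat) \<noteq> 0" by (metis lookup_single_eq lookup_zero one_neq_zero)
    then have "lookup (taylor (mvar x)) 0 = (mvar x :: ('a, 'b) mpoly)"
      by (subst taylor_mvar) (auto simp: lookup_add mconst_def mvar_def power_product_def lookup_single when_def)
    with single show ?case by (simp add: power_product_add taylor_mult lookup_mult_0 mvar_def)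
  qed
  then have "lookup (taylor p) 0 = (\<Sum>m\<in>keys p. mconst (lookup p m) * power_product m)"
    by (simp only: lookup_taylor[of p])
  also have "\<dots> = p" by (rule mpoly_eq_sum[of p, symmetric])
  finally show ?thesis .
qed

section \<open>A lower bound for the number of local generators of a prime ideal\<close>

text \<open>The elements congruent to a multiple of \<open>x\<close> modulo the ideal of
  \<open>S\<close> form an ideal that contains all generators.\<close>

lemma genideal_mpoly_insert:
  fixes x :: "('x, 'k::comm_ring_1) mpoly"
  assumes S: "S \<subseteq> polys X" and x: "x \<in> polys X" and y: "y \<in> genideal (mpoly_ring X) (insert x S)"
  obtains r where "r \<in> polys X" "y - r * x \<in> genideal (mpoly_ring X) S"
proof -
  let ?I = "genideal (mpoly_ring X) S"
  define J where "J = {y \<in> polys X. \<exists>r\<in>polys X. y - r * x \<in> ?I}"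
  note I = genideal_mpoly_ideal[OF S]
  have "ideal J (mpoly_ring X)"
  proof (rule idealI_mpoly)
    show "0 \<in> J" using ideal_mpoly_0[OF I] by (auto simp: J_def intro!: bexI[of _ 0])
    fix a b :: "('x, 'k) mpoly" assume "a \<in> J" "b \<in> J"
    then obtain r s where *: "a \<in> polys X" "b \<in> polys X" "r \<in> polys X" "s \<in> polys X" "a - r * x \<in> ?I" "b - s * x \<in> ?I"
      by (auto simp: J_def)
    have "(a + b) - (r + s) * x \<in> ?I"
      using ideal_mpoly_add[OF I *(5,6)] by (simp add: algebra_simps)
    then show "a + b \<in> J" using * by (auto simp: J_def intro!: polys_add)
  next
    fix q a :: "('x, 'k) mpoly" assume q: "q \<in> polys X" and "a \<in> J"
    then obtain r where *: "a \<in> polys X" "r \<in> polys X" "a - r * x \<in> ?I" by (auto simp: J_def)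
    have "q * a - (q * r) * x \<in> ?I"
      using ideal_mpoly_mult[OF I q *(3)] by (simp add: algebra_simps)
    then show "q * a \<in> J" using q * by (auto simp: J_def intro!: polys_mult)
  qed (auto simp: J_def)
  moreover have "insert x S \<subseteq> J"
  proof -
    have "x - 1 * x \<in> ?I" using ideal_mpoly_0[OF I] by simp
    then have "x \<in> J" using x polys_1 unfolding J_def by blast
    moreover have "s \<in> J" if "s \<in> S" for s
    proof -
      have "s - 0 * x \<in> ?I" using genideal_mpoly_self[OF S] that by auto
      then show ?thesis using that S polys_0 unfolding J_def by blast
    qed
    ultimately show ?thesis by blast
  qed
  ultimately have "genideal (mpoly_ring X) (insert x S) \<subseteq> J" by (rule genideal_mpoly_minimal)
  then show ?thesis using that y by (auto simp: J_def)
qed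

text \<open>The colon ideal of \<open>I\<close> by \<open>w\<close> contains \<open>E\<close>, hence
  everything that \<open>E\<close> generates.\<close>

lemma genideal_mpoly_induct:
  fixes w :: "('x, 'k::comm_ring_1) mpoly"
  assumes E: "E \<subseteq> polys X" and I: "ideal I (mpoly_ring X)"
    and "\<And>g. g \<in> E \<Longrightarrow> g * w \<in> I" and r: "r \<in> genideal (mpoly_ring X) E"
  shows "r * w \<in> I"
proof -
  define J where "J = {r \<in> polys X. r * w \<in> I}"
  have "ideal J (mpoly_ring X)"
    by (rule idealI_mpoly)
       (auto simp: J_def distrib_right mult.assoc intro: ideal_mpoly_0[OF I] ideal_mpoly_add[OF I]
         ideal_mpoly_mult[OF I] polys_add polys_mult)
  moreover have "E \<subseteq> J" using assms(1,3) by (auto simp: J_def)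
  ultimately have "genideal (mpoly_ring X) E \<subseteq> J" by (rule genideal_mpoly_minimal)
  then show ?thesis using r by (auto simp: J_def)
qed

lemma genideal_mpoly_mono:
  "S \<subseteq> T \<Longrightarrow> T \<subseteq> polys X \<Longrightarrow> genideal (mpoly_ring X) S \<subseteq> genideal (mpoly_ring X) T"
  using genideal_mpoly_self[of T X] genideal_mpoly_ideal[of T X]
  by (intro genideal_mpoly_minimal) auto

lemma ex_sorted_enumeration:
  fixes w :: "'a \<Rightarrow> nat"
  assumes "finite A"
  obtains f where "bij_betw f {..<card A} A" "\<And>i j. i \<le> j \<Longrightarrow> j < card A \<Longrightarrow> w (f i) \<le> w (f j)"
proof -
  obtain xs where xs: "set xs = A" "distinct xs" using finite_distinct_list[OF assms] by blast
  define ys where "ys = sort_key w xs"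
  have ys: "set ys = A" "distinct ys" "length ys = card A" "sorted (map w ys)"
    using xs distinct_card[OF xs(2)] by (auto simp: ys_def)
  have "bij_betw ((!) ys) {..<card A} A" using ys by (intro bij_betw_nth) auto
  moreover have "w (ys ! i) \<le> w (ys ! j)" if "i \<le> j" "j < card A" for i j
    using sorted_nth_mono[OF ys(4), of i j] ys(3) that by simp
  ultimately show ?thesis using that by blast
qed

text \<open>The Leibniz formula with its leading term isolated. In an induction along exponents
  sorted by degree, the remaining terms involve only coefficients of \<open>q\<close> that have been
  treated before.\<close>

lemma lookup_mult_split:
  fixes p q :: "('x, 'r::comm_ring_1) mpoly"
  obtains S where "lookup (p * q) m = lookup p 0 * lookup q m + (\<Sum>(a, c)\<in>S. lookup p a * lookup q c)"
    "\<And>a c. (a, c) \<in> S \<Longrightarrow> a + c = m \<and> mdeg c < mdeg m"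
proof -
  define S where "S = {(a, c). a \<in> keys p \<and> c \<in> keys q \<and> a + c = m \<and> a \<noteq> 0}"
  have fin: "finite S" by (rule finite_subset[of _ "keys p \<times> keys q"]) (auto simp: S_def)
  have "lookup (p * q) m = (\<Sum>(a, c)\<in>{(a, c). a \<in> insert 0 (keys p) \<and> c \<in> insert m (keys q) \<and> a + c = m}. lookup p a * lookup q c)"
    by (rule lookup_mult_finite) auto
  also have "{(a, c). a \<in> insert 0 (keys p) \<and> c \<in> insert m (keys q) \<and> a + c = m} = insert (0, m) S"
    by (auto simp: S_def)
  also have "(\<Sum>(a, c)\<in>insert (0, m) S. lookup p a * lookup q c)
      = lookup p 0 * lookup q m + (\<Sum>(a, c)\<in>S. lookup p a * lookup q c)"
    by (subst sum.insert) (use fin in \<open>auto simp: S_def\<close>)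
  finally have eq: "lookup (p * q) m = \<dots>" .
  have "a + c = m \<and> mdeg c < mdeg m" if "(a, c) \<in> S" for a c
  proof -
    have "mdeg a \<noteq> 0" "a + c = m" using that by (auto simp: S_def mdeg_eq_0_iff)
    then show ?thesis using mdeg_add[of a c] by simp
  qed
  with eq that show ?thesis by blast
qed

text \<open>Membership in the differential power of order \<open>k\<close> of \<open>P\<close>,
  formed with Hasse derivatives. Products of \<open>k\<close> elements of \<open>P\<close> belong to
  it.\<close>

definition vanishing_order :: "('x, 'k::comm_ring_1) mpoly set \<Rightarrow> nat \<Rightarrow> ('x, 'k) mpoly \<Rightarrow> bool" where
  "vanishing_order P k f \<longleftrightarrow> (\<forall>b. mdeg b < k \<longrightarrow> lookup (taylor f) b \<in> P)"

text \<open>In each Leibniz term the two degrees add up to less than \<open>j + k\<close>, so one of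
  the two factors lies in \<open>P\<close>.\<close>

lemma vanishing_order_mult:
  fixes P :: "('x, 'k::comm_ring_1) mpoly set"
  assumes P: "ideal P (mpoly_ring X)" and "f \<in> polys X" "g \<in> polys X"
    and f: "vanishing_order P j f" and g: "vanishing_order P k g"
  shows "vanishing_order P (j + k) (f * g)"
  unfolding vanishing_order_def
proof (intro allI impI)
  fix b :: "'x \<Rightarrow>\<^sub>0 nat" assume b: "mdeg b < j + k"
  have "lookup (taylor (f * g)) b
      = (\<Sum>(a, c)\<in>{(a, c). a \<in> keys (taylor f) \<and> c \<in> keys (taylor g) \<and> a + c = b}. lookup (taylor f) a * lookup (taylor g) c)"
    unfolding taylor_mult by (rule lookup_mult_finite) auto
  also have "\<dots> \<in> P"
  proof (rule ideal_mpoly_sum[OF P])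
    fix x assume "x \<in> {(a, c). a \<in> keys (taylor f) \<and> c \<in> keys (taylor g) \<and> a + c = b}"
    then obtain a c where x: "x = (a, c)" "a + c = b" by auto
    then have "mdeg a < j \<or> mdeg c < k" using b mdeg_add[of a c] by auto
    then have "lookup (taylor f) a * lookup (taylor g) c \<in> P"
    proof
      assume "mdeg a < j"
      then have "lookup (taylor f) a \<in> P" using f by (simp add: vanishing_order_def)
      then show ?thesis using ideal_mpoly_mult[OF P taylor_polys[OF assms(3)]] by (simp add: mult.commute)
    next
      assume "mdeg c < k"
      then have "lookup (taylor g) c \<in> P" using g by (simp add: vanishing_order_def)
      then show ?thesis using ideal_mpoly_mult[OF P taylor_polys[OF assms(2)]] by simp
    qed
    then show "(case x of (a, c) \<Rightarrow> lookup (taylor f) a * lookup (taylor g) c) \<in> P" by (simp add: x)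
  qed
  finally show "lookup (taylor (f * g)) b \<in> P" .
qed

lemma vanishing_order_0: "vanishing_order P 0 f"
  by (simp add: vanishing_order_def)

lemma vanishing_order_1: "f \<in> P \<Longrightarrow> vanishing_order P 1 f"
  by (auto simp: vanishing_order_def mdeg_eq_0_iff taylor_0)

lemma vanishing_order_power:
  assumes P: "ideal P (mpoly_ring X)" and "f \<in> P"
  shows "vanishing_order P n (f ^ n)"
proof (induction n)
  case (Suc n)
  have fX: "f \<in> polys X" using ideal_mpoly_subset[OF P] assms(2) by blast
  have "vanishing_order P (1 + n) (f * f ^ n)"
    by (rule vanishing_order_mult[OF P fX polys_power[OF fX] vanishing_order_1[OF assms(2)] Suc])
  then show ?case by simp
qed (rule vanishing_order_0)

lemma vanishing_order_monomial:
  assumes P: "ideal P (mpoly_ring X)" and "finite E" "E \<subseteq> P"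
  shows "vanishing_order P (\<Sum>p\<in>E. a p) (\<Prod>p\<in>E. p ^ a p)"
  using assms(2,3)
proof (induction E rule: finite_induct)
  case (insert p E)
  have X: "q \<in> insert p E \<Longrightarrow> q \<in> polys X" for q using ideal_mpoly_subset[OF P] insert.prems by blast
  have "vanishing_order P (a p + (\<Sum>p\<in>E. a p)) (p ^ a p * (\<Prod>p\<in>E. p ^ a p))"
  proof (rule vanishing_order_mult[OF P])
    show "vanishing_order P (a p) (p ^ a p)" using insert.prems by (intro vanishing_order_power[OF P]) auto
    show "p ^ a p \<in> polys X" using X by (intro polys_power) auto
    show "(\<Prod>p\<in>E. p ^ a p) \<in> polys X" using X by (intro polys_prod polys_power) auto
  qed (use insert in auto)
  then show ?case using insert.hyps by simp
qed (simp add: vanishing_order_0)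

text \<open>Taylor coefficients map \<open>V\<close> to \<open>V\<close>, and only \<open>0\<close> has all its coefficients in \<open>P\<close>. So \<open>dim V\<close>
  is at most \<open>dim V/(V \<inter> P)\<close> times the number of strict steps of \<open>J\<close>. The members of \<open>J\<close> are
  \<open>P\<close>-saturated ideals because \<open>b\<close> is listed by increasing degree, so the number of strict steps is
  at most the number of monomials of degree at most \<open>D\<close> in local generators of \<open>P\<close>.\<close>

locale taylor_filtration =
  fixes X :: "'x set" and P :: "('x, 'k::field) mpoly set" and N :: nat and b :: "nat \<Rightarrow> 'x \<Rightarrow>\<^sub>0 nat"
  assumes finX: "finite X" and prime: "primeideal P (mpoly_ring X)"
    and bij: "bij_betw b {..<card (box X N)} (box X N)"
    and sorted: "\<And>i j. i \<le> j \<Longrightarrow> j < card (box X N) \<Longrightarrow> mdeg (b i) \<le> mdeg (b j)"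
begin

definition J :: "nat \<Rightarrow> ('x, 'k) mpoly set" where
  "J i = {f \<in> polys X. \<forall>j<i. lookup (taylor f) (b j) \<in> P}"

abbreviation M :: nat where
  "M \<equiv> card (box X N)"

lemma P: "ideal P (mpoly_ring X)"
  using prime by (rule primeideal_mpoly_ideal)

lemma b_box: "j < M \<Longrightarrow> b j \<in> box X N"
  using bij by (auto simp: bij_betw_def)

text \<open>A proper divisor of \<open>b j\<close> is again in the box and has smaller degree, so it
  is listed before \<open>j\<close>.\<close>

lemma lookup_J_smaller:
  assumes f: "f \<in> J i" and j: "j < i" "i \<le> M" and c: "a + c = b j" "mdeg c < mdeg (b j) \<or> c = b j"
  shows "lookup (taylor f) c \<in> P"
proof (cases "c = b j")
  case True
  then show ?thesis using f j by (simp add: J_def)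
next
  case False
  have "mle c (b j)" unfolding c(1)[symmetric] by (simp add: mle_def lookup_add)
  then have "c \<in> box X N" using b_box[of j] j mle_box by (metis less_le_trans)
  then obtain j' where j': "j' < M" "b j' = c" using bij_betw_lessThanD[OF bij] by blast
  have "j' < j"
  proof (rule ccontr)
    assume "\<not> j' < j"
    then have "mdeg (b j) \<le> mdeg c" using sorted[of j j'] j' by simp
    then show False using c False by simp
  qed
  then show ?thesis using f j j' by (auto simp: J_def)
qed

lemma J_ideal: assumes i: "i \<le> M" shows "ideal (J i) (mpoly_ring X)"
proof (rule idealI_mpoly)
  have "taylor (0 :: ('x, 'k) mpoly) = 0" by (simp add: taylor_def)
  then show "0 \<in> J i" by (simp add: J_def ideal_mpoly_0[OF P])
  show "f + g \<in> J i" if "f \<in> J i" "g \<in> J i" for f g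
    using that by (auto simp: J_def taylor_add lookup_add intro: polys_add ideal_mpoly_add[OF P])
  show "r * f \<in> J i" if r: "r \<in> polys X" and f: "f \<in> J i" for r f
  proof -
    have "lookup (taylor (r * f)) (b j) \<in> P" if j: "j < i" for j
    proof -
      obtain S where eq: "lookup (taylor r * taylor f) (b j)
          = lookup (taylor r) 0 * lookup (taylor f) (b j) + (\<Sum>(a, c)\<in>S. lookup (taylor r) a * lookup (taylor f) c)"
        and S: "\<And>a c. (a, c) \<in> S \<Longrightarrow> a + c = b j \<and> mdeg c < mdeg (b j)"
        by (rule lookup_mult_split) blast
      have "lookup (taylor r) 0 * lookup (taylor f) (b j) \<in> P"
        using f j by (intro ideal_mpoly_mult[OF P] taylor_polys r) (auto simp: J_def)
      moreover have "(\<Sum>(a, c)\<in>S. lookup (taylor r) a * lookup (taylor f) c) \<in> P"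
      proof (rule ideal_mpoly_sum[OF P])
        fix x assume x: "x \<in> S"
        obtain a c where ac: "x = (a, c)" by fastforce
        have "lookup (taylor f) c \<in> P"
          using S[of a c] x ac by (intro lookup_J_smaller[OF f j i, of a]) auto
        then have "lookup (taylor r) a * lookup (taylor f) c \<in> P"
          by (intro ideal_mpoly_mult[OF P] taylor_polys r)
        then show "(case x of (a, c) \<Rightarrow> lookup (taylor r) a * lookup (taylor f) c) \<in> P" by (simp add: ac)
      qed
      ultimately show ?thesis unfolding taylor_mult eq by (rule ideal_mpoly_add[OF P])
    qed
    then show ?thesis using r f by (auto simp: J_def intro: polys_mult)
  qed
qed (auto simp: J_def)

text \<open>The coefficient of \<open>u * f\<close> at \<open>b j\<close> is \<open>u\<close> times
  that of \<open>f\<close>, up to terms with earlier exponents. Since \<open>u\<close> lies outside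
  the prime \<open>P\<close>, the coefficients of \<open>f\<close> enter \<open>P\<close> one after
  another.\<close>

lemma J_saturated:
  assumes "i \<le> M" and u: "u \<in> polys X - P" and f: "f \<in> polys X" and uf: "u * f \<in> J i"
  shows "f \<in> J i"
proof -
  have "f \<in> J j" if "j \<le> i" for j
    using that
  proof (induction j)
    case 0
    then show ?case using f by (simp add: J_def)
  next
    case (Suc j)
    then have fj: "f \<in> J j" and j: "j < M" using assms(1) by auto
    obtain S where eq: "lookup (taylor u * taylor f) (b j)
        = lookup (taylor u) 0 * lookup (taylor f) (b j) + (\<Sum>(a, c)\<in>S. lookup (taylor u) a * lookup (taylor f) c)"
      and S: "\<And>a c. (a, c) \<in> S \<Longrightarrow> a + c = b j \<and> mdeg c < mdeg (b j)"
      by (rule lookup_mult_split) blast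
    have "(\<Sum>(a, c)\<in>S. lookup (taylor u) a * lookup (taylor f) c) \<in> P"
    proof (rule ideal_mpoly_sum[OF P])
      fix x assume x: "x \<in> S"
      obtain a c where ac: "x = (a, c)" by fastforce
      have c: "a + c = b j" "mdeg c < mdeg (b j)" using S[of a c] x ac by auto
      have "mle c (b j)" unfolding c(1)[symmetric] by (simp add: mle_def lookup_add)
      then have "c \<in> box X N" using b_box[OF j] mle_box by metis
      then obtain j' where j': "j' < M" "b j' = c" using bij_betw_lessThanD[OF bij] by blast
      have "j' < j" using sorted[of j j'] j' c by (metis leD leI)
      then have "lookup (taylor f) c \<in> P" using fj j' by (auto simp: J_def)
      then have "lookup (taylor u) a * lookup (taylor f) c \<in> P"
        using u by (intro ideal_mpoly_mult[OF P] taylor_polys) auto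
      then show "(case x of (a, c) \<Rightarrow> lookup (taylor u) a * lookup (taylor f) c) \<in> P" by (simp add: ac)
    qed
    moreover have "lookup (taylor u * taylor f) (b j) \<in> P"
      using uf Suc.prems by (auto simp: J_def taylor_mult)
    ultimately have "u * lookup (taylor f) (b j) \<in> P"
      using ideal_mpoly_cancel[OF P] unfolding eq taylor_0 by blast
    then have "lookup (taylor f) (b j) \<in> P"
      using primeideal_mpoly_mult[OF prime _ taylor_polys[OF f]] u by blast
    then show ?case using fj by (auto simp: J_def less_Suc_eq)
  qed
  then show ?thesis by simp
qed

lemma J_mono: "i \<le> j \<Longrightarrow> J j \<subseteq> J i"
  by (auto simp: J_def)

abbreviation V :: "('x, 'k) mpoly set" where
  "V \<equiv> box_polys X N"

text \<open>The top coefficient of a nonzero polynomial is a nonzero constant, which a prime cannot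
  contain. The box contains every exponent of \<open>f\<close>, so this coefficient is among those
  tested.\<close>

lemma J_top: "V \<inter> J M \<subseteq> {0}"
proof
  fix f assume f: "f \<in> V \<inter> J M"
  show "f \<in> {0}"
  proof (rule ccontr)
    assume "f \<notin> {0}"
    then obtain m where m: "m \<in> keys f" "lookup (taylor f) m = mconst (lookup f m)"
      using taylor_top[of f] by blast
    then have "m \<in> box X N" using f by (auto simp: box_polys_def)
    then obtain j where "j < M" "b j = m" using bij_betw_lessThanD[OF bij] by blast
    then have "mconst (lookup f m) \<in> P" using f m by (auto simp: J_def)
    moreover have "lookup f m \<noteq> 0" using m by (simp add: in_keys_iff)
    ultimately have "1 \<in> P"
      using lin_subspace_mconst_cancel[OF lin_subspace_ideal[OF P], of "lookup f m" 1] by simp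
    then show False using primeideal_mpoly_1[OF prime] by blast
  qed
qed

definition jumps :: "nat \<Rightarrow> nat set" where
  "jumps i = {j. j < i \<and> J j \<noteq> J (Suc j)}"

text \<open>A step that does not shrink \<open>J\<close> costs nothing; any other imposes one more
  Taylor coefficient, a linear map from \<open>V\<close> to \<open>V\<close> read modulo
  \<open>P\<close>.\<close>

lemma rel_dim_J: "i \<le> M \<Longrightarrow> rel_dim (J i) V \<le> card (jumps i) * rel_dim P V"
proof (induction i)
  case 0
  have "V \<subseteq> J 0" using box_polys_subset by (auto simp: J_def)
  then show ?case by (simp add: rel_dim_trivial)
next
  case (Suc i)
  have sub: "lin_subspace (J j)" if "j \<le> M" for j using J_ideal[OF that] by (rule lin_subspace_ideal)
  show ?case
  proof (cases "J i = J (Suc i)")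
    case True
    then have "jumps (Suc i) = jumps i" by (auto simp: jumps_def less_Suc_eq)
    then show ?thesis using True Suc by simp
  next
    case False
    then have "jumps (Suc i) = insert i (jumps i)" by (auto simp: jumps_def less_Suc_eq)
    then have card: "card (jumps (Suc i)) = Suc (card (jumps i))" by (simp add: jumps_def)
    have "rel_dim (J (Suc i)) V \<le> rel_dim (J i) V + rel_dim P V"
    proof (rule rel_dim_functional[where \<phi> = "\<lambda>f. lookup (taylor f) (b i)"])
      show "lookup (taylor f) (b i) \<in> V" if "f \<in> V" for f using taylor_box(2)[OF that] .
      show "f \<in> J (Suc i)" if "f \<in> J i" "lookup (taylor f) (b i) \<in> P" for f
        using that by (auto simp: J_def less_Suc_eq)
    qed (use Suc.prems sub lin_subspace_ideal[OF P] finX in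
        \<open>auto intro: finite_rel_dim_box lin_subspace_box_polys simp: lookup_taylor_lin_comb\<close>)
    then show ?thesis using Suc card by simp
  qed
qed

text \<open>By \<open>J_top\<close>, independence modulo zero survives modulo \<open>J M\<close>, so
  the jumps account for all of \<open>V\<close>.\<close>

lemma box_le_jumps: "(N + 1) ^ card X \<le> card (jumps M) * rel_dim P V"
proof -
  have JM: "lin_subspace (J M)" using J_ideal[of M] by (simp add: lin_subspace_ideal)
  have "rel_dim {0} V \<le> rel_dim (J M) V"
  proof -
    obtain v where v: "\<And>i. i < rel_dim {0} V \<Longrightarrow> v i \<in> V" "lin_indep_mod {0} (rel_dim {0} V) v"
      using rel_dim_attained[OF finite_rel_dim_box[OF finX lin_subspace_zero]] by blast
    have "lin_indep_mod (J M) (rel_dim {0} V) v"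
      unfolding lin_indep_mod_def
    proof (intro allI impI)
      fix c i assume c: "lin_comb (rel_dim {0} V) c v \<in> J M" and i: "i < rel_dim {0} V"
      have "lin_comb (rel_dim {0} V) c v \<in> V" using v(1) by (intro lin_comb_in lin_subspace_box_polys)
      then show "c i = 0" using c J_top v(2) i unfolding lin_indep_mod_def by blast
    qed
    then show ?thesis using v(1) by (intro rel_dim_ge[OF finite_rel_dim_box[OF finX JM]])
  qed
  then show ?thesis using rel_dim_zero_box[OF finX, of N, where 'k = 'k] rel_dim_J[of M] by linarith
qed

text \<open>The total degree of the corner of the box; no Taylor coefficient of higher degree is
  tested.\<close>

definition D :: nat where
  "D = N * card X"

lemma mdeg_box: "m \<in> box X N \<Longrightarrow> mdeg m \<le> D"
proof -
  assume m: "m \<in> box X N"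
  then have "mdeg m = (\<Sum>x\<in>X. lookup m x)" using finX by (intro mdeg_superset) (auto simp: box_def)
  also have "\<dots> \<le> (\<Sum>x\<in>X. N)" using m by (intro sum_mono) (auto simp: box_def)
  finally show ?thesis by (simp add: D_def mult.commute)
qed

text \<open>Modulo the monomials of degree above \<open>D\<close> in the generators, the local ring
  at \<open>P\<close> has a filtration in which every step is spanned by one monomial over the
  residue field. The reversed chain of the \<open>J i\<close> is compared with it by
  \<open>composition_jumps\<close>.\<close>

lemma card_jumps_le:
  assumes E: "finite E" "E \<subseteq> P" and gen: "\<And>p. p \<in> P \<Longrightarrow> \<exists>u\<in>polys X - P. u * p \<in> genideal (mpoly_ring X) E"
  shows "card (jumps M) \<le> (D + 1) ^ card E"
proof -
  define deg where "deg a = (\<Sum>p\<in>E. a p)" for a :: "('x, 'k) mpoly \<Rightarrow> nat"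
  define mon where "mon a = (\<Prod>p\<in>E. p ^ a p)" for a :: "('x, 'k) mpoly \<Rightarrow> nat"
  define A where "A = {a \<in> PiE E (\<lambda>_. {..D}). deg a \<le> D}"
  have EX: "E \<subseteq> polys X" using E ideal_mpoly_subset[OF P] by blast
  have finP: "finite (PiE E (\<lambda>_. {..D}))" using E by (simp add: finite_PiE)
  then have finA: "finite A" by (simp add: A_def)
  \<comment> \<open>Sorting by \<open>D - deg\<close> lists exponents by decreasing degree, so
    raising one exponent of \<open>a s\<close> leads to an earlier index or beyond degree
    \<open>D\<close>.\<close>
  obtain a where a: "bij_betw a {..<card A} A" "\<And>i j. i \<le> j \<Longrightarrow> j < card A \<Longrightarrow> D - deg (a i) \<le> D - deg (a j)"
    using ex_sorted_enumeration[OF finA, of "\<lambda>a. D - deg a"] by blast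
  define T where "T s = {e. D < deg e} \<union> a ` {..<s}" for s
  define I where "I s = genideal (mpoly_ring X) (mon ` T s)" for s
  \<comment> \<open>The \<open>P\<close>-saturation of \<open>I s\<close>, which amounts to its
    contraction from the local ring at \<open>P\<close>.\<close>
  define G where "G s = {f \<in> polys X. \<exists>u\<in>polys X - P. u * f \<in> I s}" for s
  have monX: "mon e \<in> polys X" for e unfolding mon_def using EX by (intro polys_prod polys_power) auto
  then have monT: "mon ` T s \<subseteq> polys X" for s by auto
  have I: "ideal (I s) (mpoly_ring X)" for s unfolding I_def by (rule genideal_mpoly_ideal[OF monT])
  have U_mult: "u * v \<in> polys X - P" if "u \<in> polys X - P" "v \<in> polys X - P" for u v
    using that primeideal_mpoly_mult[OF prime] polys_mult by blast
  have mon_mult: "p * mon e = mon (e(p := Suc (e p)))" and deg_mult: "deg (e(p := Suc (e p))) = Suc (deg e)"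
    if "p \<in> E" for p e
    using that E by (simp_all add: mon_def deg_def prod.remove[OF E(1) that] sum.remove[OF E(1) that] mult.assoc)
  \<comment> \<open>Elements generated by \<open>E\<close> annihilate \<open>mon (a s)\<close>
    modulo \<open>I s\<close>; hence its coefficient matters only through its residue class.\<close>
  have absorb: "r * mon (a s) \<in> I s" if s: "s < card A" and r: "r \<in> genideal (mpoly_ring X) E" for s r
  proof (rule genideal_mpoly_induct[OF EX I _ r])
    fix p assume p: "p \<in> E"
    define e where "e = (a s)(p := Suc (a s p))"
    have as: "a s \<in> A" using bij_betwE[OF a(1)] s by simp
    have "e \<in> T s"
    proof (cases "D < deg e")
      case False
      have "e q \<le> D" if "q \<in> E" for q
        using member_le_sum[OF that, of e] E False by (simp add: deg_def)
      moreover have "e \<in> extensional E" using as p by (auto simp: e_def A_def PiE_def extensional_def)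
      ultimately have "e \<in> A" using False by (auto simp: A_def PiE_def)
      then obtain j where j: "j < card A" "a j = e" using bij_betw_lessThanD[OF a(1)] by blast
      have "j < s"
      proof (rule ccontr)
        assume "\<not> j < s"
        then have "D - deg (a s) \<le> D - deg e" using a(2)[of s j] j by simp
        then show False using False deg_mult[OF p, of "a s"] by (simp add: e_def)
      qed
      then show ?thesis using j by (auto simp: T_def)
    qed (simp add: T_def)
    then have "mon e \<in> I s" using genideal_mpoly_self[OF monT] by (auto simp: I_def)
    then show "p * mon (a s) \<in> I s" using mon_mult[OF p] by (simp add: e_def)
  qed
  \<comment> \<open>The \<open>J i\<close> decrease, so the chain is read backwards.\<close>
  define K where "K i = J (M - i)" for i
  have "card {i. i < M \<and> K i \<noteq> K (Suc i)} \<le> card A"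
  proof (rule composition_jumps[where G = G and U = "polys X - P" and w = "\<lambda>s. mon (a s)"])
    fix i f g u
    show "f - g \<in> K i" if "f \<in> K i" "g \<in> K i"
      using ideal_mpoly_diff[OF J_ideal that[unfolded K_def]] by (simp add: K_def)
    show "u * f \<in> K i" if "u \<in> polys X - P" "f \<in> K i"
      using ideal_mpoly_mult[OF J_ideal _ that(2)[unfolded K_def], of u] that(1) by (simp add: K_def)
    show "f \<in> K i" if "u \<in> polys X - P" "f \<in> G (card A)" "u * f \<in> K i"
      using J_saturated[of "M - i" u f] that by (auto simp: K_def G_def)
    show "K i \<subseteq> K (Suc i)" by (simp add: K_def J_mono)
  next
    \<comment> \<open>A monomial of degree above \<open>D\<close> vanishes to an order above every
      \<open>mdeg (b j)\<close>, so all its tested coefficients lie in \<open>P\<close>; saturation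
      of \<open>J M\<close> extends this to \<open>G 0\<close>.\<close>
    show "G 0 \<subseteq> K 0"
    proof
      fix f assume "f \<in> G 0"
      then obtain u where f: "f \<in> polys X" and u: "u \<in> polys X - P" and uf: "u * f \<in> I 0" by (auto simp: G_def)
      have "I 0 \<subseteq> J M"
        unfolding I_def
      proof (rule genideal_mpoly_minimal[OF J_ideal])
        show "mon ` T 0 \<subseteq> J M"
        proof
          fix m assume "m \<in> mon ` T 0"
          then obtain e where e: "D < deg e" "m = mon e" by (auto simp: T_def)
          have "lookup (taylor m) (b j) \<in> P" if "j < M" for j
            using vanishing_order_monomial[OF P E, of e] mdeg_box[OF b_box[OF that]] e
            by (auto simp: vanishing_order_def mon_def deg_def)
          then show "m \<in> J M" using e monX by (auto simp: J_def)
        qed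
      qed simp
      then show "f \<in> K 0" using J_saturated[of M u f] u f uf by (auto simp: K_def)
    qed
    \<comment> \<open>The zero exponent vector belongs to \<open>A\<close>, hence the last ideal of
      the filtration is the whole ring.\<close>
    have "1 \<in> I (card A)"
    proof -
      have "restrict (\<lambda>_. 0) E \<in> A" by (auto simp: A_def deg_def)
      then obtain j where "j < card A" "a j = restrict (\<lambda>_. 0) E" using bij_betw_lessThanD[OF a(1)] by blast
      then have "mon (restrict (\<lambda>_. 0) E) \<in> I (card A)"
        using genideal_mpoly_self[OF monT, of "card A"] by (force simp: I_def T_def)
      then show ?thesis by (simp add: mon_def)
    qed
    then have "polys X \<subseteq> I (card A)" using ideal_carrier_iff[OF I] by blast
    moreover have "1 \<in> polys X - P" using primeideal_mpoly_1[OF prime] by simp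
    ultimately show "K M \<subseteq> G (card A)"
    proof (intro subsetI)
      fix f assume "f \<in> K M"
      then have "f \<in> polys X" by (simp add: K_def J_def)
      moreover from this have "1 * f \<in> I (card A)" using \<open>polys X \<subseteq> I (card A)\<close> by auto
      ultimately show "f \<in> G (card A)" using \<open>1 \<in> polys X - P\<close> unfolding G_def by blast
    qed
  next
    fix s f g u
    show "f - g \<in> G s" if fg: "f \<in> G s" "g \<in> G s"
    proof -
      obtain u v where uv: "u \<in> polys X - P" "v \<in> polys X - P" "u * f \<in> I s" "v * g \<in> I s"
        and fgX: "f \<in> polys X" "g \<in> polys X"
        using fg by (auto simp: G_def)
      have "v * (u * f) \<in> I s" "u * (v * g) \<in> I s"
        using uv ideal_mpoly_mult[OF I _ uv(3), of v] ideal_mpoly_mult[OF I _ uv(4), of u] by auto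
      then have "v * (u * f) - u * (v * g) \<in> I s" by (rule ideal_mpoly_diff[OF I])
      then have "(u * v) * (f - g) \<in> I s" by (simp add: algebra_simps)
      then show ?thesis using U_mult[OF uv(1,2)] fgX polys_diff by (auto simp: G_def)
    qed
    show "u * f \<in> G s" if u: "u \<in> polys X - P" and f: "f \<in> G s"
    proof -
      obtain v where v: "v \<in> polys X - P" "v * f \<in> I s" "f \<in> polys X" using f by (auto simp: G_def)
      have "u * (v * f) \<in> I s" using u by (intro ideal_mpoly_mult[OF I _ v(2)]) auto
      then have "v * (u * f) \<in> I s" by (simp add: ac_simps)
      then show ?thesis using u v polys_mult by (auto simp: G_def)
    qed
    show "G s \<subseteq> G (Suc s)"
    proof -
      have "I s \<subseteq> I (Suc s)" unfolding I_def
        by (rule genideal_mpoly_mono[OF _ monT]) (auto simp: T_def)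
      then show ?thesis by (auto simp: G_def)
    qed
    show "\<exists>u\<in>polys X - P. \<exists>c\<in>insert 0 (polys X - P). u * f - c * mon (a s) \<in> G s"
      if s: "s < card A" and f: "f \<in> G (Suc s)"
    proof -
      obtain u where u: "u \<in> polys X - P" "u * f \<in> I (Suc s)" and fX: "f \<in> polys X" using f by (auto simp: G_def)
      have "mon ` T (Suc s) = insert (mon (a s)) (mon ` T s)" by (auto simp: T_def less_Suc_eq)
      then have "u * f \<in> genideal (mpoly_ring X) (insert (mon (a s)) (mon ` T s))" using u by (simp add: I_def)
      then obtain r where r: "r \<in> polys X" "u * f - r * mon (a s) \<in> I s"
        unfolding I_def using genideal_mpoly_insert[OF monT monX] by blast
      have I_G: "I s \<subseteq> G s"
      proof
        fix h assume "h \<in> I s"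
        then have "h \<in> polys X" "1 * h \<in> I s" using ideal_mpoly_subset[OF I, of s] by auto
        moreover have "1 \<in> polys X - P" using primeideal_mpoly_1[OF prime] by simp
        ultimately show "h \<in> G s" unfolding G_def by blast
      qed
      show ?thesis
      proof (cases "r \<in> P")
        case False
        then show ?thesis using u r I_G by blast
      next
        \<comment> \<open>A coefficient in \<open>P\<close> is first multiplied into the ideal of
          \<open>E\<close> and then absorbed, so the leading coefficient may be taken as
          \<open>0\<close>.\<close>
        case True
        then obtain v where v: "v \<in> polys X - P" "v * r \<in> genideal (mpoly_ring X) E" using gen by blast
        have "v * (u * f - r * mon (a s)) + (v * r) * mon (a s) \<in> I s"
          using v r absorb[OF s v(2)] ideal_mpoly_mult[OF I _ r(2), of v] by (intro ideal_mpoly_add[OF I]) auto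
        then have "(v * u) * f - 0 * mon (a s) \<in> I s" by (simp add: algebra_simps)
        then show ?thesis using U_mult[OF v(1) u(1)] I_G by blast
      qed
    qed
  qed
  moreover have "card (jumps M) = card {i. i < M \<and> K i \<noteq> K (Suc i)}"
  \<comment> \<open>Step \<open>i\<close> of \<open>J\<close> is step \<open>M - Suc i\<close> of
    the reversed chain.\<close>
  proof (rule bij_betw_same_card[of "\<lambda>i. M - Suc i"])
    have "M - i = Suc (M - Suc i)" if "i < M" for i using that by simp
    then show "bij_betw (\<lambda>i. M - Suc i) (jumps M) {i. i < M \<and> K i \<noteq> K (Suc i)}"
      by (intro bij_betw_byWitness[where f' = "\<lambda>i. M - Suc i"]) (auto simp: jumps_def K_def)
  qed
  moreover have "card A \<le> card (PiE E (\<lambda>_. {..D}))" by (rule card_mono[OF finP]) (auto simp: A_def)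
  moreover have "card (PiE E (\<lambda>_. {..D})) = (D + 1) ^ card E" using E by (simp add: card_PiE)
  ultimately show ?thesis by simp
qed

end

text \<open>The inequality between embedding dimension and height, with \<open>card X - d\<close>
  for the height. The two counts of jumps combine to
  \<open>(N + 1) ^ card X \<le> C' * (N + 1) ^ (card E + d)\<close> for every \<open>N\<close>,
  which forces the order of the exponents.\<close>

theorem card_le_local_generators:
  fixes P :: "('x, 'k::field) mpoly set"
  assumes X: "finite X" and P: "primeideal P (mpoly_ring X)" and E: "finite E" "E \<subseteq> P"
    and gen: "\<And>p. p \<in> P \<Longrightarrow> \<exists>u\<in>polys X - P. u * p \<in> genideal (mpoly_ring X) E"
    and growth: "growth_le X P d"
  shows "card X \<le> card E + d"
proof (rule ccontr)
  let ?e = "card E"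
  assume neg: "\<not> card X \<le> ?e + d"
  obtain C where C: "\<And>N. rel_dim P (box_polys X N) \<le> C * (N + 1) ^ d"
    using growth by (auto simp: growth_le_def)
  \<comment> \<open>The factor \<open>(card X + 1) ^ card E\<close> comes from
    \<open>D + 1 \<le> (card X + 1) * (N + 1)\<close>.\<close>
  define C' where "C' = (card X + 1) ^ ?e * C"
  have le: "(N + 1) ^ card X \<le> C' * (N + 1) ^ (?e + d)" for N
  proof -
    obtain b where "bij_betw b {..<card (box X N)} (box X N)"
      "\<And>i j. i \<le> j \<Longrightarrow> j < card (box X N) \<Longrightarrow> mdeg (b i) \<le> mdeg (b j)"
      using ex_sorted_enumeration[OF finite_box[OF X], where w = mdeg] by blast
    then interpret taylor_filtration X P N b by (intro taylor_filtration.intro X P)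
    have "D + 1 \<le> (card X + 1) * (N + 1)" by (simp add: D_def algebra_simps)
    then have "(D + 1) ^ ?e \<le> (card X + 1) ^ ?e * (N + 1) ^ ?e"
      unfolding power_mult_distrib[symmetric] by (rule power_mono) simp
    then have "card (jumps M) \<le> (card X + 1) ^ ?e * (N + 1) ^ ?e"
      using card_jumps_le[OF E gen] by linarith
    then have "card (jumps M) * rel_dim P V \<le> ((card X + 1) ^ ?e * (N + 1) ^ ?e) * (C * (N + 1) ^ d)"
      using C[of N] by (rule mult_le_mono)
    also have "\<dots> = C' * (N + 1) ^ (?e + d)" by (simp add: C'_def power_add ac_simps)
    finally show ?thesis using box_le_jumps by linarith
  qed
  \<comment> \<open>Evaluation at \<open>N = C'\<close> makes the base exceed the constant.\<close>
  have "(C' + 1) * (C' + 1) ^ (?e + d) \<le> (C' + 1) ^ card X"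
    using neg power_increasing[of "Suc (?e + d)" "card X" "C' + 1"] by simp
  also have "\<dots> \<le> C' * (C' + 1) ^ (?e + d)" using le[of C'] by simp
  finally show False by simp
qed

section \<open>Chains of sets and localization\<close>

lemma chain_length_ge:
  assumes "\<And>i. i \<le> n \<Longrightarrow> C i \<in> \<F>" "\<And>i. i < n \<Longrightarrow> C i \<subset> C (Suc i)"
  shows "enat n \<le> chain_length \<F>"
  unfolding chain_length_def by (rule SUP_upper) (use assms in blast)

lemma chain_length_le:
  assumes "\<And>n C. (\<And>i. i \<le> n \<Longrightarrow> C i \<in> \<F>) \<Longrightarrow> (\<And>i. i < n \<Longrightarrow> C i \<subset> C (Suc i)) \<Longrightarrow> n \<le> d"
  shows "chain_length \<F> \<le> enat d"
  unfolding chain_length_def by (rule SUP_least) (use assms in auto)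

text \<open>A finite supremum of natural numbers is attained as soon as there is a chain at all. The
  empty family also has \<open>chain_length\<close> zero, but no chain.\<close>

lemma chain_length_attained:
  assumes "chain_length \<F> = enat n" "\<F> \<noteq> {}"
  obtains C where "\<And>i. i \<le> n \<Longrightarrow> C i \<in> \<F>" "\<And>i. i < n \<Longrightarrow> C i \<subset> C (Suc i)"
proof -
  let ?N = "{n. \<exists>C. (\<forall>i \<le> n. C i \<in> \<F>) \<and> (\<forall>i < n. C i \<subset> C (Suc i))}"
  have "n \<in> ?N"
  proof (rule ccontr)
    assume neg: "n \<notin> ?N"
    have le: "k \<le> n" if "k \<in> ?N" for k
    proof -
      have "enat k \<le> chain_length \<F>" unfolding chain_length_def using that by (rule SUP_upper)
      then show ?thesis using assms(1) by simp
    qed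
    obtain F where "F \<in> \<F>" using assms(2) by blast
    then have "0 \<in> ?N" by (auto intro!: exI[of _ "\<lambda>_. F"])
    then have n: "n \<noteq> 0" using neg by metis
    have "chain_length \<F> \<le> enat (n - 1)"
      unfolding chain_length_def
    proof (rule SUP_least)
      fix k assume k: "k \<in> ?N"
      then have "k \<noteq> n" using neg by metis
      then show "enat k \<le> enat (n - 1)" using le[OF k] by simp
    qed
    then show False using assms(1) n by simp
  qed
  then show ?thesis using that by blast
qed

text \<open>Operations on fractions are unions over all representatives; once the result is
  independent of them the union collapses, provided that both classes are inhabited.\<close>

lemma UN_pair_const:
  assumes "\<And>a b c d. (a, b) \<in> A \<Longrightarrow> (c, d) \<in> B \<Longrightarrow> f a b c d = Y" "p \<in> A" "q \<in> B"
  shows "(\<Union>(a, b)\<in>A. \<Union>(c, d)\<in>B. f a b c d) = Y"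
proof -
  have "(\<Union>(a, b)\<in>A. \<Union>(c, d)\<in>B. f a b c d) = (\<Union>x\<in>A. \<Union>y\<in>B. Y)"
    using assms(1) by (intro SUP_cong) auto
  then show ?thesis using assms(2,3) by auto
qed

section \<open>The localization at a prime, its maximal ideal and regularity\<close>

context primeideal
begin

abbreviation frac where "frac \<equiv> fraction R I"
abbreviation loc where "loc \<equiv> localization R I"
definition S where "S = carrier R - I"

definition frac_rel where
  "frac_rel a s b t \<longleftrightarrow> (\<exists>u\<in>S. u \<otimes> (t \<otimes> a) = u \<otimes> (s \<otimes> b))"

lemma S_iff: "s \<in> S \<longleftrightarrow> s \<in> carrier R \<and> s \<notin> I"
  by (simp add: S_def)

lemma S_carrier [simp]: "s \<in> S \<Longrightarrow> s \<in> carrier R"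
  by (simp add: S_def)

lemma S_mult [simp]: "s \<in> S \<Longrightarrow> t \<in> S \<Longrightarrow> s \<otimes> t \<in> S"
  using I_prime by (auto simp: S_def)

lemma S_one [simp]: "\<one> \<in> S"
  using one_imp_carrier I_notcarr by (auto simp: S_def)

lemma frac_rel_refl: "a \<in> carrier R \<Longrightarrow> s \<in> S \<Longrightarrow> frac_rel a s a s"
  unfolding frac_rel_def using S_one by blast

lemma frac_rel_sym: "frac_rel a s b t \<Longrightarrow> frac_rel b t a s"
  unfolding frac_rel_def by metis

lemma frac_rel_trans:
  assumes "a \<in> carrier R" "b \<in> carrier R" "c \<in> carrier R" "s \<in> S" "t \<in> S" "r \<in> S"
    and "frac_rel a s b t" "frac_rel b t c r"
  shows "frac_rel a s c r"
proof -
  obtain u v where u: "u \<in> S" "u \<otimes> (t \<otimes> a) = u \<otimes> (s \<otimes> b)" and v: "v \<in> S" "v \<otimes> (r \<otimes> b) = v \<otimes> (t \<otimes> c)"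
    using assms(7,8) by (auto simp: frac_rel_def)
  note car = assms(1-3) S_carrier[OF assms(4)] S_carrier[OF assms(5)] S_carrier[OF assms(6)]
    S_carrier[OF u(1)] S_carrier[OF v(1)]
  \<comment> \<open>The middle denominator \<open>t\<close> has to join the multiplier, together
    with the two given multipliers.\<close>
  have "(u \<otimes> (v \<otimes> t)) \<otimes> (r \<otimes> a) = (v \<otimes> r) \<otimes> (u \<otimes> (t \<otimes> a))" using car by (simp add: m_ac)
  also have "\<dots> = (u \<otimes> s) \<otimes> (v \<otimes> (r \<otimes> b))" unfolding u(2) using car by (simp add: m_ac)
  also have "\<dots> = (u \<otimes> (v \<otimes> t)) \<otimes> (s \<otimes> c)" unfolding v(2) using car by (simp add: m_ac)
  finally show ?thesis unfolding frac_rel_def using u(1) v(1) assms(5) S_mult by blast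
qed

lemma mem_frac_iff: "(b, t) \<in> frac a s \<longleftrightarrow> b \<in> carrier R \<and> t \<in> S \<and> frac_rel a s b t"
  by (auto simp: fraction_def frac_rel_def S_def)

lemma frac_eq_iff:
  assumes "a \<in> carrier R" "b \<in> carrier R" "s \<in> S" "t \<in> S"
  shows "frac a s = frac b t \<longleftrightarrow> frac_rel a s b t"
proof
  assume "frac a s = frac b t"
  then have "(b, t) \<in> frac a s" using assms by (simp add: mem_frac_iff frac_rel_refl)
  then show "frac_rel a s b t" by (simp add: mem_frac_iff)
next
  assume rel: "frac_rel a s b t"
  have "frac_rel a s c r \<longleftrightarrow> frac_rel b t c r" if "c \<in> carrier R" "r \<in> S" for c r
    using frac_rel_trans[of b a c t s r] frac_rel_trans[of a b c s t r] rel frac_rel_sym[OF rel] assms that by blast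
  then have "(c, r) \<in> frac a s \<longleftrightarrow> (c, r) \<in> frac b t" for c r
    unfolding mem_frac_iff by blast
  then show "frac a s = frac b t" by auto
qed

lemma frac_cancel:
  assumes "a \<in> carrier R" "s \<in> S" "r \<in> S"
  shows "frac (r \<otimes> a) (r \<otimes> s) = frac a s"
proof (subst frac_eq_iff)
  have "\<one> \<otimes> (s \<otimes> (r \<otimes> a)) = \<one> \<otimes> (r \<otimes> s \<otimes> a)" using assms by (simp add: m_ac)
  then show "frac_rel (r \<otimes> a) (r \<otimes> s) a s" unfolding frac_rel_def using S_one by blast
qed (use assms S_mult in auto)

text \<open>Only the first fraction varies; commutativity then gives the second, here and likewise
  for sums.\<close>

lemma frac_mult_cong:
  assumes a: "a \<in> carrier R" "a' \<in> carrier R" "s \<in> S" "s' \<in> S" "frac_rel a s a' s'" and b: "b \<in> carrier R" "t \<in> S"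
  shows "frac (a \<otimes> b) (s \<otimes> t) = frac (a' \<otimes> b) (s' \<otimes> t)"
proof -
  obtain u where u: "u \<in> S" "u \<otimes> (s' \<otimes> a) = u \<otimes> (s \<otimes> a')" using a by (auto simp: frac_rel_def)
  have "u \<otimes> (s' \<otimes> t \<otimes> (a \<otimes> b)) = u \<otimes> (s' \<otimes> a) \<otimes> (t \<otimes> b)" using a(1-4) b u(1) by (simp add: m_ac)
  also have "\<dots> = u \<otimes> (s \<otimes> t \<otimes> (a' \<otimes> b))" unfolding u(2) using a(1-4) b u(1) by (simp add: m_ac)
  finally show ?thesis using a b u(1) by (subst frac_eq_iff) (auto simp: frac_rel_def)
qed

lemma frac_add_cong:
  assumes a: "a \<in> carrier R" "a' \<in> carrier R" "s \<in> S" "s' \<in> S" "frac_rel a s a' s'" and b: "b \<in> carrier R" "t \<in> S"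
  shows "frac ((a \<otimes> t) \<oplus> (b \<otimes> s)) (s \<otimes> t) = frac ((a' \<otimes> t) \<oplus> (b \<otimes> s')) (s' \<otimes> t)"
proof -
  obtain u where u: "u \<in> S" "u \<otimes> (s' \<otimes> a) = u \<otimes> (s \<otimes> a')" using a by (auto simp: frac_rel_def)
  have "u \<otimes> (s' \<otimes> t \<otimes> ((a \<otimes> t) \<oplus> (b \<otimes> s))) = u \<otimes> (s' \<otimes> a) \<otimes> (t \<otimes> t) \<oplus> u \<otimes> (s' \<otimes> t \<otimes> (b \<otimes> s))"
    using a(1-4) b u(1) by (simp add: m_ac r_distr)
  also have "\<dots> = u \<otimes> (s \<otimes> t \<otimes> ((a' \<otimes> t) \<oplus> (b \<otimes> s')))"
    unfolding u(2) using a(1-4) b u(1) by (simp add: m_ac r_distr)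
  finally show ?thesis using a b u(1) by (subst frac_eq_iff) (auto simp: frac_rel_def)
qed

lemma loc_mult:
  assumes "a \<in> carrier R" "b \<in> carrier R" "s \<in> S" "t \<in> S"
  shows "frac a s \<otimes>\<^bsub>loc\<^esub> frac b t = frac (a \<otimes> b) (s \<otimes> t)"
proof -
  have "frac (a' \<otimes> b') (s' \<otimes> t') = frac (a \<otimes> b) (s \<otimes> t)"
    if in': "(a', s') \<in> frac a s" "(b', t') \<in> frac b t" for a' b' s' t'
  proof -
    from in' have ab: "a' \<in> carrier R" "b' \<in> carrier R" "s' \<in> S" "t' \<in> S" "frac_rel a s a' s'" "frac_rel b t b' t'"
      by (auto simp: mem_frac_iff)
    have "frac (a \<otimes> b) (s \<otimes> t) = frac (a' \<otimes> b) (s' \<otimes> t)" using assms ab by (intro frac_mult_cong)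
    also have "\<dots> = frac (b \<otimes> a') (t \<otimes> s')" using assms ab by (simp add: m_comm)
    also have "\<dots> = frac (b' \<otimes> a') (t' \<otimes> s')" using assms ab by (intro frac_mult_cong)
    finally show ?thesis using ab by (simp add: m_comm)
  qed
  moreover have "(a, s) \<in> frac a s" "(b, t) \<in> frac b t" using assms by (auto simp: mem_frac_iff frac_rel_refl)
  ultimately have "(\<Union>(a', s')\<in>frac a s. \<Union>(b', t')\<in>frac b t. frac (a' \<otimes> b') (s' \<otimes> t')) = frac (a \<otimes> b) (s \<otimes> t)"
    by (rule UN_pair_const)
  then show ?thesis by (simp add: localization_def)
qed

lemma loc_add:
  assumes "a \<in> carrier R" "b \<in> carrier R" "s \<in> S" "t \<in> S"
  shows "frac a s \<oplus>\<^bsub>loc\<^esub> frac b t = frac ((a \<otimes> t) \<oplus> (b \<otimes> s)) (s \<otimes> t)"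
proof -
  have "frac ((a' \<otimes> t') \<oplus> (b' \<otimes> s')) (s' \<otimes> t') = frac ((a \<otimes> t) \<oplus> (b \<otimes> s)) (s \<otimes> t)"
    if in': "(a', s') \<in> frac a s" "(b', t') \<in> frac b t" for a' b' s' t'
  proof -
    from in' have ab: "a' \<in> carrier R" "b' \<in> carrier R" "s' \<in> S" "t' \<in> S" "frac_rel a s a' s'" "frac_rel b t b' t'"
      by (auto simp: mem_frac_iff)
    have "frac ((a \<otimes> t) \<oplus> (b \<otimes> s)) (s \<otimes> t) = frac ((a' \<otimes> t) \<oplus> (b \<otimes> s')) (s' \<otimes> t)"
      using assms ab by (intro frac_add_cong)
    also have "\<dots> = frac ((b \<otimes> s') \<oplus> (a' \<otimes> t)) (t \<otimes> s')" using assms ab by (simp add: m_comm a_comm)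
    also have "\<dots> = frac ((b' \<otimes> s') \<oplus> (a' \<otimes> t')) (t' \<otimes> s')" using assms ab by (intro frac_add_cong)
    finally show ?thesis using ab by (simp add: m_comm a_comm)
  qed
  moreover have "(a, s) \<in> frac a s" "(b, t) \<in> frac b t" using assms by (auto simp: mem_frac_iff frac_rel_refl)
  ultimately have "(\<Union>(a', s')\<in>frac a s. \<Union>(b', t')\<in>frac b t. frac ((a' \<otimes> t') \<oplus> (b' \<otimes> s')) (s' \<otimes> t'))
      = frac ((a \<otimes> t) \<oplus> (b \<otimes> s)) (s \<otimes> t)"
    by (rule UN_pair_const)
  then show ?thesis by (simp add: localization_def)
qed

lemma loc_carrier: "carrier loc = {frac a s |a s. a \<in> carrier R \<and> s \<in> S}"
  and loc_one: "\<one>\<^bsub>loc\<^esub> = frac \<one> \<one>"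
  and loc_zero: "\<zero>\<^bsub>loc\<^esub> = frac \<zero> \<one>"
  by (simp_all add: localization_def S_def)

lemma loc_carrierE:
  assumes "x \<in> carrier loc"
  obtains a s where "a \<in> carrier R" "s \<in> S" "x = frac a s"
  using assms by (auto simp: loc_carrier)

lemma frac_in_loc [simp]: "a \<in> carrier R \<Longrightarrow> s \<in> S \<Longrightarrow> frac a s \<in> carrier loc"
  unfolding loc_carrier by blast

lemma frac_zero: "s \<in> S \<Longrightarrow> frac \<zero> s = \<zero>\<^bsub>loc\<^esub>"
  using frac_cancel[of \<zero> \<one> s] by (simp add: loc_zero)

lemma cring_loc: "cring loc"
proof (intro cringI abelian_groupI comm_monoidI)
  fix x y assume "x \<in> carrier loc" "y \<in> carrier loc"
  then obtain a s b t where x: "a \<in> carrier R" "s \<in> S" "x = frac a s"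
    and y: "b \<in> carrier R" "t \<in> S" "y = frac b t" by (metis loc_carrierE)
  note car = x(1) S_carrier[OF x(2)] y(1) S_carrier[OF y(2)]
  show "x \<oplus>\<^bsub>loc\<^esub> y \<in> carrier loc" unfolding x y using loc_add x y car by simp
  show "x \<otimes>\<^bsub>loc\<^esub> y \<in> carrier loc" unfolding x y using loc_mult x y car by simp
  show "x \<oplus>\<^bsub>loc\<^esub> y = y \<oplus>\<^bsub>loc\<^esub> x" unfolding x y using loc_add x y car by (simp add: a_comm m_comm)
  show "x \<otimes>\<^bsub>loc\<^esub> y = y \<otimes>\<^bsub>loc\<^esub> x" unfolding x y using loc_mult x y car by (simp add: m_comm)
next
  show "\<zero>\<^bsub>loc\<^esub> \<in> carrier loc" "\<one>\<^bsub>loc\<^esub> \<in> carrier loc" by (simp_all add: loc_zero loc_one)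
next
  fix x assume "x \<in> carrier loc"
  then obtain a s where x: "a \<in> carrier R" "s \<in> S" "x = frac a s" by (rule loc_carrierE)
  note car = x(1) S_carrier[OF x(2)]
  show "\<zero>\<^bsub>loc\<^esub> \<oplus>\<^bsub>loc\<^esub> x = x" unfolding x loc_zero using x car by (simp add: loc_add)
  show "\<one>\<^bsub>loc\<^esub> \<otimes>\<^bsub>loc\<^esub> x = x" unfolding x loc_one using x car by (simp add: loc_mult)
  have "frac (\<ominus> a) s \<oplus>\<^bsub>loc\<^esub> x = frac ((\<ominus> a \<oplus> a) \<otimes> s) (s \<otimes> s)"
    unfolding x using x car by (simp add: loc_add l_distr)
  then have "frac (\<ominus> a) s \<oplus>\<^bsub>loc\<^esub> x = \<zero>\<^bsub>loc\<^esub>" using x car frac_zero[of "s \<otimes> s"] S_mult by (simp add: l_neg)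
  then show "\<exists>y\<in>carrier loc. y \<oplus>\<^bsub>loc\<^esub> x = \<zero>\<^bsub>loc\<^esub>"
    using x by (intro bexI[of _ "frac (\<ominus> a) s"]) auto
next
  fix x y z assume "x \<in> carrier loc" "y \<in> carrier loc" "z \<in> carrier loc"
  then obtain a s b t c r where x: "a \<in> carrier R" "s \<in> S" "x = frac a s"
    and y: "b \<in> carrier R" "t \<in> S" "y = frac b t" and z: "c \<in> carrier R" "r \<in> S" "z = frac c r"
    by (metis loc_carrierE)
  note car = x(1) S_carrier[OF x(2)] y(1) S_carrier[OF y(2)] z(1) S_carrier[OF z(2)]
  note Sm = S_mult[OF x(2) y(2)] S_mult[OF y(2) z(2)] S_mult[OF x(2) z(2)]
  note add = loc_add[OF _ _ x(2) y(2)] loc_add[OF _ _ y(2) z(2)] loc_add[OF _ _ Sm(1) z(2)]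
    loc_add[OF _ _ x(2) Sm(2)] loc_add[OF _ _ Sm(3) Sm(2)]
  note mul = loc_mult[OF _ _ x(2) y(2)] loc_mult[OF _ _ y(2) z(2)] loc_mult[OF _ _ Sm(1) z(2)]
    loc_mult[OF _ _ x(2) Sm(2)] loc_mult[OF _ _ x(2) z(2)]
  have "x \<oplus>\<^bsub>loc\<^esub> y \<oplus>\<^bsub>loc\<^esub> z = frac ((a \<otimes> t \<oplus> b \<otimes> s) \<otimes> r \<oplus> c \<otimes> (s \<otimes> t)) (s \<otimes> t \<otimes> r)"
    unfolding x y z using car by (simp add: add)
  also have "\<dots> = frac (a \<otimes> (t \<otimes> r) \<oplus> (b \<otimes> r \<oplus> c \<otimes> t) \<otimes> s) (s \<otimes> (t \<otimes> r))"
    using car by (simp add: l_distr r_distr m_ac a_ac)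
  also have "\<dots> = x \<oplus>\<^bsub>loc\<^esub> (y \<oplus>\<^bsub>loc\<^esub> z)"
    unfolding x y z using car by (simp add: add)
  finally show "x \<oplus>\<^bsub>loc\<^esub> y \<oplus>\<^bsub>loc\<^esub> z = x \<oplus>\<^bsub>loc\<^esub> (y \<oplus>\<^bsub>loc\<^esub> z)" .
  show "x \<otimes>\<^bsub>loc\<^esub> y \<otimes>\<^bsub>loc\<^esub> z = x \<otimes>\<^bsub>loc\<^esub> (y \<otimes>\<^bsub>loc\<^esub> z)"
    unfolding x y z using car by (simp add: mul m_assoc)
  have "(x \<oplus>\<^bsub>loc\<^esub> y) \<otimes>\<^bsub>loc\<^esub> z = frac ((a \<otimes> t \<oplus> b \<otimes> s) \<otimes> c) (s \<otimes> t \<otimes> r)"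
    unfolding x y z using car by (simp add: add mul)
  also have "\<dots> = frac (r \<otimes> ((a \<otimes> t \<oplus> b \<otimes> s) \<otimes> c)) (r \<otimes> (s \<otimes> t \<otimes> r))"
    by (rule frac_cancel[symmetric]) (use car Sm z S_mult[OF Sm(1) z(2)] in auto)
  also have "\<dots> = frac ((a \<otimes> c) \<otimes> (t \<otimes> r) \<oplus> (b \<otimes> c) \<otimes> (s \<otimes> r)) ((s \<otimes> r) \<otimes> (t \<otimes> r))"
    using car by (simp add: l_distr r_distr m_ac)
  also have "\<dots> = x \<otimes>\<^bsub>loc\<^esub> z \<oplus>\<^bsub>loc\<^esub> y \<otimes>\<^bsub>loc\<^esub> z"
    unfolding x y z using car by (simp add: add mul)
  finally show "(x \<oplus>\<^bsub>loc\<^esub> y) \<otimes>\<^bsub>loc\<^esub> z = x \<otimes>\<^bsub>loc\<^esub> z \<oplus>\<^bsub>loc\<^esub> y \<otimes>\<^bsub>loc\<^esub> z" .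
qed

lemma frac_hom: "ring_hom_ring R loc (\<lambda>a. frac a \<one>)"
proof (rule ring_hom_ringI2[OF ring_axioms cring.axioms(1)[OF cring_loc]])
  show "(\<lambda>a. frac a \<one>) \<in> ring_hom R loc"
    by (rule ring_hom_memI) (auto simp: loc_mult loc_add loc_one)
qed

lemma frac_in_ideal_iff:
  assumes J: "ideal J loc" and a: "a \<in> carrier R" "s \<in> S"
  shows "frac a s \<in> J \<longleftrightarrow> frac a \<one> \<in> J"
proof
  assume "frac a s \<in> J"
  then have "frac s \<one> \<otimes>\<^bsub>loc\<^esub> frac a s \<in> J" using ideal.I_l_closed[OF J] a by simp
  then show "frac a \<one> \<in> J" using a frac_cancel[of a \<one> s] by (simp add: loc_mult)
next
  assume "frac a \<one> \<in> J"
  then have "frac \<one> s \<otimes>\<^bsub>loc\<^esub> frac a \<one> \<in> J" using ideal.I_l_closed[OF J] a by simp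
  then show "frac a s \<in> J" using a by (simp add: loc_mult)
qed

lemma frac_notin_proper_ideal:
  assumes J: "ideal J loc" "J \<noteq> carrier loc" and a: "a \<in> S" "s \<in> S"
  shows "frac a s \<notin> J"
proof
  assume "frac a s \<in> J"
  then have "frac s a \<otimes>\<^bsub>loc\<^esub> frac a s \<in> J" using ideal.I_l_closed[OF J(1)] a by simp
  moreover have "frac s a \<otimes>\<^bsub>loc\<^esub> frac a s = \<one>\<^bsub>loc\<^esub>"
    using a frac_cancel[of \<one> \<one> "a \<otimes> s"] S_mult[OF a] by (simp add: loc_mult loc_one m_comm)
  ultimately show False using ideal.one_imp_carrier[OF J(1)] J(2) by simp
qed

definition loc_max where
  "loc_max = {frac a s |a s. a \<in> I \<and> s \<in> S}"

lemma frac_in_loc_max_iff: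
  assumes "a \<in> carrier R" "s \<in> S"
  shows "frac a s \<in> loc_max \<longleftrightarrow> a \<in> I"
proof
  assume "frac a s \<in> loc_max"
  then obtain b t where b: "b \<in> I" "t \<in> S" "frac a s = frac b t" by (auto simp: loc_max_def)
  then have "frac_rel a s b t" using frac_eq_iff assms Icarr by metis
  then obtain u where u: "u \<in> S" "u \<otimes> (t \<otimes> a) = u \<otimes> (s \<otimes> b)" by (auto simp: frac_rel_def)
  have "u \<otimes> (s \<otimes> b) \<in> I" using u assms b I_l_closed by simp
  then have "(u \<otimes> t) \<otimes> a \<in> I" using u assms b by (simp add: m_assoc)
  then show "a \<in> I" using I_prime[of "u \<otimes> t" a] S_mult[OF u(1) b(2)] assms by (auto simp: S_iff)
next
  assume "a \<in> I" then show "frac a s \<in> loc_max" using assms unfolding loc_max_def by blast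
qed

text \<open>This is the extension of \<open>A\<close> to the localization in closed form. For
  \<open>A = I\<close> it yields \<open>loc_max\<close>; for the ideal generated by some numerators
  it contains the ideal generated by their fractions.\<close>

lemma ideal_loc_saturation:
  assumes A: "ideal A R"
  shows "ideal {x \<in> carrier loc. \<exists>a s u. a \<in> carrier R \<and> s \<in> S \<and> x = frac a s \<and> u \<in> S \<and> u \<otimes> a \<in> A} loc"
    (is "ideal ?T loc")
proof (rule idealI)
  interpret L: cring loc by (rule cring_loc)
  interpret A: ideal A R by (rule A)
  show "ring loc" by (rule L.ring_axioms)
  have mul: "y \<otimes>\<^bsub>loc\<^esub> x \<in> ?T" if x: "x \<in> ?T" and y: "y \<in> carrier loc" for x y
  proof -
    obtain a s u where a: "a \<in> carrier R" "s \<in> S" "x = frac a s" "u \<in> S" "u \<otimes> a \<in> A" using x by blast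
    obtain b t where b: "b \<in> carrier R" "t \<in> S" "y = frac b t" using y by (rule loc_carrierE)
    have "y \<otimes>\<^bsub>loc\<^esub> x = frac (b \<otimes> a) (t \<otimes> s)" using a b by (simp add: loc_mult)
    moreover have "u \<otimes> (b \<otimes> a) = b \<otimes> (u \<otimes> a)" using a b by (simp add: m_ac)
    then have "u \<otimes> (b \<otimes> a) \<in> A" using A.I_l_closed[OF a(5) b(1)] by simp
    moreover have "y \<otimes>\<^bsub>loc\<^esub> x \<in> carrier loc" "b \<otimes> a \<in> carrier R" "t \<otimes> s \<in> S" using x y a b S_mult by auto
    ultimately show ?thesis using a(4) by blast
  qed
  show "y \<otimes>\<^bsub>loc\<^esub> x \<in> ?T" "x \<otimes>\<^bsub>loc\<^esub> y \<in> ?T" if "x \<in> ?T" "y \<in> carrier loc" for x y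
    using mul[OF that] that L.m_comm[of x y] by auto
  show "subgroup ?T (add_monoid loc)"
  proof (rule L.add.subgroupI)
    show "?T \<subseteq> carrier loc" by auto
    have "\<zero> \<in> carrier R" "\<one> \<in> S" "\<one> \<otimes> \<zero> \<in> A" using A.zero_closed by auto
    then have "\<zero>\<^bsub>loc\<^esub> \<in> ?T" using loc_zero L.zero_closed by blast
    then show "?T \<noteq> {}" by blast
    fix x y assume x: "x \<in> ?T"
    have "\<ominus>\<^bsub>loc\<^esub> x = \<ominus>\<^bsub>loc\<^esub> \<one>\<^bsub>loc\<^esub> \<otimes>\<^bsub>loc\<^esub> x"
      using x L.l_minus[of "\<one>\<^bsub>loc\<^esub>" x] by simp
    then show "\<ominus>\<^bsub>loc\<^esub> x \<in> ?T" using mul[OF x, of "\<ominus>\<^bsub>loc\<^esub> \<one>\<^bsub>loc\<^esub>"] by simp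
    assume y: "y \<in> ?T"
    obtain a s u where a: "a \<in> carrier R" "s \<in> S" "x = frac a s" "u \<in> S" "u \<otimes> a \<in> A" using x by blast
    obtain b t v where b: "b \<in> carrier R" "t \<in> S" "y = frac b t" "v \<in> S" "v \<otimes> b \<in> A" using y by blast
    have "x \<oplus>\<^bsub>loc\<^esub> y = frac ((a \<otimes> t) \<oplus> (b \<otimes> s)) (s \<otimes> t)" using a b by (simp add: loc_add)
    moreover have "(u \<otimes> v) \<otimes> ((a \<otimes> t) \<oplus> (b \<otimes> s)) = (v \<otimes> t) \<otimes> (u \<otimes> a) \<oplus> (u \<otimes> s) \<otimes> (v \<otimes> b)"
      using a b by (simp add: r_distr m_ac)
    then have "(u \<otimes> v) \<otimes> ((a \<otimes> t) \<oplus> (b \<otimes> s)) \<in> A"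
      using A.I_l_closed[OF a(5), of "v \<otimes> t"] A.I_l_closed[OF b(5), of "u \<otimes> s"] a b A.a_closed by simp
    moreover have "x \<oplus>\<^bsub>loc\<^esub> y \<in> carrier loc" using x y by auto
    moreover have "(a \<otimes> t) \<oplus> (b \<otimes> s) \<in> carrier R" "s \<otimes> t \<in> S" "u \<otimes> v \<in> S" using a b S_mult by auto
    ultimately show "x \<oplus>\<^bsub>loc\<^esub> y \<in> ?T" by blast
  qed
qed

lemma loc_max_eq: "loc_max = {x \<in> carrier loc. \<exists>a s u. a \<in> carrier R \<and> s \<in> S \<and> x = frac a s \<and> u \<in> S \<and> u \<otimes> a \<in> I}"
proof (intro equalityI subsetI)
  fix x assume "x \<in> loc_max"
  then obtain a s where a: "a \<in> I" "s \<in> S" "x = frac a s" by (auto simp: loc_max_def)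
  then have "\<one> \<otimes> a \<in> I" "\<one> \<in> S" "a \<in> carrier R" using Icarr by auto
  then show "x \<in> {x \<in> carrier loc. \<exists>a s u. a \<in> carrier R \<and> s \<in> S \<and> x = frac a s \<and> u \<in> S \<and> u \<otimes> a \<in> I}"
    using a frac_in_loc by blast
next
  fix x assume "x \<in> {x \<in> carrier loc. \<exists>a s u. a \<in> carrier R \<and> s \<in> S \<and> x = frac a s \<and> u \<in> S \<and> u \<otimes> a \<in> I}"
  then obtain a s u where a: "a \<in> carrier R" "s \<in> S" "x = frac a s" "u \<in> S" "u \<otimes> a \<in> I" by blast
  then show "x \<in> loc_max" using I_prime[of u a] by (auto simp: frac_in_loc_max_iff S_iff)
qed

lemma loc_max_maximal: "maximalideal loc_max loc"
proof (rule maximalidealI)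
  show "ideal loc_max loc" unfolding loc_max_eq by (rule ideal_loc_saturation[OF is_ideal])
  have "\<one>\<^bsub>loc\<^esub> \<notin> loc_max" unfolding loc_one using frac_in_loc_max_iff[of \<one> \<one>] S_one S_iff by simp
  then show "carrier loc \<noteq> loc_max" using frac_in_loc[OF one_closed S_one] loc_one by metis
  fix J assume J: "ideal J loc" "loc_max \<subseteq> J" "J \<subseteq> carrier loc"
  show "J = loc_max \<or> J = carrier loc"
  proof (rule disjCI)
    assume ne: "J \<noteq> carrier loc"
    have "x \<in> loc_max" if x: "x \<in> J" for x
    proof -
      obtain a s where a: "a \<in> carrier R" "s \<in> S" "x = frac a s" using x J(3) loc_carrierE by blast
      then show ?thesis using frac_notin_proper_ideal[OF J(1) ne, of a s] x by (auto simp: frac_in_loc_max_iff S_iff)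
    qed
    then show "J = loc_max" using J(2) by blast
  qed
qed

text \<open>Denominators are units, so the numerators of the generators suffice up to multipliers
  outside \<open>I\<close>, and a chain realizing the dimension contracts along the localization
  map. There is only \<open>card G \<le> n\<close> because numerators may coincide.\<close>

lemma regular_localizationD:
  assumes reg: "regular_local_ring loc"
  obtains G n Q where "finite G" "G \<subseteq> I" "card G \<le> n"
    "\<And>p. p \<in> I \<Longrightarrow> \<exists>u\<in>S. u \<otimes> p \<in> Idl G"
    "\<And>i. i \<le> n \<Longrightarrow> primeideal (Q i) R \<and> Q i \<subseteq> I" "\<And>i. i < n \<Longrightarrow> Q i \<subset> Q (Suc i)"
proof -
  interpret L: cring loc by (rule cring_loc)
  obtain m B where m: "{J. maximalideal J loc} = {m}" and B: "B \<subseteq> carrier loc" "finite B"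
    "m = Idl\<^bsub>loc\<^esub> B" "krull_dim loc = enat (card B)"
    using reg by (auto simp: regular_local_ring_def)
  have m_eq: "m = loc_max" using m loc_max_maximal by blast
  have BI: "\<exists>a s. a \<in> I \<and> s \<in> S \<and> x = frac a s" if "x \<in> B" for x
    using that B(3) m_eq L.genideal_self[OF B(1)] unfolding loc_max_def by blast
  then obtain num den where nd: "\<And>x. x \<in> B \<Longrightarrow> num x \<in> I \<and> den x \<in> S \<and> x = frac (num x) (den x)"
    by metis
  define G where "G = num ` B"
  have GI: "G \<subseteq> I" using nd by (auto simp: G_def)
  then have Gc: "G \<subseteq> carrier R" using Icarr by blast
  let ?T = "{x \<in> carrier loc. \<exists>a s u. a \<in> carrier R \<and> s \<in> S \<and> x = frac a s \<and> u \<in> S \<and> u \<otimes> a \<in> Idl G}"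
  have "ideal ?T loc" by (rule ideal_loc_saturation[OF genideal_ideal[OF Gc]])
  moreover have "B \<subseteq> ?T"
  proof
    fix x assume x: "x \<in> B"
    have "num x \<in> Idl G" using genideal_self[OF Gc] x by (auto simp: G_def)
    then have "\<one> \<otimes> num x \<in> Idl G" "num x \<in> carrier R" using nd[OF x] Icarr by auto
    then show "x \<in> ?T" using nd[OF x] S_one B(1) x by blast
  qed
  ultimately have "Idl\<^bsub>loc\<^esub> B \<subseteq> ?T" by (rule L.genideal_minimal)
  then have max_sub: "loc_max \<subseteq> ?T" unfolding m_eq[symmetric] B(3) .
  have gen: "\<exists>u\<in>S. u \<otimes> p \<in> Idl G" if p: "p \<in> I" for p
  proof -
    have pc: "p \<in> carrier R" using p Icarr by blast
    then have "frac p \<one> \<in> ?T" using p max_sub frac_in_loc_max_iff[of p \<one>] S_one by blast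
    then obtain a s u where a: "a \<in> carrier R" "s \<in> S" "frac p \<one> = frac a s" "u \<in> S" "u \<otimes> a \<in> Idl G" by blast
    then have "frac_rel p \<one> a s" using frac_eq_iff[of p a \<one> s] pc S_one by blast
    then obtain v where v: "v \<in> S" "v \<otimes> (s \<otimes> p) = v \<otimes> (\<one> \<otimes> a)" by (auto simp: frac_rel_def)
    have "(u \<otimes> (v \<otimes> s)) \<otimes> p = u \<otimes> (v \<otimes> (s \<otimes> p))" using a(2,4) v(1) pc by (simp add: m_assoc)
    also have "\<dots> = v \<otimes> (u \<otimes> a)" unfolding v(2) using a(1,4) v(1) by (simp add: m_ac)
    finally have "(u \<otimes> (v \<otimes> s)) \<otimes> p \<in> Idl G"
      using ideal.I_l_closed[OF genideal_ideal[OF Gc] a(5), of v] v by simp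
    then show ?thesis using a v S_mult by blast
  qed
  \<comment> \<open>The family of primes is therefore nonempty, and the finite dimension is attained
    by a chain.\<close>
  have "primeideal loc_max loc" by (rule L.maximalideal_prime[OF loc_max_maximal])
  then have "{P. primeideal P loc} \<noteq> {}" by blast
  then obtain C where C: "\<And>i. i \<le> card B \<Longrightarrow> primeideal (C i) loc" "\<And>i. i < card B \<Longrightarrow> C i \<subset> C (Suc i)"
    using chain_length_attained[OF B(4)[unfolded krull_dim_def]] by (metis mem_Collect_eq)
  define Q where "Q i = {r \<in> carrier R. frac r \<one> \<in> C i}" for i
  have idl: "ideal (C i) loc" if "i \<le> card B" for i
    using primeideal.axioms(1)[OF C(1)[OF that]] .
  have "primeideal (Q i) R \<and> Q i \<subseteq> I" if i: "i \<le> card B" for i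
  proof
    show "primeideal (Q i) R" unfolding Q_def
      by (rule ring_hom_ring.primeideal_vimage[OF frac_hom is_cring C(1)[OF i]])
    show "Q i \<subseteq> I"
    proof
      fix r assume r: "r \<in> Q i"
      have "C i \<noteq> carrier loc" using primeideal.I_notcarr[OF C(1)[OF i]] by blast
      then show "r \<in> I" using frac_notin_proper_ideal[OF idl[OF i], of r \<one>] r S_one by (auto simp: Q_def S_iff)
    qed
  qed
  moreover have "Q i \<subset> Q (Suc i)" if i: "i < card B" for i
  proof -
    obtain x where x: "x \<in> C (Suc i)" "x \<notin> C i" using C(2)[OF i] by blast
    then have "x \<in> carrier loc" using ideal.Icarr[OF idl[of "Suc i"]] i by simp
    then obtain a s where a: "a \<in> carrier R" "s \<in> S" "x = frac a s" by (rule loc_carrierE)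
    then have "a \<in> Q (Suc i)" "a \<notin> Q i"
      using x i frac_in_ideal_iff[OF idl[of "Suc i"] a(1,2)] frac_in_ideal_iff[OF idl[of i] a(1,2)]
      by (auto simp: Q_def)
    moreover have "Q i \<subseteq> Q (Suc i)" using C(2)[OF i] by (auto simp: Q_def)
    ultimately show ?thesis by blast
  qed
  moreover have "card G \<le> card B" "finite G" using B(2) card_image_le by (auto simp: G_def)
  ultimately show ?thesis using that[of G "card B" Q] GI gen by blast
qed

text \<open>The maximal ideal of the localization is then zero, so the localization is a field:
  regular of dimension \<open>0\<close> with the empty generating set.\<close>

lemma regular_localizationI:
  assumes gen: "\<And>p. p \<in> I \<Longrightarrow> \<exists>u\<in>S. u \<otimes> p = \<zero>"
  shows "regular_local_ring loc"
proof -
  interpret L: cring loc by (rule cring_loc)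
  have "loc_max = {\<zero>\<^bsub>loc\<^esub>}"
  proof -
    have "frac p s = \<zero>\<^bsub>loc\<^esub>" if p: "p \<in> I" "s \<in> S" for p s
    proof -
      obtain u where u: "u \<in> S" "u \<otimes> p = \<zero>" using gen[OF p(1)] by blast
      have "u \<otimes> (\<one> \<otimes> p) = u \<otimes> (s \<otimes> \<zero>)" using u p Icarr by simp
      then have "frac_rel p s \<zero> \<one>" using u unfolding frac_rel_def by blast
      then show ?thesis using p Icarr S_one unfolding loc_zero by (subst frac_eq_iff) auto
    qed
    moreover have "\<zero>\<^bsub>loc\<^esub> \<in> loc_max"
      using additive_subgroup.zero_closed[OF ideal.axioms(1)[OF maximalideal.axioms(1)[OF loc_max_maximal]]] .
    ultimately show ?thesis unfolding loc_max_def by blast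
  qed
  then have "maximalideal {\<zero>\<^bsub>loc\<^esub>} loc" using loc_max_maximal by simp
  then interpret F: field loc by (rule L.zeromaximalideal_fieldI)
  have ideals: "J = {\<zero>\<^bsub>loc\<^esub>} \<or> J = carrier loc" if "ideal J loc" for J using F.all_ideals that by blast
  have "noetherian_ring loc"
  proof (rule L.noetherian_ringI)
    fix J assume "ideal J loc"
    then show "\<exists>A\<subseteq>carrier loc. finite A \<and> J = Idl\<^bsub>loc\<^esub> A"
      using ideals[of J] L.genideal_zero L.genideal_one
      by (metis L.one_closed L.zero_closed empty_subsetI finite.emptyI finite.insertI insert_subset)
  qed
  moreover have "{J. maximalideal J loc} = {{\<zero>\<^bsub>loc\<^esub>}}"
    using F.zeromaximalideal ideals maximalideal.I_notcarr maximalideal.axioms(1) by fastforce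
  moreover have "Idl\<^bsub>loc\<^esub> {} = {\<zero>\<^bsub>loc\<^esub>}"
    using L.genideal_minimal[OF L.zeroideal, of "{}"] L.genideal_ideal[of "{}"]
      additive_subgroup.zero_closed[OF ideal.axioms(1)] by fastforce
  moreover have "krull_dim loc = enat 0"
  proof (rule antisym)
    have "P = {\<zero>\<^bsub>loc\<^esub>}" if "primeideal P loc" for P
      using ideals[OF primeideal.axioms(1)[OF that]] primeideal.I_notcarr[OF that] by blast
    then show "krull_dim loc \<le> enat 0"
      unfolding krull_dim_def by (intro chain_length_le) (metis le0 mem_Collect_eq not_gr_zero order.irrefl Suc_leI le_refl)
  qed (simp add: enat_0)
  ultimately show ?thesis
    unfolding regular_local_ring_def using cring_loc by (metis card.empty empty_subsetI finite.emptyI)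
qed

end

section \<open>Quotients of polynomial rings\<close>

text \<open>An ideal containing \<open>N\<close> is a union of cosets of \<open>N\<close>.\<close>

lemma (in ring) rcos_mem_image_iff:
  assumes N: "ideal N R" and K: "ideal K R" "N \<subseteq> K" and a: "a \<in> carrier R"
  shows "N +> a \<in> (+>) N ` K \<longleftrightarrow> a \<in> K"
proof
  assume "N +> a \<in> (+>) N ` K"
  then obtain b where b: "b \<in> K" "N +> a = N +> b" by blast
  then have bc: "b \<in> carrier R" using ideal.Icarr[OF K(1)] by blast
  have "a \<ominus> b \<in> K" using quotient_eq_iff_same_a_r_cos[OF N a bc] b(2) K(2) by blast
  then have "(a \<ominus> b) \<oplus> b \<in> K" using additive_subgroup.a_closed[OF ideal.axioms(1)[OF K(1)]] b(1) by blast
  moreover have "(a \<ominus> b) \<oplus> b = a" using a bc by (simp add: minus_eq a_assoc l_neg)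
  ultimately show "a \<in> K" by simp
qed auto

abbreviation cls :: "'x set \<Rightarrow> ('x, 'k::comm_ring_1) mpoly set \<Rightarrow> ('x, 'k) mpoly \<Rightarrow> ('x, 'k) mpoly set" where
  "cls X J f \<equiv> J +>\<^bsub>mpoly_ring X\<^esub> f"

lemma cls_hom: "ideal J (mpoly_ring X) \<Longrightarrow> ring_hom_ring (mpoly_ring X) (mpoly_ring X Quot J) (cls X J)"
  by (rule ideal.rcos_ring_hom_ring)

lemma cring_Quot: "ideal J (mpoly_ring X) \<Longrightarrow> cring (mpoly_ring X Quot J)"
  by (rule ideal.quotient_is_cring[OF _ cring_mpoly_ring])

lemma carrier_Quot: "carrier (mpoly_ring X Quot J) = cls X J ` polys X"
  by (auto simp: FactRing_def A_RCOSETS_def')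

lemma cls_eq_iff:
  fixes J :: "('x, 'k::comm_ring_1) mpoly set"
  assumes J: "ideal J (mpoly_ring X)" and f: "f \<in> polys X" and g: "g \<in> polys X"
  shows "cls X J f = cls X J g \<longleftrightarrow> f - g \<in> J"
proof -
  have "f \<ominus>\<^bsub>mpoly_ring X\<^esub> g = f - g" using g by (simp add: a_minus_def a_inv_mpoly_ring)
  then show ?thesis
    using ring.quotient_eq_iff_same_a_r_cos[OF ring_mpoly_ring J, of f g] f g by simp
qed

lemma
  fixes J :: "('x, 'k::comm_ring_1) mpoly set"
  assumes J: "ideal J (mpoly_ring X)"
  shows cls_closed: "f \<in> polys X \<Longrightarrow> cls X J f \<in> carrier (mpoly_ring X Quot J)"
    and cls_mult: "f \<in> polys X \<Longrightarrow> g \<in> polys X \<Longrightarrow> cls X J (f * g) = cls X J f \<otimes>\<^bsub>mpoly_ring X Quot J\<^esub> cls X J g"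
    and cls_zero: "cls X J 0 = \<zero>\<^bsub>mpoly_ring X Quot J\<^esub>"
  using ring_hom_closed[OF ring_hom_ring.homh[OF cls_hom[OF J]]]
    ring_hom_mult[OF ring_hom_ring.homh[OF cls_hom[OF J]]]
    ring_hom_zero[OF ring_hom_ring.homh[OF cls_hom[OF J]] ring_mpoly_ring cring.axioms(1)[OF cring_Quot[OF J]]]
  by simp_all

definition pull :: "'x set \<Rightarrow> ('x, 'k::comm_ring_1) mpoly set \<Rightarrow> ('x, 'k) mpoly set set \<Rightarrow> ('x, 'k) mpoly set" where
  "pull X J K = {f \<in> polys X. cls X J f \<in> K}"

lemma ideal_pull:
  assumes "ideal J (mpoly_ring X)" "ideal K (mpoly_ring X Quot J)"
  shows "ideal (pull X J K) (mpoly_ring X)"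
  using ring_hom_ring.ideal_vimage[OF cls_hom[OF assms(1)] assms(2)] by (simp add: pull_def)

lemma primeideal_pull:
  assumes "ideal J (mpoly_ring X)" "primeideal K (mpoly_ring X Quot J)"
  shows "primeideal (pull X J K) (mpoly_ring X)"
  using ring_hom_ring.primeideal_vimage[OF cls_hom[OF assms(1)] cring_mpoly_ring assms(2)] by (simp add: pull_def)

lemma pull_superset:
  assumes J: "ideal J (mpoly_ring X)" and K: "ideal K (mpoly_ring X Quot J)"
  shows "J \<subseteq> pull X J K"
proof
  fix f assume f: "f \<in> J"
  then have fX: "f \<in> polys X" using ideal_mpoly_subset[OF J] by blast
  have "cls X J f = \<zero>\<^bsub>mpoly_ring X Quot J\<^esub>" using cls_eq_iff[OF J fX, of 0] f cls_zero[OF J] by simp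
  then show "f \<in> pull X J K" using additive_subgroup.zero_closed[OF ideal.axioms(1)[OF K]] fX by (simp add: pull_def)
qed

lemma pull_strict:
  assumes J: "ideal J (mpoly_ring X)" and K: "ideal K' (mpoly_ring X Quot J)" and "K \<subset> K'"
  shows "pull X J K \<subset> pull X J K'"
proof -
  obtain x where x: "x \<in> K'" "x \<notin> K" using assms(3) by blast
  then obtain f where "f \<in> polys X" "x = cls X J f" using ideal.Icarr[OF K x(1)] carrier_Quot by blast
  then show ?thesis using x assms(3) by (auto simp: pull_def)
qed

lemma cls_mem_image_iff:
  "ideal J (mpoly_ring X) \<Longrightarrow> ideal L (mpoly_ring X) \<Longrightarrow> J \<subseteq> L \<Longrightarrow> f \<in> polys X
    \<Longrightarrow> cls X J f \<in> cls X J ` L \<longleftrightarrow> f \<in> L"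
  using ring.rcos_mem_image_iff[OF ring_mpoly_ring, of J X L f] by simp

lemma ideal_image_cls:
  "ideal J (mpoly_ring X) \<Longrightarrow> ideal L (mpoly_ring X) \<Longrightarrow> ideal (cls X J ` L) (mpoly_ring X Quot J)"
  by (rule ring.ring_ideal_imp_quot_ideal[OF ring_mpoly_ring])

lemma primeideal_image_cls:
  assumes J: "ideal J (mpoly_ring X)" and L: "primeideal L (mpoly_ring X)" "J \<subseteq> L"
  shows "primeideal (cls X J ` L) (mpoly_ring X Quot J)"
proof (rule primeidealI[OF ideal_image_cls[OF J primeideal_mpoly_ideal[OF L(1)]] cring_Quot[OF J]])
  note mem = cls_mem_image_iff[OF J primeideal_mpoly_ideal[OF L(1)] L(2)]
  have "cls X J 1 \<notin> cls X J ` L" using mem[of 1] primeideal_mpoly_1[OF L(1)] by simp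
  then show "carrier (mpoly_ring X Quot J) \<noteq> cls X J ` L" using cls_closed[OF J, of 1] by auto
  fix a b assume "a \<in> carrier (mpoly_ring X Quot J)" "b \<in> carrier (mpoly_ring X Quot J)"
    and ab: "a \<otimes>\<^bsub>mpoly_ring X Quot J\<^esub> b \<in> cls X J ` L"
  then have "a \<in> cls X J ` polys X" "b \<in> cls X J ` polys X" by (simp_all only: carrier_Quot)
  then obtain f g where fg: "f \<in> polys X" "g \<in> polys X" "a = cls X J f" "b = cls X J g"
    by (elim imageE)
  then have "cls X J (f * g) \<in> cls X J ` L" using ab by (simp add: cls_mult[OF J])
  then have "f * g \<in> L" using mem[OF polys_mult[OF fg(1,2)]] by blast
  then show "a \<in> cls X J ` L \<or> b \<in> cls X J ` L"
    using primeideal_mpoly_mult[OF L(1) fg(1,2)] fg(3,4) by blast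
qed

text \<open>Primes of the quotient and primes above \<open>J\<close> correspond by
  \<open>pull\<close> and image, both of which keep chains strict.\<close>

lemma krull_dim_Quot:
  assumes J: "ideal J (mpoly_ring X)"
  shows "krull_dim (mpoly_ring X Quot J) = chain_length {P. primeideal P (mpoly_ring X) \<and> J \<subseteq> P}"
proof (rule antisym)
  let ?A = "mpoly_ring X Quot J"
  show "krull_dim ?A \<le> chain_length {P. primeideal P (mpoly_ring X) \<and> J \<subseteq> P}"
    unfolding krull_dim_def chain_length_def[of "{P. primeideal P ?A}"]
  proof (rule SUP_least)
    fix n assume "n \<in> {n. \<exists>C. (\<forall>i\<le>n. C i \<in> {P. primeideal P ?A}) \<and> (\<forall>i<n. C i \<subset> C (Suc i))}"
    then obtain C where C: "\<And>i. i \<le> n \<Longrightarrow> primeideal (C i) ?A" "\<And>i. i < n \<Longrightarrow> C i \<subset> C (Suc i)" by auto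
    show "enat n \<le> chain_length {P. primeideal P (mpoly_ring X) \<and> J \<subseteq> P}"
    proof (rule chain_length_ge[where C = "\<lambda>i. pull X J (C i)"])
      show "pull X J (C i) \<in> {P. primeideal P (mpoly_ring X) \<and> J \<subseteq> P}" if "i \<le> n" for i
        using primeideal_pull[OF J C(1)[OF that]] pull_superset[OF J primeideal.axioms(1)[OF C(1)[OF that]]] by simp
      show "pull X J (C i) \<subset> pull X J (C (Suc i))" if "i < n" for i
        using pull_strict[OF J primeideal.axioms(1)[OF C(1)] C(2)[OF that]] that by simp
    qed
  qed
  show "chain_length {P. primeideal P (mpoly_ring X) \<and> J \<subseteq> P} \<le> krull_dim ?A"
    unfolding krull_dim_def chain_length_def[of "{P. primeideal P (mpoly_ring X) \<and> J \<subseteq> P}"]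
  proof (rule SUP_least)
    fix n assume "n \<in> {n. \<exists>C. (\<forall>i\<le>n. C i \<in> {P. primeideal P (mpoly_ring X) \<and> J \<subseteq> P}) \<and> (\<forall>i<n. C i \<subset> C (Suc i))}"
    then obtain C where C: "\<And>i. i \<le> n \<Longrightarrow> primeideal (C i) (mpoly_ring X) \<and> J \<subseteq> C i" "\<And>i. i < n \<Longrightarrow> C i \<subset> C (Suc i)" by auto
    show "enat n \<le> chain_length {P. primeideal P ?A}"
    proof (rule chain_length_ge[where C = "\<lambda>i. cls X J ` C i"])
      show "cls X J ` C i \<in> {P. primeideal P ?A}" if "i \<le> n" for i
        using primeideal_image_cls[OF J] C(1)[OF that] by simp
      show "cls X J ` C i \<subset> cls X J ` C (Suc i)" if i: "i < n" for i
      proof -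
        obtain f where f: "f \<in> C (Suc i)" "f \<notin> C i" using C(2)[OF i] by blast
        have "f \<in> polys X" using f(1) C(1)[of "Suc i"] i ideal_mpoly_subset primeideal_mpoly_ideal by (metis Suc_leI subsetD)
        then have "cls X J f \<notin> cls X J ` C i"
          using f(2) C(1)[of i] i cls_mem_image_iff[OF J primeideal_mpoly_ideal] by simp
        then show ?thesis using f(1) C(2)[OF i] by blast
      qed
    qed
  qed
qed

text \<open>The consequences of regularity moved to the polynomial ring: generators are lifted, and
  the relations of the quotient reappear as \<open>J\<close> in \<open>E \<union> J\<close>.\<close>

lemma regular_point_data:
  fixes J :: "('x, 'k::comm_ring_1) mpoly set"
  assumes J: "ideal J (mpoly_ring X)" and P: "primeideal P (mpoly_ring X)" "J \<subseteq> P"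
    and reg: "regular_local_ring (localization (mpoly_ring X Quot J) (cls X J ` P))"
  obtains E n Q where "finite E" "E \<subseteq> P" "card E \<le> n"
    "\<And>p. p \<in> P \<Longrightarrow> \<exists>u\<in>polys X - P. u * p \<in> genideal (mpoly_ring X) (E \<union> J)"
    "\<And>i. i \<le> n \<Longrightarrow> primeideal (Q i) (mpoly_ring X) \<and> J \<subseteq> Q i \<and> Q i \<subseteq> P"
    "\<And>i. i < n \<Longrightarrow> Q i \<subset> Q (Suc i)"
proof -
  let ?A = "mpoly_ring X Quot J"
  interpret A: cring ?A by (rule cring_Quot[OF J])
  note PA = primeideal_image_cls[OF J P]
  note mem = cls_mem_image_iff[OF J primeideal_mpoly_ideal[OF P(1)] P(2)]
  note PX = ideal_mpoly_subset[OF primeideal_mpoly_ideal[OF P(1)]]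
  obtain G n C where G: "finite G" "G \<subseteq> cls X J ` P" "card G \<le> n"
    and gen: "\<And>p. p \<in> cls X J ` P \<Longrightarrow> \<exists>u\<in>primeideal.S (cls X J ` P) ?A. u \<otimes>\<^bsub>?A\<^esub> p \<in> genideal ?A G"
    and C: "\<And>i. i \<le> n \<Longrightarrow> primeideal (C i) ?A \<and> C i \<subseteq> cls X J ` P" "\<And>i. i < n \<Longrightarrow> C i \<subset> C (Suc i)"
    by (rule primeideal.regular_localizationD[OF PA reg]) blast
  have "\<exists>g. g \<in> P \<and> x = cls X J g" if "x \<in> G" for x using G(2) that by blast
  then obtain r where r: "\<And>x. x \<in> G \<Longrightarrow> r x \<in> P \<and> x = cls X J (r x)" by metis
  define E where "E = r ` G"
  have E: "finite E" "E \<subseteq> P" "card E \<le> n"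
    using G r card_image_le[OF G(1), of r] by (auto simp: E_def)
  then have EJX: "E \<union> J \<subseteq> polys X" using PX ideal_mpoly_subset[OF J] by blast
  let ?K = "genideal (mpoly_ring X) (E \<union> J)"
  note K = genideal_mpoly_ideal[OF EJX]
  have JK: "J \<subseteq> ?K" using genideal_mpoly_self[OF EJX] by blast
  have "genideal ?A G \<subseteq> cls X J ` ?K"
  proof (rule A.genideal_minimal[OF ideal_image_cls[OF J K]])
    show "G \<subseteq> cls X J ` ?K" using r genideal_mpoly_self[OF EJX] unfolding E_def by fast
  qed
  note sub = this
  have gen': "\<exists>u\<in>polys X - P. u * p \<in> ?K" if p: "p \<in> P" for p
  proof -
    have pX: "p \<in> polys X" using p PX by blast
    obtain v where v: "v \<in> primeideal.S (cls X J ` P) ?A" "v \<otimes>\<^bsub>?A\<^esub> cls X J p \<in> genideal ?A G"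
      using gen[of "cls X J p"] p by blast
    then have "v \<in> carrier ?A" "v \<notin> cls X J ` P" by (simp_all add: primeideal.S_iff[OF PA])
    then obtain u where u: "u \<in> polys X" "v = cls X J u" using carrier_Quot by blast
    then have "u \<in> polys X - P" using \<open>v \<notin> cls X J ` P\<close> mem by blast
    moreover have "cls X J (u * p) \<in> cls X J ` ?K" using v u pX sub by (auto simp: cls_mult[OF J])
    then have "u * p \<in> ?K" using cls_mem_image_iff[OF J K JK polys_mult[OF u(1) pX]] by blast
    ultimately show ?thesis by blast
  qed
  have Ci: "ideal (C i) ?A" if "i \<le> n" for i using C(1)[OF that] primeideal.axioms(1) by blast
  have "primeideal (pull X J (C i)) (mpoly_ring X) \<and> J \<subseteq> pull X J (C i) \<and> pull X J (C i) \<subseteq> P" if i: "i \<le> n" for i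
  proof (intro conjI)
    show "primeideal (pull X J (C i)) (mpoly_ring X)" using primeideal_pull[OF J] C(1)[OF i] by blast
    show "J \<subseteq> pull X J (C i)" by (rule pull_superset[OF J Ci[OF i]])
    show "pull X J (C i) \<subseteq> P"
    proof
      fix f assume "f \<in> pull X J (C i)"
      then have "f \<in> polys X" "cls X J f \<in> cls X J ` P" using C(1)[OF i] unfolding pull_def by blast+
      then show "f \<in> P" using mem by blast
    qed
  qed
  moreover have "pull X J (C i) \<subset> pull X J (C (Suc i))" if "i < n" for i
    using pull_strict[OF J Ci C(2)[OF that]] that by simp
  ultimately show ?thesis using that[of E n "\<lambda>i. pull X J (C i)"] E gen' by blast
qed

lemma regular_point_generic:
  assumes J: "ideal J (mpoly_ring X)" and P: "primeideal P (mpoly_ring X)" "J \<subseteq> P"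
    and gen: "\<And>p. p \<in> P \<Longrightarrow> \<exists>u\<in>polys X - P. u * p \<in> J"
  shows "regular_local_ring (localization (mpoly_ring X Quot J) (cls X J ` P))"
proof (rule primeideal.regular_localizationI[OF primeideal_image_cls[OF J P]])
  let ?A = "mpoly_ring X Quot J"
  fix x assume "x \<in> cls X J ` P"
  then obtain p where p: "p \<in> P" "x = cls X J p" by blast
  then have pX: "p \<in> polys X" using ideal_mpoly_subset[OF primeideal_mpoly_ideal[OF P(1)]] by blast
  obtain u where u: "u \<in> polys X" "u \<notin> P" "u * p \<in> J" using gen[OF p(1)] by blast
  have "cls X J u \<otimes>\<^bsub>?A\<^esub> x = \<zero>\<^bsub>?A\<^esub>"
    using cls_eq_iff[OF J polys_mult[OF u(1) pX], of 0] u(3) by (simp add: p cls_mult[OF J u(1) pX] cls_zero[OF J])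
  moreover have "cls X J u \<in> primeideal.S (cls X J ` P) ?A"
    using u cls_mem_image_iff[OF J primeideal_mpoly_ideal[OF P(1)] P(2)] cls_closed[OF J]
    by (simp add: primeideal.S_iff[OF primeideal_image_cls[OF J P]])
  ultimately show "\<exists>u\<in>primeideal.S (cls X J ` P) ?A. u \<otimes>\<^bsub>?A\<^esub> x = \<zero>\<^bsub>?A\<^esub>" by blast
qed

section \<open>Stanley--Reisner ideals\<close>

definition face_monomial :: "'x set \<Rightarrow> 'x \<Rightarrow>\<^sub>0 nat" where
  "face_monomial G = (\<Sum>x\<in>G. Poly_Mapping.single x 1)"

lemma lookup_face_monomial: "finite G \<Longrightarrow> lookup (face_monomial G) x = (if x \<in> G then 1 else 0)"
  by (simp add: face_monomial_def lookup_sum lookup_single when_def)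

lemma keys_face_monomial: "finite G \<Longrightarrow> keys (face_monomial G) = G"
  by (auto simp: in_keys_iff lookup_face_monomial split: if_splits)

lemma squarefree_face_monomial: "finite G \<Longrightarrow> G \<subseteq> X \<Longrightarrow> squarefree_on X (face_monomial G)"
  by (simp add: squarefree_on_def keys_face_monomial lookup_face_monomial)

lemma in_ideal_if_monomials:
  fixes p :: "('x, 'k::comm_ring_1) mpoly"
  assumes "ideal J (mpoly_ring X)" "\<And>m. m \<in> keys p \<Longrightarrow> power_product m \<in> J"
  shows "p \<in> J"
proof -
  have "(\<Sum>m\<in>keys p. mconst (lookup p m) * power_product m) \<in> J"
    by (rule ideal_mpoly_sum[OF assms(1)]) (rule ideal_mpoly_mult[OF assms(1) polys_mconst assms(2)])
  then show ?thesis by (rule ssubst[OF mpoly_eq_sum])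
qed

text \<open>The generators have exponents at most \<open>1\<close>, so divisibility by them is
  containment of supports.\<close>

lemma genideal_squarefree:
  fixes X :: "'x set"
  assumes M: "\<And>m. m \<in> M \<Longrightarrow> squarefree_on X m"
  shows "genideal (mpoly_ring X) (power_product ` M :: ('x, 'k::comm_ring_1) mpoly set)
    = {p \<in> polys X. \<forall>m\<in>keys p. \<exists>m0\<in>M. keys m0 \<subseteq> keys m}" (is "?I = ?J")
proof
  have sub: "power_product ` M \<subseteq> (polys X :: ('x, 'k) mpoly set)"
    using M by (auto simp: squarefree_on_def polys_power_product)
  have "ideal {p :: ('x, 'k) mpoly. p \<in> polys X \<and> keys p \<subseteq> {m. \<exists>m0\<in>M. keys m0 \<subseteq> keys m}} (mpoly_ring X)"
    by (rule ideal_monomials) (auto simp: keys_add_nat)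
  moreover have "{p :: ('x, 'k) mpoly. p \<in> polys X \<and> keys p \<subseteq> {m. \<exists>m0\<in>M. keys m0 \<subseteq> keys m}} = ?J" by auto
  ultimately have "ideal ?J (mpoly_ring X)" by simp
  then show "?I \<subseteq> ?J" by (rule genideal_mpoly_minimal) (use sub in auto)
  show "?J \<subseteq> ?I"
  proof
    fix p assume p: "p \<in> ?J"
    show "p \<in> ?I"
    proof (rule in_ideal_if_monomials[OF genideal_mpoly_ideal[OF sub]])
      fix m assume m: "m \<in> keys p"
      then obtain m0 where m0: "m0 \<in> M" "keys m0 \<subseteq> keys m" using p by blast
      have "lookup m0 x \<le> lookup m x" for x
      proof (cases "x \<in> keys m0")
        case True
        then have "x \<in> keys m" using m0(2) by blast
        then have "1 \<le> lookup m x" by (simp add: in_keys_iff)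
        moreover have "lookup m0 x \<le> 1" using M[OF m0(1)] by (simp add: squarefree_on_def)
        ultimately show ?thesis by simp
      qed (simp add: in_keys_iff)
      then have eq: "m = (m - m0) + m0" by (intro poly_mapping_eqI) (simp add: lookup_add lookup_minus)
      have "power_product m0 \<in> ?I" using genideal_mpoly_self[OF sub] m0(1) by blast
      moreover have "keys (m - m0) \<subseteq> X"
        using p m keys_add_nat[of "m - m0" m0] eq by (auto simp: polys_def)
      ultimately have "power_product (m - m0) * power_product m0 \<in> ?I"
        by (intro ideal_mpoly_mult[OF genideal_mpoly_ideal[OF sub]] polys_power_product)
      then show "power_product m \<in> ?I" by (subst eq) (simp only: power_product_add)
    qed
  qed
qed

text \<open>Membership of a monomial in \<open>I\<close> depends on its support alone, so the
  squarefree monomials decide it. Finite generation is recorded because \<open>jet_ideal\<close>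
  chooses a finite generating set.\<close>

lemma stanley_reisner_eq:
  fixes I :: "('x, 'k::comm_ring_1) mpoly set"
  assumes "stanley_reisner_ideal X \<Delta> I"
  shows "I = nonface_ideal X \<Delta>"
    and "finite X \<Longrightarrow> \<exists>G. finite G \<and> G \<subseteq> polys X \<and> I = genideal (mpoly_ring X) G"
proof -
  obtain M where M: "\<And>m. m \<in> M \<Longrightarrow> squarefree_on X m" "I = genideal (mpoly_ring X) (power_product ` M)"
    and \<Delta>: "\<Delta> = {keys m | m. squarefree_on X m \<and> power_product m \<notin> I}"
    using assms by (auto simp: stanley_reisner_ideal_def squarefree_monomial_ideal_def)
  have I: "I = {p \<in> polys X. \<forall>m\<in>keys p. \<exists>m0\<in>M. keys m0 \<subseteq> keys m}"
    unfolding M(2) by (rule genideal_squarefree[OF M(1)])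
  have mem: "power_product m \<in> I \<longleftrightarrow> (\<exists>m0\<in>M. keys m0 \<subseteq> keys m)" if "keys m \<subseteq> X" for m
    using that by (simp add: I polys_power_product)
  have face_iff: "keys m \<in> \<Delta> \<longleftrightarrow> \<not> (\<exists>m0\<in>M. keys m0 \<subseteq> keys m)" if m: "keys m \<subseteq> X" for m
  proof
    assume "keys m \<in> \<Delta>"
    then obtain m' where "keys m = keys m'" "squarefree_on X m'" "power_product m' \<notin> I" using \<Delta> by auto
    then show "\<not> (\<exists>m0\<in>M. keys m0 \<subseteq> keys m)" using mem[of m'] m by simp
  next
    assume neg: "\<not> (\<exists>m0\<in>M. keys m0 \<subseteq> keys m)"
    \<comment> \<open>The exponents of \<open>m\<close> may exceed \<open>1\<close>; its squarefree
      part has the same support and is what the definition of \<open>\<Delta>\<close> tests.\<close>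
    let ?m = "face_monomial (keys m)"
    have "keys m = keys ?m" "squarefree_on X ?m" "power_product ?m \<notin> I"
      using m neg mem[of ?m] by (simp_all add: keys_face_monomial squarefree_face_monomial)
    then show "keys m \<in> \<Delta>" unfolding \<Delta> by blast
  qed
  show "I = nonface_ideal X \<Delta>" unfolding I nonface_ideal_def polys_def using face_iff by blast
  assume X: "finite X"
  have "M \<subseteq> box X 1" using M(1) by (auto simp: box_def squarefree_on_def)
  then have "finite M" using finite_box[OF X] finite_subset by blast
  then show "\<exists>G. finite G \<and> G \<subseteq> polys X \<and> I = genideal (mpoly_ring X) G"
    using M by (intro exI[of _ "power_product ` M"]) (auto simp: squarefree_on_def polys_power_product)
qed

lemma stanley_reisner_nonface_ideal:
  fixes X :: "'x set"
  assumes X: "finite X" and \<Delta>: "simplicial_complex X \<Delta>"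
  shows "stanley_reisner_ideal X \<Delta> (nonface_ideal X \<Delta> :: ('x, 'k::comm_ring_1) mpoly set)"
  unfolding stanley_reisner_ideal_def squarefree_monomial_ideal_def
proof (intro conjI exI[of _ "face_monomial ` {G. G \<subseteq> X \<and> G \<notin> \<Delta>}"])
  let ?M = "face_monomial ` {G. G \<subseteq> X \<and> G \<notin> \<Delta>}"
  have fin: "finite G" if "G \<subseteq> X" for G using that X finite_subset by blast
  show sq: "\<forall>m\<in>?M. squarefree_on X m" using fin squarefree_face_monomial by auto
  have "(\<exists>m0\<in>?M. keys m0 \<subseteq> keys m) \<longleftrightarrow> keys m \<notin> \<Delta>" if m: "keys m \<subseteq> X" for m
  proof
    assume "\<exists>m0\<in>?M. keys m0 \<subseteq> keys m"
    then obtain G where G: "G \<subseteq> X" "G \<notin> \<Delta>" "keys (face_monomial G) \<subseteq> keys m" by blast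
    then have "G \<subseteq> keys m" using keys_face_monomial[OF fin[OF G(1)]] by simp
    with G(2) show "keys m \<notin> \<Delta>" using \<Delta> unfolding simplicial_complex_def by blast
  next
    assume "keys m \<notin> \<Delta>"
    then show "\<exists>m0\<in>?M. keys m0 \<subseteq> keys m" using m by (intro bexI[of _ "face_monomial (keys m)"]) (auto simp: keys_face_monomial)
  qed
  then have "nonface_ideal X \<Delta> = {p :: ('x, 'k) mpoly. p \<in> polys X \<and> (\<forall>m\<in>keys p. \<exists>m0\<in>?M. keys m0 \<subseteq> keys m)}"
    unfolding nonface_ideal_def polys_def by blast
  then show "nonface_ideal X \<Delta> = genideal (mpoly_ring X) (power_product ` ?M :: ('x, 'k) mpoly set)"
    using genideal_squarefree[of ?M X, where 'k = 'k] sq by simp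
  show "\<Delta> = {keys m | m. squarefree_on X m \<and> power_product m \<notin> (nonface_ideal X \<Delta> :: ('x, 'k) mpoly set)}"
  proof (intro equalityI subsetI)
    fix F assume F: "F \<in> \<Delta>"
    then have "F \<subseteq> X" using \<Delta> by (auto simp: simplicial_complex_def)
    then show "F \<in> {keys m | m. squarefree_on X m \<and> power_product m \<notin> (nonface_ideal X \<Delta> :: ('x, 'k) mpoly set)}"
      using F fin by (intro CollectI exI[of _ "face_monomial F"])
        (simp add: keys_face_monomial squarefree_face_monomial nonface_ideal_def)
  next
    fix F assume "F \<in> {keys m | m. squarefree_on X m \<and> power_product m \<notin> (nonface_ideal X \<Delta> :: ('x, 'k) mpoly set)}"
    then show "F \<in> \<Delta>" by (auto simp: squarefree_on_def nonface_ideal_def polys_power_product)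
  qed
qed

lemma nonface_subset_face_ideal:
  "simplicial_complex X \<Delta> \<Longrightarrow> F \<in> \<Delta> \<Longrightarrow> nonface_ideal X \<Delta> \<subseteq> face_ideal X F"
  unfolding nonface_ideal_def face_ideal_def simplicial_complex_def by blast

lemma ideal_nonface_complex: "simplicial_complex X \<Delta> \<Longrightarrow> ideal (nonface_ideal X \<Delta>) (mpoly_ring X)"
  by (rule ideal_nonface_ideal) (auto simp: simplicial_complex_def)

lemma Inter_face_ideals:
  assumes "simplicial_complex X \<Delta>" "f \<in> polys X" "\<And>F. F \<in> \<Delta> \<Longrightarrow> f \<in> face_ideal X F"
  shows "f \<in> nonface_ideal X \<Delta>"
  using assms(2,3) unfolding nonface_ideal_def face_ideal_def by blast

text \<open>The primes of the faces all lie in the locus and already cut out the ideal, so it is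
  radical.\<close>

lemma vanishing_ideal_nonface:
  fixes X :: "'x set" and \<Delta> :: "'x set set"
  assumes X: "finite X" and \<Delta>: "simplicial_complex X \<Delta>"
  defines "I \<equiv> nonface_ideal X \<Delta> :: ('x, 'k::field) mpoly set"
  shows "vanishing_ideal (mpoly_ring X) (vanishing_locus (mpoly_ring X) I) = I"
proof (intro equalityI subsetI)
  fix f assume f: "f \<in> vanishing_ideal (mpoly_ring X) (vanishing_locus (mpoly_ring X) I)"
  have "f \<in> face_ideal X F" if F: "F \<in> \<Delta>" for F
    using f primeideal_face_ideal[OF X, of F, where 'k = 'k] nonface_subset_face_ideal[OF \<Delta> F]
    by (auto simp: vanishing_ideal_def vanishing_locus_def spec_def I_def)
  then show "f \<in> I" using f Inter_face_ideals[OF \<Delta>] by (auto simp: vanishing_ideal_def I_def)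
next
  fix f assume "f \<in> I"
  then show "f \<in> vanishing_ideal (mpoly_ring X) (vanishing_locus (mpoly_ring X) I)"
    by (auto simp: vanishing_ideal_def vanishing_locus_def I_def nonface_ideal_def)
qed

lemma finite_complex: "finite X \<Longrightarrow> simplicial_complex X \<Delta> \<Longrightarrow> finite \<Delta>"
  unfolding simplicial_complex_def using finite_subset[of \<Delta> "Pow X"] by simp

text \<open>Otherwise choose for each face an element of its ideal outside \<open>Q\<close>. Their
  product lies in every face ideal, hence in \<open>Q\<close>, against primality.\<close>

lemma prime_contains_face_ideal:
  fixes Q :: "('x, 'k::field) mpoly set"
  assumes X: "finite X" and \<Delta>: "simplicial_complex X \<Delta>"
    and Q: "primeideal Q (mpoly_ring X)" "nonface_ideal X \<Delta> \<subseteq> Q"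
  shows "\<exists>F\<in>\<Delta>. face_ideal X F \<subseteq> Q"
proof (rule ccontr)
  assume neg: "\<not> ?thesis"
  then have "\<exists>f. f \<in> face_ideal X F - Q" if "F \<in> \<Delta>" for F using that by blast
  then obtain f where f: "\<And>F. F \<in> \<Delta> \<Longrightarrow> f F \<in> face_ideal X F - Q" by metis
  note fin = finite_complex[OF X \<Delta>]
  have fX: "f F \<in> polys X - Q" if "F \<in> \<Delta>" for F using f[OF that] by (auto simp: face_ideal_def)
  have prod: "prod f \<Delta> \<in> polys X - Q" using fX by (intro primeideal_mpoly_prod[OF Q(1) fin])
  have "prod f \<Delta> \<in> nonface_ideal X \<Delta>"
  proof (rule Inter_face_ideals[OF \<Delta>])
    fix F assume F: "F \<in> \<Delta>"
    have "prod f \<Delta> = prod f (\<Delta> - {F}) * f F" using prod.remove[OF fin F, of f] by (simp add: mult.commute)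
    moreover have "prod f (\<Delta> - {F}) \<in> polys X" using fX by (intro polys_prod) auto
    ultimately show "prod f \<Delta> \<in> face_ideal X F"
      using ideal_mpoly_mult[OF ideal_face_ideal] f[OF F] by auto
  qed (use prod in auto)
  then show False using prod Q(2) by blast
qed

lemma power_product_dvd_mvar:
  assumes "x \<in> keys m"
  shows "m = (m - Poly_Mapping.single x 1) + Poly_Mapping.single x 1"
    and "power_product m = power_product (m - Poly_Mapping.single x 1) * mvar x"
    and "keys (m - Poly_Mapping.single x 1) \<subseteq> keys m"
proof -
  show eq: "m = (m - Poly_Mapping.single x 1) + Poly_Mapping.single x 1"
  proof (rule poly_mapping_eqI)
    fix y
    show "lookup m y = lookup (m - Poly_Mapping.single x 1 + Poly_Mapping.single x 1) y"
      using assms by (cases "y = x") (auto simp: lookup_add lookup_minus lookup_single in_keys_iff)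
  qed
  then show "power_product m = power_product (m - Poly_Mapping.single x 1) * mvar x"
    by (metis mvar_def power_product_add)
  show "keys (m - Poly_Mapping.single x 1) \<subseteq> keys m"
    using keys_add_nat[of "m - Poly_Mapping.single x 1" "Poly_Mapping.single x 1"] eq by auto
qed

lemma power_product_in_ideal:
  assumes "ideal J (mpoly_ring X)" "keys m \<subseteq> X" "x \<in> keys m" "mvar x \<in> J"
  shows "power_product m \<in> J"
  using ideal_mpoly_mult[OF assms(1) polys_power_product assms(4)] power_product_dvd_mvar[OF assms(3)] assms(2)
  by (metis subset_trans)

lemma mvar_in_face_ideal: "x \<in> X \<Longrightarrow> x \<notin> F \<Longrightarrow> mvar x \<in> (face_ideal X F :: ('x, 'k::comm_ring_1) mpoly set)"
  by (simp add: face_ideal_def polys_mvar) (simp add: mvar_def)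

lemma power_product_face_monomial: "finite G \<Longrightarrow> power_product (face_monomial G) = (\<Prod>x\<in>G. mvar x)"
  by (induction G rule: finite_induct) (simp_all add: face_monomial_def power_product_add mvar_def)

lemma face_ideal_subset:
  fixes J :: "('x, 'k::comm_ring_1) mpoly set"
  assumes "ideal J (mpoly_ring X)" "\<And>x. x \<in> X - F \<Longrightarrow> mvar x \<in> J"
  shows "face_ideal X F \<subseteq> J"
proof
  fix p :: "('x, 'k) mpoly" assume p: "p \<in> face_ideal X F"
  show "p \<in> J"
  proof (rule in_ideal_if_monomials[OF assms(1)])
    fix m assume "m \<in> keys p"
    then have "keys m \<subseteq> X" "\<not> keys m \<subseteq> F" using p by (auto simp: face_ideal_def polys_def)
    then obtain x where "keys m \<subseteq> X" "x \<in> keys m" "x \<notin> F" by blast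
    then show "power_product m \<in> J" using assms by (intro power_product_in_ideal[OF assms(1)]) auto
  qed
qed

text \<open>The finitely many generators in \<open>E\<close> are split off one at a time, and the
  contribution of \<open>J\<close> is kept as a remainder.\<close>

lemma genideal_Un_rep:
  fixes E :: "('x, 'k::comm_ring_1) mpoly set"
  assumes J: "ideal J (mpoly_ring X)" and "finite E" "E \<subseteq> polys X" "z \<in> genideal (mpoly_ring X) (E \<union> J)"
  shows "\<exists>c. (\<forall>g\<in>E. c g \<in> polys X) \<and> z - (\<Sum>g\<in>E. c g * g) \<in> J"
  using assms(2-4)
proof (induction E arbitrary: z rule: finite_induct)
  case empty
  then have "z \<in> J" using genideal_mpoly_minimal[OF J, of J] by auto
  then show ?case by simp
next
  case (insert g E)
  have sub: "E \<union> J \<subseteq> polys X" "g \<in> polys X" using insert.prems ideal_mpoly_subset[OF J] by auto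
  obtain r where r: "r \<in> polys X" "z - r * g \<in> genideal (mpoly_ring X) (E \<union> J)"
    using genideal_mpoly_insert[OF sub] insert.prems(2) by (metis Un_insert_left)
  then obtain c where c: "\<forall>g\<in>E. c g \<in> polys X" "z - r * g - (\<Sum>g\<in>E. c g * g) \<in> J"
    using insert.IH[of "z - r * g"] insert.prems by auto
  have "(\<Sum>h\<in>insert g E. (c(g := r)) h * h) = r * g + (\<Sum>h\<in>E. c h * h)"
    using insert.hyps by (simp add: sum.insert) (intro sum.cong, auto)
  then have "z - (\<Sum>h\<in>insert g E. (c(g := r)) h * h) \<in> J" using c(2) by (simp add: algebra_simps)
  then show ?case using c(1) r(1) by (intro exI[of _ "c(g := r)"]) auto
qed

section \<open>Derivatives as linear Taylor coefficients\<close>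

definition partial_deriv :: "'x \<Rightarrow> ('x, 'k::comm_ring_1) mpoly \<Rightarrow> ('x, 'k) mpoly" where
  "partial_deriv y f = lookup (taylor f) (Poly_Mapping.single y 1)"

text \<open>An exponent of degree one splits only as itself plus \<open>0\<close>, so the
  convolution of Taylor coefficients has two terms.\<close>

lemma partial_deriv_mult: "partial_deriv y (f * g) = f * partial_deriv y g + partial_deriv y f * g"
proof -
  let ?s = "Poly_Mapping.single y (1::nat)"
  have s0: "?s \<noteq> 0" by (metis lookup_single_eq lookup_zero one_neq_zero)
  let ?S = "{(a, c). a \<in> insert 0 (insert ?s (keys (taylor f))) \<and> c \<in> insert 0 (insert ?s (keys (taylor g))) \<and> a + c = ?s}"
  have "lookup (taylor f * taylor g) ?s = (\<Sum>(a, c)\<in>?S. lookup (taylor f) a * lookup (taylor g) c)"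
    by (rule lookup_mult_finite) auto
  also have "?S = {(0, ?s), (?s, 0)}"
  proof -
    have zero: "a = 0 \<or> c = 0" if "a + c = ?s" for a c
    proof -
      have "mdeg a + mdeg c = 1" using arg_cong[OF that, of mdeg] by (simp only: mdeg_add mdeg_single)
      then have "mdeg a = 0 \<or> mdeg c = 0" by arith
      then show ?thesis by (simp only: mdeg_eq_0_iff)
    qed
    have "(a = 0 \<and> c = ?s) \<or> (a = ?s \<and> c = 0)" if "a + c = ?s" for a c
      using zero[OF that] that by auto
    then show ?thesis by (intro equalityI subsetI) (auto split: prod.splits)
  qed
  finally show ?thesis using s0 by (simp add: partial_deriv_def taylor_mult taylor_0)
qed

lemma partial_deriv_diff: "partial_deriv y (f - g) = partial_deriv y f - partial_deriv y g"
proof -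
  have "taylor f = taylor (f - g) + taylor g" using taylor_add[of "f - g" g] by (simp only: diff_add_cancel)
  then have "lookup (taylor f) b = lookup (taylor (f - g)) b + lookup (taylor g) b" for b by (simp only: lookup_add)
  then show ?thesis by (simp only: partial_deriv_def) (simp only: add_diff_cancel_right')
qed

lemma partial_deriv_sum: "partial_deriv y (sum f A) = (\<Sum>i\<in>A. partial_deriv y (f i))"
  by (simp add: partial_deriv_def taylor_sum lookup_sum)



lemma partial_deriv_mvar: "partial_deriv y (mvar x) = (if x = y then 1 else 0)"
proof -
  have "Poly_Mapping.single x (1::nat) = Poly_Mapping.single y 1 \<longleftrightarrow> x = y"
    by (metis lookup_single_eq lookup_single_not_eq one_neq_zero)
  moreover have "Poly_Mapping.single y (1::nat) \<noteq> 0" by (metis lookup_single_eq lookup_zero one_neq_zero)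
  ultimately show ?thesis
    unfolding partial_deriv_def taylor_mvar
    by (auto simp: lookup_add mconst_def mvar_def power_product_def lookup_single when_def)
qed

lemma partial_deriv_polys: "f \<in> polys X \<Longrightarrow> partial_deriv y f \<in> polys X"
  unfolding partial_deriv_def by (rule taylor_polys)

lemma rel_dim_antimono:
  assumes X: "finite X" and W: "lin_subspace W" "lin_subspace W'" "W \<subseteq> W'"
  shows "rel_dim W' (box_polys X N) \<le> rel_dim W (box_polys X N)"
proof -
  define r where "r = rel_dim W' (box_polys X N)"
  obtain v where v: "\<And>i. i < r \<Longrightarrow> v i \<in> box_polys X N" and ind: "lin_indep_mod W' r v"
    using rel_dim_attained[OF finite_rel_dim_box[OF X W(2), of N]] r_def by metis
  have "lin_indep_mod W r v"
    unfolding lin_indep_mod_def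
  proof (rule allI, rule impI)
    fix c assume "lin_comb r c v \<in> W"
    then have "lin_comb r c v \<in> W'" using W(3) by auto
    then show "\<forall>i<r. c i = 0" using ind unfolding lin_indep_mod_def by simp
  qed
  then have "r \<le> rel_dim W (box_polys X N)"
    using v by (rule rel_dim_ge[OF finite_rel_dim_box[OF X W(1)]])
  then show ?thesis by (simp only: r_def)
qed

lemma growth_le_mono:
  assumes X: "finite X" and W: "lin_subspace W" "lin_subspace W'" "W \<subseteq> W'" and g: "growth_le X W d"
  shows "growth_le X W' d"
proof -
  obtain C where C: "\<And>N. rel_dim W (box_polys X N) \<le> C * (N + 1) ^ d"
    using g unfolding growth_le_def by blast
  have "rel_dim W' (box_polys X N) \<le> C * (N + 1) ^ d" for N
    using rel_dim_antimono[OF X W, of N] C[of N] by (rule order_trans)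
  then show ?thesis unfolding growth_le_def by blast
qed

section \<open>Regular points of Stanley--Reisner schemes\<close>

text \<open>If \<open>y\<close> joins the nonvanishing variables but lies outside the face \<open>F\<close> of a component through
  \<open>P\<close>, then the derivative along \<open>y\<close> lets \<open>y\<close> replace one of the \<open>n\<close> generators of the maximal
  ideal. As \<open>y\<close> vanishes on the component, this leaves \<open>n - 1\<close> generators for the local ring of
  the component, which has dimension \<open>n\<close>.\<close>

lemma regular_point_star:
  fixes X :: "'x set" and \<Delta> :: "'x set set" and P :: "('x, 'k::field) mpoly set"
  assumes X: "finite X" and \<Delta>: "simplicial_complex X \<Delta>"
    and P: "primeideal P (mpoly_ring X)" "nonface_ideal X \<Delta> \<subseteq> P"
    and reg: "regular_local_ring (localization (mpoly_ring X Quot nonface_ideal X \<Delta>) (cls X (nonface_ideal X \<Delta>) ` P))"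
  defines "U \<equiv> {x \<in> X. mvar x \<notin> P}"
  shows "U \<union> {y \<in> X. insert y U \<in> \<Delta>} \<in> \<Delta>"
proof -
  let ?I = "nonface_ideal X \<Delta> :: ('x, 'k) mpoly set"
  note I = ideal_nonface_complex[OF \<Delta>, where 'b = 'k]
  note Pi = primeideal_mpoly_ideal[OF P(1)]
  note PX = ideal_mpoly_subset[OF Pi]
  obtain E n Q where E: "finite E" "E \<subseteq> P" "card E \<le> n"
    and gen: "\<And>p. p \<in> P \<Longrightarrow> \<exists>u\<in>polys X - P. u * p \<in> genideal (mpoly_ring X) (E \<union> ?I)"
    and Q: "\<And>i. i \<le> n \<Longrightarrow> primeideal (Q i) (mpoly_ring X) \<and> ?I \<subseteq> Q i \<and> Q i \<subseteq> P"
    and strict: "\<And>i. i < n \<Longrightarrow> Q i \<subset> Q (Suc i)"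
    by (rule regular_point_data[OF I P reg]) blast
  have EX: "E \<subseteq> polys X" using E(2) PX by blast
  \<comment> \<open>The component is chosen through the bottom prime of the chain, so that all
    \<open>n\<close> steps of the chain lie on it.\<close>
  obtain F where F: "F \<in> \<Delta>" "face_ideal X F \<subseteq> Q 0"
    using prime_contains_face_ideal[OF X \<Delta>, of "Q 0"] Q[of 0] by blast
  have FX: "F \<subseteq> X" using \<Delta> F(1) by (auto simp: simplicial_complex_def)
  have F_P: "face_ideal X F \<subseteq> P" using F(2) Q[of 0] by blast
  then have outside: "mvar x \<in> P" if "x \<in> X - F" for x using mvar_in_face_ideal[of x X F] that by blast
  have "y \<in> F" if y: "y \<in> X" "insert y U \<in> \<Delta>" for y
  proof (rule ccontr)
    assume yF: "y \<notin> F"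
    have yP: "mvar y \<in> P" using outside y yF by blast
    obtain u where u: "u \<in> polys X" "u \<notin> P" "u * mvar y \<in> genideal (mpoly_ring X) (E \<union> ?I)"
      using gen[OF yP] by blast
    obtain c where c: "\<And>g. g \<in> E \<Longrightarrow> c g \<in> polys X" and j: "u * mvar y - (\<Sum>g\<in>E. c g * g) \<in> ?I"
      using genideal_Un_rep[OF I E(1) EX u(3)] by blast
    \<comment> \<open>Since \<open>insert y U\<close> is a face, each monomial of \<open>f\<close>
      has a variable other than \<open>y\<close> that vanishes at \<open>P\<close>; differentiation
      along \<open>y\<close> leaves this factor in place.\<close>
    have deriv_I: "partial_deriv y f \<in> P" if f: "f \<in> ?I" for f
    proof -
      have "partial_deriv y (power_product m) \<in> P" if m: "m \<in> keys f" for m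
      proof -
        have mX: "keys m \<subseteq> X" "keys m \<notin> \<Delta>" using f m by (auto simp: nonface_ideal_def polys_def)
        then have "\<not> keys m \<subseteq> insert y U" using \<Delta> y(2) by (auto simp: simplicial_complex_def)
        then obtain x where x: "x \<in> keys m" "x \<noteq> y" "mvar x \<in> P" using mX by (auto simp: U_def)
        have "keys (m - Poly_Mapping.single x 1) \<subseteq> X" using power_product_dvd_mvar(3)[OF x(1)] mX by blast
        then have "partial_deriv y (power_product (m - Poly_Mapping.single x 1)) * mvar x \<in> P"
          by (intro ideal_mpoly_mult[OF Pi] x partial_deriv_polys polys_power_product)
        then show ?thesis
          by (subst power_product_dvd_mvar(2)[OF x(1)]) (simp add: partial_deriv_mult partial_deriv_mvar x(2))
      qed
      then have "(\<Sum>m\<in>keys f. mconst (lookup f m) * partial_deriv y (power_product m)) \<in> P"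
        by (intro ideal_mpoly_sum[OF Pi] ideal_mpoly_mult[OF Pi]) auto
      also have "(\<Sum>m\<in>keys f. mconst (lookup f m) * partial_deriv y (power_product m)) = partial_deriv y f"
        unfolding partial_deriv_def by (rule lookup_taylor[symmetric])
      finally show ?thesis .
    qed
    \<comment> \<open>Otherwise the derivative of the relation \<open>j\<close> along
      \<open>y\<close> is congruent to \<open>u\<close> modulo \<open>P\<close>, because
      \<open>mvar y\<close> and all elements of \<open>E\<close> lie in \<open>P\<close>; but
      \<open>u\<close> does not.\<close>
    have "\<exists>g\<in>E. c g \<notin> P"
    proof (rule ccontr)
      assume neg: "\<not> ?thesis"
      let ?r = "(\<Sum>g\<in>E. c g * partial_deriv y g + partial_deriv y (c g) * g)"
      have "?r \<in> P"
      proof (rule ideal_mpoly_sum[OF Pi], rule ideal_mpoly_add[OF Pi])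
        fix g assume g: "g \<in> E"
        have "partial_deriv y g * c g \<in> P"
          using neg g EX by (intro ideal_mpoly_mult[OF Pi] partial_deriv_polys) auto
        then show "c g * partial_deriv y g \<in> P" by (simp add: mult.commute)
        show "partial_deriv y (c g) * g \<in> P"
          using g c E(2) by (intro ideal_mpoly_mult[OF Pi] partial_deriv_polys) auto
      qed
      moreover have "partial_deriv y (u * mvar y - (\<Sum>g\<in>E. c g * g)) = u + partial_deriv y u * mvar y - ?r"
        by (simp add: partial_deriv_diff partial_deriv_mult partial_deriv_mvar partial_deriv_sum)
      then have "u + partial_deriv y u * mvar y - ?r \<in> P" using deriv_I[OF j] by simp
      ultimately have "u + partial_deriv y u * mvar y \<in> P" using ideal_mpoly_add[OF Pi] by fastforce
      moreover have "partial_deriv y u * mvar y \<in> P"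
        by (intro ideal_mpoly_mult[OF Pi] partial_deriv_polys u yP)
      ultimately have "u \<in> P" using ideal_mpoly_cancel[OF Pi] by blast
      then show False using u(2) by blast
    qed
    then obtain g0 where g0: "g0 \<in> E" "c g0 \<notin> P" by blast
    \<comment> \<open>The variables outside \<open>F\<close> include \<open>y\<close> and generate
      the face ideal, so modulo them the relation expresses \<open>c g0 * g0\<close> by the
      generators other than \<open>g0\<close>.\<close>
    define E' where "E' = (E - {g0}) \<union> mvar ` (X - F)"
    have E': "finite E'" "E' \<subseteq> P" using E X outside by (auto simp: E'_def)
    then have E'X: "E' \<subseteq> polys X" using PX by blast
    let ?K = "genideal (mpoly_ring X) E'"
    note K = genideal_mpoly_ideal[OF E'X]
    have KE': "g \<in> ?K" if "g \<in> E'" for g using genideal_mpoly_self[OF E'X] that by blast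
    have "face_ideal X F \<subseteq> ?K" using KE' by (intro face_ideal_subset[OF K]) (auto simp: E'_def)
    then have IK: "?I \<subseteq> ?K" using nonface_subset_face_ideal[OF \<Delta> F(1)] by blast
    have "g0 * c g0 \<in> ?K"
    proof -
      have "u * mvar y \<in> ?K" using y yF by (intro ideal_mpoly_mult[OF K] u KE') (auto simp: E'_def)
      moreover have "(\<Sum>g\<in>E - {g0}. c g * g) \<in> ?K"
        by (intro ideal_mpoly_sum[OF K] ideal_mpoly_mult[OF K] c KE') (auto simp: E'_def)
      moreover have "u * mvar y - (\<Sum>g\<in>E. c g * g) \<in> ?K" using j IK by blast
      ultimately have "(u * mvar y - (\<Sum>g\<in>E - {g0}. c g * g)) - (u * mvar y - (\<Sum>g\<in>E. c g * g)) \<in> ?K"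
        using ideal_mpoly_diff[OF K] by blast
      then show ?thesis using sum.remove[OF E(1) g0(1), of "\<lambda>g. c g * g"] by (simp add: mult.commute)
    qed
    then have "g * c g0 \<in> ?K" if "g \<in> E \<union> ?I" for g
    proof (cases "g = g0")
      case False
      then have "g \<in> ?K" using that IK KE' by (auto simp: E'_def)
      then show ?thesis using ideal_mpoly_mult[OF K c[OF g0(1)], of g] by (simp add: mult.commute)
    qed simp
    note E_absorb = this
    have EIX: "E \<union> ?I \<subseteq> polys X" using EX ideal_mpoly_subset[OF I] by blast
    have absorb: "r * c g0 \<in> ?K" if "r \<in> genideal (mpoly_ring X) (E \<union> ?I)" for r
      using E_absorb by (rule genideal_mpoly_induct[OF EIX K _ that])
    have gen': "\<exists>v\<in>polys X - P. v * p \<in> ?K" if p: "p \<in> P" for p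
    proof -
      obtain v where v: "v \<in> polys X" "v \<notin> P" "v * p \<in> genideal (mpoly_ring X) (E \<union> ?I)" using gen[OF p] by blast
      have "(v * c g0) * p \<in> ?K" using absorb[OF v(3)] by (simp add: ac_simps)
      moreover have "v * c g0 \<in> polys X - P"
        using primeideal_mpoly_mult[OF P(1) v(1) c[OF g0(1)]] v g0 polys_mult[OF v(1) c[OF g0(1)]] by blast
      ultimately show ?thesis by blast
    qed
    have sub: "lin_subspace (Q i)" if "i \<le> n" for i
      using Q[OF that] by (intro lin_subspace_ideal primeideal_mpoly_ideal) auto
    have "growth_le X (Q 0) (card F)"
      by (rule growth_le_mono[OF X lin_subspace_ideal[OF ideal_face_ideal] sub F(2) growth_le_face_ideal[OF X FX]]) simp
    then have n: "n \<le> card F" "growth_le X (Q n) (card F - n)"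
      using growth_chain[OF X, of n Q "card F"] Q strict by auto
    then have growth: "growth_le X P (card F - n)"
      using Q[of n] by (intro growth_le_mono[OF X sub[of n] lin_subspace_ideal[OF Pi]]) auto
    \<comment> \<open>Together with the size of \<open>E'\<close> this reads
      \<open>card X \<le> (n - 1) + (card X - card F) + (card F - n)\<close>, whose right side is
      one too small.\<close>
    have "card X \<le> card E' + (card F - n)"
      by (rule card_le_local_generators[OF X P(1) E' _ growth]) (rule gen')
    moreover have "card E' \<le> (card E - 1) + (card X - card F)"
    proof -
      have "card E' \<le> card (E - {g0}) + card (mvar ` (X - F) :: ('x, 'k) mpoly set)"
        unfolding E'_def by (rule card_Un_le)
      moreover have "card (mvar ` (X - F) :: ('x, 'k) mpoly set) \<le> card (X - F)" using X by (intro card_image_le) auto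
      moreover have "card (X - F) = card X - card F" using X FX finite_subset by (intro card_Diff_subset) auto
      ultimately show ?thesis using E(1) g0(1) by (simp add: card_Diff_singleton)
    qed
    moreover have "1 \<le> card E" using E(1) g0(1) by (metis One_nat_def Suc_leI card_gt_0_iff empty_iff)
    moreover have "card F \<le> card X" using X FX by (rule card_mono)
    ultimately show False using n(1) E(3) by linarith
  qed
  moreover have "U \<subseteq> F" using outside by (auto simp: U_def)
  ultimately have "U \<union> {y \<in> X. insert y U \<in> \<Delta>} \<subseteq> F" by blast
  then show ?thesis using \<Delta> F(1) unfolding simplicial_complex_def by blast
qed

text \<open>Multiplication by the monomial of a facet enlarges every support not contained in
  \<open>F\<close> strictly beyond \<open>F\<close>, hence to a nonface. So the face ideal vanishes
  locally at its generic point.\<close>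

lemma regular_facet:
  fixes X :: "'x set" and \<Delta> :: "'x set set"
  assumes X: "finite X" and \<Delta>: "simplicial_complex X \<Delta>"
    and F: "F \<in> \<Delta>" "\<And>G. G \<in> \<Delta> \<Longrightarrow> F \<subseteq> G \<Longrightarrow> G = F"
  defines "I \<equiv> nonface_ideal X \<Delta> :: ('x, 'k::field) mpoly set"
  shows "regular_local_ring (localization (mpoly_ring X Quot I) (cls X I ` face_ideal X F))"
  unfolding I_def
proof (rule regular_point_generic[OF ideal_nonface_complex[OF \<Delta>] primeideal_face_ideal[OF X] nonface_subset_face_ideal[OF \<Delta> F(1)]])
  fix p :: "('x, 'k) mpoly" assume p: "p \<in> face_ideal X F"
  have FX: "F \<subseteq> X" "finite F" using \<Delta> F(1) X finite_subset by (auto simp: simplicial_complex_def)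
  let ?u = "power_product (face_monomial F) :: ('x, 'k) mpoly"
  have u: "?u \<in> polys X - face_ideal X F"
    using FX by (simp add: keys_face_monomial face_ideal_def polys_power_product)
  have "?u * p \<in> nonface_ideal X \<Delta>"
  proof -
    have "keys m \<notin> \<Delta>" if m: "m \<in> keys (?u * p)" for m
    proof -
      obtain b where b: "m = face_monomial F + b" "b \<in> keys p"
        using m Poly_Mapping.keys_mult[of ?u p] by auto
      then have "keys m = F \<union> keys b" "\<not> keys b \<subseteq> F"
        using FX p by (auto simp: keys_add_nat keys_face_monomial face_ideal_def)
      then show ?thesis using F(2)[of "keys m"] by blast
    qed
    then show ?thesis using u p by (auto simp: nonface_ideal_def face_ideal_def intro!: polys_mult)
  qed
  then show "\<exists>u\<in>polys X - face_ideal X F. u * p \<in> nonface_ideal X \<Delta>" using u by blast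
qed

lemma ex_facet:
  assumes "finite X" "simplicial_complex X \<Delta>" "G \<in> \<Delta>"
  obtains F where "F \<in> \<Delta>" "G \<subseteq> F" "\<And>H. H \<in> \<Delta> \<Longrightarrow> F \<subseteq> H \<Longrightarrow> H = F"
  using finite_has_maximal2[OF finite_complex[OF assms(1,2)] assms(3)] by metis

section \<open>Principal jets\<close>

lemma coeff_hom_const_poly: "coeff_hom (\<lambda>c. [:mconst c:])"
  by (simp add: coeff_hom_def mconst_add mconst_mult one_pCons)

definition jet_var :: "nat \<Rightarrow> 'x \<Rightarrow> ('x \<times> nat, 'k::comm_ring_1) mpoly poly" where
  "jet_var s x = (\<Sum>j\<le>s. Polynomial.monom (mvar (x, j)) j)"

lemma jet_subst_eq: "jet_subst s = mpoly_eval (\<lambda>c. [:mconst c:]) (jet_var s)"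
  by (simp add: jet_subst_def jet_var_def[abs_def])

lemma coeff_jet_var: "Polynomial.coeff (jet_var s x) j = (if j \<le> s then mvar (x, j) else 0)"
  by (simp add: jet_var_def coeff_sum)

lemma jet_subst_add: "jet_subst s (p + q) = jet_subst s p + jet_subst s q"
  and jet_subst_mult: "jet_subst s (p * q) = jet_subst s p * jet_subst s q"
  and jet_subst_power_product: "jet_subst s (power_product m) = monomial_eval (jet_var s) m"
  and jet_subst_mvar: "jet_subst s (mvar x) = jet_var s x"
  unfolding jet_subst_eq
  by (rule mpoly_eval_add[OF coeff_hom_const_poly] mpoly_eval_mult[OF coeff_hom_const_poly]
      mpoly_eval_power_product[OF coeff_hom_const_poly] mpoly_eval_mvar[OF coeff_hom_const_poly])+

lemma jet_subst_0 [simp]: "jet_subst s 0 = 0"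
  unfolding jet_subst_eq by (rule mpoly_eval_0)

lemma jet_subst_eq_sum: "jet_subst s p = (\<Sum>m\<in>keys p. [:mconst (lookup p m):] * jet_subst s (power_product m))"
  unfolding jet_subst_power_product unfolding jet_subst_eq mpoly_eval_eq ..

definition coeffs_in :: "'a::comm_ring_1 set \<Rightarrow> 'a poly \<Rightarrow> bool" where
  "coeffs_in K p \<longleftrightarrow> (\<forall>j. Polynomial.coeff p j \<in> K)"

lemma coeffs_in_mult:
  fixes p q :: "('y, 'k::comm_ring_1) mpoly poly"
  assumes "ideal K (mpoly_ring Y)" "coeffs_in (polys Y) p" "coeffs_in K q"
  shows "coeffs_in K (p * q)"
  using assms unfolding coeffs_in_def coeff_mult
  by (intro allI ideal_mpoly_sum[OF assms(1)] ideal_mpoly_mult[OF assms(1)]) auto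

lemma coeffs_in_sum:
  "ideal K (mpoly_ring Y) \<Longrightarrow> (\<And>i. i \<in> A \<Longrightarrow> coeffs_in K (f i)) \<Longrightarrow> coeffs_in K (sum f A)"
  unfolding coeffs_in_def coeff_sum by (auto intro: ideal_mpoly_sum)

lemma ideal_polys: "ideal (polys Y) (mpoly_ring Y)"
  by (rule idealI_mpoly) (auto intro: polys_add polys_mult)

lemma coeffs_in_const: "coeffs_in (polys Y) [:mconst c:]"
  by (simp add: coeffs_in_def coeff_pCons split: nat.split)

lemma coeffs_in_jet_var: "x \<in> X \<Longrightarrow> coeffs_in (polys (jet_vars s X)) (jet_var s x)"
  by (simp add: coeffs_in_def coeff_jet_var polys_mvar jet_vars_def)

lemma coeffs_in_jet_monomial:
  "keys m \<subseteq> X \<Longrightarrow> coeffs_in (polys (jet_vars s X)) (jet_subst s (power_product m) :: ('x \<times> nat, 'k::comm_ring_1) mpoly poly)"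
proof (induction m rule: monomial_induct)
  case zero
  have "coeffs_in (polys (jet_vars s X)) (1 :: ('x \<times> nat, 'k) mpoly poly)"
    by (simp add: coeffs_in_def coeff_1)
  then show ?case by (simp add: jet_subst_power_product del: power_product_0)
next
  case (single m x)
  then have "keys m \<subseteq> X" "x \<in> X" by (auto simp: keys_add_nat)
  then have "coeffs_in (polys (jet_vars s X)) (jet_subst s (power_product m) * jet_var s x :: ('x \<times> nat, 'k) mpoly poly)"
    by (intro coeffs_in_mult[OF ideal_polys] single.IH coeffs_in_jet_var)
  then show ?case by (simp add: jet_subst_power_product monomial_eval_add)
qed

lemma coeffs_in_jet_subst:
  fixes p :: "('x, 'k::comm_ring_1) mpoly"
  assumes "p \<in> polys X"
  shows "coeffs_in (polys (jet_vars s X)) (jet_subst s p)"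
proof -
  have "coeffs_in (polys (jet_vars s X)) (\<Sum>m\<in>keys p. [:mconst (lookup p m):] * jet_subst s (power_product m))"
    using assms by (intro coeffs_in_sum[OF ideal_polys] coeffs_in_mult[OF ideal_polys] coeffs_in_const
        coeffs_in_jet_monomial) (auto simp: polys_def)
  then show ?thesis by (simp only: jet_subst_eq_sum[of s p])
qed

text \<open>Each monomial contains a variable \<open>x\<close> outside \<open>F\<close>; the
  coefficients of \<open>jet_var s x\<close> are zero or variables outside
  \<open>F \<times> {..s}\<close>, and the property passes to multiples.\<close>

lemma coeffs_in_jet_face:
  fixes p :: "('x, 'k::comm_ring_1) mpoly"
  assumes p: "p \<in> face_ideal X F"
  shows "coeffs_in (face_ideal (jet_vars s X) (F \<times> {..s})) (jet_subst s p)"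
proof -
  let ?K = "face_ideal (jet_vars s X) (F \<times> {..s}) :: ('x \<times> nat, 'k) mpoly set"
  have K: "ideal ?K (mpoly_ring (jet_vars s X))" by (rule ideal_face_ideal)
  have "coeffs_in ?K (\<Sum>m\<in>keys p. [:mconst (lookup p m):] * jet_subst s (power_product m))"
  proof (intro coeffs_in_sum[OF K] coeffs_in_mult[OF K] coeffs_in_const)
    fix m assume "m \<in> keys p"
    then have mX: "keys m \<subseteq> X" "\<not> keys m \<subseteq> F" using p by (auto simp: face_ideal_def polys_def)
    then obtain x where x: "x \<in> keys m" "x \<in> X" "x \<notin> F" by blast
    have "keys (m - Poly_Mapping.single x 1) \<subseteq> X" using power_product_dvd_mvar(3)[OF x(1)] mX(1) by blast
    moreover have "coeffs_in ?K (jet_var s x)"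
      unfolding coeffs_in_def coeff_jet_var using x ideal_mpoly_0[OF K]
      by (auto intro!: mvar_in_face_ideal simp: jet_vars_def)
    ultimately have "coeffs_in ?K (jet_subst s (power_product (m - Poly_Mapping.single x 1)) * jet_var s x)"
      by (intro coeffs_in_mult[OF K] coeffs_in_jet_monomial)
    then show "coeffs_in ?K (jet_subst s (power_product m))"
      by (simp only: power_product_dvd_mvar(2)[OF x(1), where 'b = 'k] jet_subst_mult jet_subst_mvar)
  qed
  then show ?thesis by (simp only: jet_subst_eq_sum[of s p])
qed

lemma jet_ideal_generators:
  fixes J :: "('x, 'k::comm_ring_1) mpoly set"
  assumes "\<exists>G. finite G \<and> G \<subseteq> polys X \<and> J = genideal (mpoly_ring X) G"
  obtains G where "G \<subseteq> polys X" "J = genideal (mpoly_ring X) G"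
    "jet_ideal s X J = genideal (mpoly_ring (jet_vars s X)) {Polynomial.coeff (jet_subst s g) j |g j. g \<in> G \<and> j \<le> s}"
proof -
  define G where "G = (SOME G. finite G \<and> G \<subseteq> carrier (mpoly_ring X) \<and> J = genideal (mpoly_ring X) G)"
  have "finite G \<and> G \<subseteq> carrier (mpoly_ring X) \<and> J = genideal (mpoly_ring X) G"
    unfolding G_def by (rule someI_ex) (use assms in simp)
  moreover have "jet_ideal s X J = genideal (mpoly_ring (jet_vars s X)) {Polynomial.coeff (jet_subst s g) j |g j. g \<in> G \<and> j \<le> s}"
    unfolding jet_ideal_def Let_def G_def ..
  ultimately show ?thesis using that[of G] by (simp only: carrier_mpoly_ring)
qed

lemma jet_generators_polys:
  assumes "G \<subseteq> polys X"
  shows "{Polynomial.coeff (jet_subst s g) j |g j. g \<in> G \<and> j \<le> s} \<subseteq> polys (jet_vars s X)"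
  using coeffs_in_jet_subst assms by (fastforce simp: coeffs_in_def)

lemma jet_ideal_subset_face:
  fixes J :: "('x, 'k::comm_ring_1) mpoly set"
  assumes "\<exists>G. finite G \<and> G \<subseteq> polys X \<and> J = genideal (mpoly_ring X) G" "J \<subseteq> face_ideal X F"
  shows "jet_ideal s X J \<subseteq> face_ideal (jet_vars s X) (F \<times> {..s})"
proof -
  obtain G where G: "G \<subseteq> polys X" "J = genideal (mpoly_ring X) G"
    "jet_ideal s X J = genideal (mpoly_ring (jet_vars s X)) {Polynomial.coeff (jet_subst s g) j |g j. g \<in> G \<and> j \<le> s}"
    using jet_ideal_generators[OF assms(1)] .
  have "G \<subseteq> face_ideal X F" using genideal_mpoly_self[OF G(1)] G(2) assms(2) by blast
  then have "{Polynomial.coeff (jet_subst s g) j |g j. g \<in> G \<and> j \<le> s} \<subseteq> face_ideal (jet_vars s X) (F \<times> {..s})"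
    using coeffs_in_jet_face[of _ X F s] by (auto simp: coeffs_in_def)
  then show ?thesis unfolding G(3) by (rule genideal_mpoly_minimal[OF ideal_face_ideal])
qed

text \<open>This frees the jet ideal from the chosen generators. The polynomials whose jet
  coefficients up to order \<open>s\<close> lie in it form an ideal, since coefficient
  \<open>j\<close> of a product involves only coefficients up to \<open>j\<close>.\<close>

lemma jet_coeff_in_jet_ideal:
  fixes J :: "('x, 'k::comm_ring_1) mpoly set"
  assumes "\<exists>G. finite G \<and> G \<subseteq> polys X \<and> J = genideal (mpoly_ring X) G" "f \<in> J" "j \<le> s"
  shows "Polynomial.coeff (jet_subst s f) j \<in> jet_ideal s X J"
proof -
  obtain G where G: "G \<subseteq> polys X" "J = genideal (mpoly_ring X) G"
    "jet_ideal s X J = genideal (mpoly_ring (jet_vars s X)) {Polynomial.coeff (jet_subst s g) j |g j. g \<in> G \<and> j \<le> s}"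
    using jet_ideal_generators[OF assms(1)] .
  let ?K = "jet_ideal s X J"
  note gens = jet_generators_polys[OF G(1), of s]
  have K: "ideal ?K (mpoly_ring (jet_vars s X))" unfolding G(3) by (rule genideal_mpoly_ideal[OF gens])
  define L where "L = {f \<in> polys X. \<forall>j\<le>s. Polynomial.coeff (jet_subst s f) j \<in> ?K}"
  have "ideal L (mpoly_ring X)"
  proof (rule idealI_mpoly)
    show "0 \<in> L" using ideal_mpoly_0[OF K] by (simp add: L_def)
    show "a + b \<in> L" if "a \<in> L" "b \<in> L" for a b
      using that ideal_mpoly_add[OF K] by (auto simp: L_def jet_subst_add intro: polys_add)
    show "r * a \<in> L" if r: "r \<in> polys X" and a: "a \<in> L" for r a
    proof -
      have "Polynomial.coeff (jet_subst s (r * a)) j \<in> ?K" if j: "j \<le> s" for j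
        unfolding jet_subst_mult coeff_mult
      proof (rule ideal_mpoly_sum[OF K], rule ideal_mpoly_mult[OF K])
        fix i show "Polynomial.coeff (jet_subst s r) i \<in> polys (jet_vars s X)"
          using coeffs_in_jet_subst[OF r] by (simp add: coeffs_in_def)
        show "Polynomial.coeff (jet_subst s a) (j - i) \<in> ?K" using a j by (simp add: L_def)
      qed
      then show ?thesis using r a by (simp add: L_def polys_mult)
    qed
  qed (auto simp: L_def)
  moreover have "G \<subseteq> L"
  proof
    fix g assume g: "g \<in> G"
    have "Polynomial.coeff (jet_subst s g) j \<in> ?K" if "j \<le> s" for j
      unfolding G(3) by (rule subsetD[OF genideal_mpoly_self[OF gens]]) (use g that in blast)
    then show "g \<in> L" using g G(1) by (auto simp: L_def)
  qed
  ultimately have "J \<subseteq> L" unfolding G(2) by (rule genideal_mpoly_minimal)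
  then show ?thesis using assms(2,3) by (auto simp: L_def)
qed

section \<open>The projection to the base and its zero section\<close>

definition base_var :: "'x \<Rightarrow> ('x \<times> nat, 'k::comm_ring_1) mpoly" where
  "base_var x = mvar (x, 0)"

lemma monomial_eval_hom:
  assumes "h 1 = 1" "\<And>a b. h (a * b) = h a * h b"
  shows "h (monomial_eval v m) = monomial_eval (\<lambda>x. h (v x)) m"
  by (induction m rule: monomial_induct) (simp_all add: assms monomial_eval_add)

lemma jet_coeff_0:
  fixes f :: "('x, 'k::comm_ring_1) mpoly"
  shows "Polynomial.coeff (jet_subst s f) 0 = mpoly_eval mconst base_var f"
proof -
  have "Polynomial.coeff (monomial_eval (jet_var s) m :: ('x \<times> nat, 'k) mpoly poly) 0 = monomial_eval base_var m" for m
    by (subst monomial_eval_hom[where h = "\<lambda>p. Polynomial.coeff p 0"])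
       (simp_all add: coeff_mult_0 coeff_jet_var base_var_def[abs_def])
  then show ?thesis
    unfolding jet_subst_eq mpoly_eval_eq coeff_sum by (simp add: coeff_mult_0)
qed

text \<open>The zero section, which sends a point to its constant jet; on rings it is a retraction
  of the embedding \<open>x \<mapsto> x_0\<close>.\<close>

definition jet_section :: "('x \<times> nat, 'k::comm_ring_1) mpoly \<Rightarrow> ('x, 'k) mpoly" where
  "jet_section = mpoly_eval mconst (\<lambda>(x, j). if j = 0 then mvar x else 0)"

lemma jet_section_base:
  fixes f :: "('x, 'k::comm_ring_1) mpoly"
  shows "jet_section (mpoly_eval mconst base_var f) = f"
proof -
  note hom = coeff_hom_mconst
  have mult: "jet_section (a * b) = jet_section a * jet_section b" for a b :: "('x \<times> nat, 'k) mpoly"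
    unfolding jet_section_def by (rule mpoly_eval_mult[OF hom])
  have one: "jet_section 1 = (1 :: ('x, 'k) mpoly)"
    unfolding jet_section_def by (rule mpoly_eval_1[OF hom])
  have const: "jet_section (mconst c) = (mconst c :: ('x, 'k) mpoly)" for c
    unfolding jet_section_def by (rule mpoly_eval_mconst[OF hom])
  have var: "jet_section (base_var x) = (mvar x :: ('x, 'k) mpoly)" for x
    unfolding jet_section_def base_var_def by (subst mpoly_eval_mvar[OF hom]) simp
  have "jet_section (mpoly_eval mconst base_var f)
      = (\<Sum>m\<in>keys f. jet_section (mconst (lookup f m) * monomial_eval base_var m))"
    unfolding mpoly_eval_eq[of mconst base_var] jet_section_def by (rule mpoly_eval_sum[OF hom])
  also have "\<dots> = (\<Sum>m\<in>keys f. mconst (lookup f m) * power_product m)"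
  proof (rule sum.cong[OF refl])
    fix m
    have "jet_section (monomial_eval base_var m) = (monomial_eval mvar m :: ('x, 'k) mpoly)"
      using monomial_eval_hom[where h = jet_section, OF one mult, of base_var m] by (simp add: var)
    then show "jet_section (mconst (lookup f m) * monomial_eval base_var m) = mconst (lookup f m) * power_product m"
      by (simp add: mult const monomial_eval_mvar)
  qed
  also have "\<dots> = f" by (rule mpoly_eq_sum[symmetric])
  finally show ?thesis .
qed

lemma jet_section_face:
  fixes q :: "('x \<times> nat, 'k::comm_ring_1) mpoly"
  assumes q: "q \<in> face_ideal (jet_vars s X) (F \<times> {..s})"
  shows "jet_section q \<in> face_ideal X F"
proof -
  let ?v = "\<lambda>(x, j). if j = 0 then mvar x else (0 :: ('x, 'k) mpoly)"
  have K: "ideal (face_ideal X F :: ('x, 'k) mpoly set) (mpoly_ring X)" by (rule ideal_face_ideal)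
  have "monomial_eval ?v m \<in> face_ideal X F" if m: "m \<in> keys q" for m
  proof -
    have mX: "keys m \<subseteq> jet_vars s X" "\<not> keys m \<subseteq> F \<times> {..s}" using q m by (auto simp: face_ideal_def polys_def)
    then obtain x j where x: "(x, j) \<in> keys m" "x \<in> X" "x \<notin> F" by (auto simp: jet_vars_def)
    have "?v y \<in> polys X" if "y \<in> keys m" for y
      using mX(1) that by (auto simp: jet_vars_def polys_mvar split: prod.splits)
    then have rest: "(\<Prod>y\<in>keys m - {(x, j)}. ?v y ^ lookup m y) \<in> polys X"
      by (intro polys_prod polys_power) auto
    have "mvar x \<in> (face_ideal X F :: ('x, 'k) mpoly set)" by (rule mvar_in_face_ideal[OF x(2,3)])
    then have "?v (x, j) \<in> face_ideal X F" using ideal_mpoly_0[OF K] by simp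
    moreover have "lookup m (x, j) = Suc (lookup m (x, j) - 1)" using x(1) by (simp add: in_keys_iff)
    ultimately have "?v (x, j) ^ (lookup m (x, j) - 1) * ?v (x, j) \<in> face_ideal X F"
      using x(2) by (intro ideal_mpoly_mult[OF K] polys_power) (auto simp: polys_mvar)
    then have "?v (x, j) ^ lookup m (x, j) \<in> face_ideal X F"
      using \<open>lookup m (x, j) = Suc _\<close> by (metis power_Suc2)
    then have "(\<Prod>y\<in>keys m - {(x, j)}. ?v y ^ lookup m y) * ?v (x, j) ^ lookup m (x, j) \<in> face_ideal X F"
      by (rule ideal_mpoly_mult[OF K rest])
    then show ?thesis
      unfolding monomial_eval_def using prod.remove[OF finite_keys x(1), of "\<lambda>y. ?v y ^ lookup m y"]
      by (simp only: mult.commute)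
  qed
  then show ?thesis
    unfolding jet_section_def mpoly_eval_eq by (intro ideal_mpoly_sum[OF K] ideal_mpoly_mult[OF K] polys_mconst)
qed

lemma base_polys: "f \<in> polys X \<Longrightarrow> mpoly_eval mconst base_var f \<in> polys (jet_vars s X)"
  using coeffs_in_jet_subst[of f X s] unfolding coeffs_in_def by (metis jet_coeff_0)

lemma jet_projection_eq: "jet_projection X Q = {f \<in> polys X. mpoly_eval mconst base_var f \<in> Q}"
  by (simp add: jet_projection_def base_var_def[abs_def])

text \<open>The zero section shows that nothing outside the face ideal is contracted into it; the
  other inclusion is the case of constant jet coefficients.\<close>

lemma jet_projection_face:
  "jet_projection X (face_ideal (jet_vars s X) (F \<times> {..s})) = (face_ideal X F :: ('x, 'k::comm_ring_1) mpoly set)"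
proof (intro equalityI subsetI)
  fix f :: "('x, 'k) mpoly" assume "f \<in> jet_projection X (face_ideal (jet_vars s X) (F \<times> {..s}))"
  then have "jet_section (mpoly_eval mconst base_var f) \<in> face_ideal X F"
    using jet_section_face by (auto simp: jet_projection_eq)
  then show "f \<in> face_ideal X F" by (simp only: jet_section_base)
next
  fix f :: "('x, 'k) mpoly" assume f: "f \<in> face_ideal X F"
  then show "f \<in> jet_projection X (face_ideal (jet_vars s X) (F \<times> {..s}))"
    using coeffs_in_jet_face[OF f, of s]
    unfolding jet_projection_eq coeffs_in_def jet_coeff_0[symmetric, where s = s] using f by (simp add: face_ideal_def)
qed

lemma primeideal_jet_projection:
  assumes Q: "primeideal Q (mpoly_ring (jet_vars s X))"
  shows "primeideal (jet_projection X Q) (mpoly_ring X)"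
  unfolding primeideal_mpoly_iff
proof (intro conjI ballI impI)
  note hom = coeff_hom_mconst
  note Qi = primeideal_mpoly_ideal[OF Q]
  show "ideal (jet_projection X Q) (mpoly_ring X)"
    unfolding jet_projection_eq
    by (rule idealI_mpoly)
       (auto simp: mpoly_eval_add[OF hom] mpoly_eval_mult[OF hom] intro: polys_add polys_mult
         ideal_mpoly_0[OF Qi] ideal_mpoly_add[OF Qi] ideal_mpoly_mult[OF Qi] base_polys)
  show "1 \<notin> jet_projection X Q"
    using primeideal_mpoly_1[OF Q] by (simp add: jet_projection_eq mpoly_eval_1[OF hom])
  show "a \<in> jet_projection X Q \<or> b \<in> jet_projection X Q"
    if "a \<in> polys X" "b \<in> polys X" "a * b \<in> jet_projection X Q" for a b
    using that primeideal_mpoly_mult[OF Q base_polys base_polys]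
    by (auto simp: jet_projection_eq mpoly_eval_mult[OF hom])
qed

text \<open>The vanishing ideal of \<open>W\<close> is itself one of the ideals over which the
  closure is formed, so every point of the closure contains it.\<close>

lemma vanishing_ideal_closure:
  assumes W: "W \<subseteq> spec (mpoly_ring Y)"
  shows "vanishing_ideal (mpoly_ring Y) (zariski_closure (mpoly_ring Y) W) = vanishing_ideal (mpoly_ring Y) W"
proof
  let ?J = "vanishing_ideal (mpoly_ring Y) W"
  have "W \<subseteq> zariski_closure (mpoly_ring Y) W" by (auto simp: zariski_closure_def)
  then show "vanishing_ideal (mpoly_ring Y) (zariski_closure (mpoly_ring Y) W) \<subseteq> ?J"
    by (auto simp: vanishing_ideal_def)
  have id: "ideal P (mpoly_ring Y)" if "P \<in> W" for P
    using W that primeideal.axioms(1) by (auto simp: spec_def)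
  have "ideal ?J (mpoly_ring Y)"
    by (rule idealI_mpoly)
       (auto simp: vanishing_ideal_def intro: polys_add polys_mult ideal_mpoly_0[OF id] ideal_mpoly_add[OF id] ideal_mpoly_mult[OF id])
  moreover have "W \<subseteq> vanishing_locus (mpoly_ring Y) ?J"
    using W by (auto simp: vanishing_locus_def vanishing_ideal_def)
  ultimately have "zariski_closure (mpoly_ring Y) W \<subseteq> vanishing_locus (mpoly_ring Y) ?J"
    unfolding zariski_closure_def by blast
  then show "?J \<subseteq> vanishing_ideal (mpoly_ring Y) (zariski_closure (mpoly_ring Y) W)"
    by (auto simp: vanishing_ideal_def vanishing_locus_def)
qed

text \<open>The complex \<open>\<Gamma>_s\<close> of the theorem; its facets are the sets
  \<open>F \<times> {..s}\<close> for facets \<open>F\<close> of \<open>\<Delta>\<close>.\<close>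

definition jet_complex :: "nat \<Rightarrow> 'x set \<Rightarrow> 'x set set \<Rightarrow> ('x \<times> nat) set set" where
  "jet_complex s X \<Delta> = {G. G \<subseteq> jet_vars s X \<and> fst ` G \<in> \<Delta>}"

lemma simplicial_jet_complex:
  assumes "simplicial_complex X \<Delta>"
  shows "simplicial_complex (jet_vars s X) (jet_complex s X \<Delta>)"
  unfolding simplicial_complex_def
proof (intro conjI ballI allI impI)
  show "G \<in> jet_complex s X \<Delta>" if F: "F \<in> jet_complex s X \<Delta>" and G: "G \<subseteq> F" for F G
    using assms F image_mono[OF G, of fst] G unfolding simplicial_complex_def jet_complex_def by blast
qed (use assms in \<open>auto simp: simplicial_complex_def jet_complex_def\<close>)

text \<open>With \<open>w\<close> the jet of the product over \<open>U\<close>, coefficient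
  \<open>j\<close> of the given jet is \<open>x_j * w_0\<close> plus multiples of \<open>x_i\<close>
  for \<open>i < j\<close>. As \<open>w_0\<close> avoids the prime \<open>Q\<close>, the variables
  enter \<open>Q\<close> in the order of \<open>j\<close>.\<close>

lemma jet_vars_in_prime:
  fixes Q :: "('x \<times> nat, 'k::field) mpoly set"
  assumes Q: "primeideal Q (mpoly_ring (jet_vars s X))" and x: "x \<in> X" and U: "finite U" "U \<subseteq> X"
    and Uu: "\<And>u. u \<in> U \<Longrightarrow> mvar u \<notin> jet_projection X Q"
    and jets: "\<And>j. j \<le> s \<Longrightarrow> Polynomial.coeff (jet_subst s (mvar x * power_product (face_monomial U))) j \<in> Q"
    and j: "j \<le> s"
  shows "mvar (x, j) \<in> Q"
  using j
proof (induction j rule: less_induct)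
  case (less j)
  note Qi = primeideal_mpoly_ideal[OF Q]
  let ?m = "power_product (face_monomial U) :: ('x, 'k) mpoly"
  let ?w = "jet_subst s ?m"
  have mX: "?m \<in> polys X" using U by (simp add: polys_power_product keys_face_monomial)
  have "?m \<in> polys X - jet_projection X Q"
    unfolding power_product_face_monomial[OF U(1)]
  proof (rule primeideal_mpoly_prod[OF primeideal_jet_projection[OF Q] U(1)])
    show "mvar u \<in> polys X - jet_projection X Q" if "u \<in> U" for u
      using Uu[OF that] polys_mvar[of u X] U(2) that by auto
  qed
  then have w0: "Polynomial.coeff ?w 0 \<in> polys (jet_vars s X) - Q"
    using base_polys[OF mX, of s] by (simp add: jet_coeff_0 jet_projection_eq)
  have wX: "Polynomial.coeff ?w i \<in> polys (jet_vars s X)" for i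
    using coeffs_in_jet_subst[OF mX] by (simp add: coeffs_in_def)
  have "(\<Sum>i\<le>j. Polynomial.coeff (jet_var s x) i * Polynomial.coeff ?w (j - i)) \<in> Q"
    using jets[OF less.prems] by (simp add: jet_subst_mult jet_subst_mvar coeff_mult)
  also have "(\<Sum>i\<le>j. Polynomial.coeff (jet_var s x) i * Polynomial.coeff ?w (j - i))
      = mvar (x, j) * Polynomial.coeff ?w 0 + (\<Sum>i<j. mvar (x, i) * Polynomial.coeff ?w (j - i))"
    using less.prems by (simp add: lessThan_Suc_atMost[symmetric] coeff_jet_var)
  finally have sum: "mvar (x, j) * Polynomial.coeff ?w 0 + (\<Sum>i<j. mvar (x, i) * Polynomial.coeff ?w (j - i)) \<in> Q" .
  have "(\<Sum>i<j. mvar (x, i) * Polynomial.coeff ?w (j - i)) \<in> Q"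
  proof (rule ideal_mpoly_sum[OF Qi])
    fix i assume "i \<in> {..<j}"
    then have "mvar (x, i) \<in> Q" using less by simp
    then show "mvar (x, i) * Polynomial.coeff ?w (j - i) \<in> Q"
      using ideal_mpoly_mult[OF Qi wX] by (simp add: mult.commute)
  qed
  then have "mvar (x, j) * Polynomial.coeff ?w 0 \<in> Q" using ideal_mpoly_cancel[OF Qi _ sum] by blast
  moreover have "mvar (x, j) \<in> polys (jet_vars s X)" using x less.prems by (simp add: polys_mvar jet_vars_def)
  ultimately show ?case using primeideal_mpoly_mult[OF Q] w0 by blast
qed

theorem principal_jet_ideal_eq:
  fixes X :: "'x set" and \<Delta> :: "'x set set"
  assumes X: "finite X" and \<Delta>: "simplicial_complex X \<Delta>"
  shows "principal_jet_ideal s X (nonface_ideal X \<Delta> :: ('x, 'k::field) mpoly set)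
    = nonface_ideal (jet_vars s X) (jet_complex s X \<Delta>)"
proof -
  let ?I = "nonface_ideal X \<Delta> :: ('x, 'k) mpoly set"
  let ?R = "mpoly_ring X :: ('x, 'k) mpoly ring"
  let ?V = "jet_vars s X"
  let ?T = "mpoly_ring ?V :: ('x \<times> nat, 'k) mpoly ring"
  let ?Z = "vanishing_locus ?R ?I"
  define W where "W = {Q \<in> vanishing_locus ?T (jet_ideal s X ?I). jet_projection X Q \<notin> singular_locus ?R ?Z}"
  have van: "vanishing_ideal ?R ?Z = ?I" by (rule vanishing_ideal_nonface[OF X \<Delta>])
  have Wspec: "W \<subseteq> spec ?T" by (auto simp: W_def vanishing_locus_def)
  have eq: "principal_jet_ideal s X ?I = vanishing_ideal ?T W"
    unfolding principal_jet_ideal_def Let_def van W_def[symmetric] by (rule vanishing_ideal_closure[OF Wspec])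
  have V: "finite ?V" using X by (simp add: jet_vars_def)
  have fg: "\<exists>G. finite G \<and> G \<subseteq> polys X \<and> ?I = genideal ?R G"
    using stanley_reisner_eq(2)[OF stanley_reisner_nonface_ideal[OF X \<Delta>] X] .
  have sing: "P \<in> singular_locus ?R ?Z \<longleftrightarrow> P \<in> ?Z \<and> \<not> regular_local_ring (localization (?R Quot ?I) (cls X ?I ` P))" for P
    by (simp add: singular_locus_def van Let_def)
  show ?thesis
    unfolding eq
  proof (intro equalityI subsetI)
    fix f assume f: "f \<in> vanishing_ideal ?T W"
    then have fV: "f \<in> polys ?V" by (simp add: vanishing_ideal_def)
    have "keys m \<notin> jet_complex s X \<Delta>" if m: "m \<in> keys f" for m
    proof
      assume "keys m \<in> jet_complex s X \<Delta>"
      then have mV: "keys m \<subseteq> ?V" "fst ` keys m \<in> \<Delta>" by (auto simp: jet_complex_def)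
      \<comment> \<open>A maximal face is taken so that the prime over it projects to a regular
        point and therefore belongs to \<open>W\<close>.\<close>
      obtain F where F: "F \<in> \<Delta>" "fst ` keys m \<subseteq> F" "\<And>H. H \<in> \<Delta> \<Longrightarrow> F \<subseteq> H \<Longrightarrow> H = F"
        using ex_facet[OF X \<Delta> mV(2)] by blast
      let ?Q = "face_ideal ?V (F \<times> {..s}) :: ('x \<times> nat, 'k) mpoly set"
      have "primeideal ?Q ?T" by (rule primeideal_face_ideal[OF V])
      moreover have "jet_ideal s X ?I \<subseteq> ?Q"
        by (rule jet_ideal_subset_face[OF fg nonface_subset_face_ideal[OF \<Delta> F(1)]])
      moreover have "jet_projection X ?Q \<notin> singular_locus ?R ?Z"
        unfolding jet_projection_face sing using regular_facet[OF X \<Delta> F(1,3)] by blast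
      ultimately have "?Q \<in> W" by (simp add: W_def vanishing_locus_def spec_def)
      then have "f \<in> ?Q" using f by (simp add: vanishing_ideal_def)
      then have "\<not> keys m \<subseteq> F \<times> {..s}" using m by (simp add: face_ideal_def)
      then show False using mV F(2) by (auto simp: jet_vars_def)
    qed
    then show "f \<in> nonface_ideal ?V (jet_complex s X \<Delta>)" using fV by (simp add: nonface_ideal_def)
  next
    fix f assume f: "f \<in> (nonface_ideal ?V (jet_complex s X \<Delta>) :: ('x \<times> nat, 'k) mpoly set)"
    have "f \<in> Q" if QW: "Q \<in> W" for Q
    proof -
      have Q: "primeideal Q ?T" "jet_ideal s X ?I \<subseteq> Q" "jet_projection X Q \<notin> singular_locus ?R ?Z"
        using QW by (auto simp: W_def vanishing_locus_def spec_def)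
      note Qi = primeideal_mpoly_ideal[OF Q(1)]
      let ?P = "jet_projection X Q"
      have P: "primeideal ?P ?R" by (rule primeideal_jet_projection[OF Q(1)])
      have jets: "Polynomial.coeff (jet_subst s h) j \<in> Q" if "h \<in> ?I" "j \<le> s" for h j
        using jet_coeff_in_jet_ideal[OF fg that] Q(2) by blast
      have IP: "?I \<subseteq> ?P"
      proof
        fix h assume h: "h \<in> ?I"
        then have "mpoly_eval mconst base_var h \<in> Q" using jets[OF h, of 0] by (simp add: jet_coeff_0)
        then show "h \<in> ?P" using h by (simp add: jet_projection_eq nonface_ideal_def)
      qed
      then have "regular_local_ring (localization (?R Quot ?I) (cls X ?I ` ?P))"
        using Q(3) P unfolding sing by (simp add: vanishing_locus_def spec_def)
      define U where "U = {x \<in> X. mvar x \<notin> ?P}"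
      define A where "A = U \<union> {y \<in> X. insert y U \<in> \<Delta>}"
      have A: "A \<in> \<Delta>" unfolding A_def U_def by (rule regular_point_star[OF X \<Delta> P IP]) fact
      have U: "finite U" "U \<subseteq> X" using X by (auto simp: U_def)
      have var: "mvar (x, j) \<in> Q" if x: "x \<in> X" "x \<notin> A" and j: "j \<le> s" for x j
      proof (rule jet_vars_in_prime[OF Q(1) x(1) U _ _ j])
        show "mvar u \<notin> ?P" if "u \<in> U" for u using that by (simp add: U_def)
        \<comment> \<open>Outside \<open>A\<close> the set \<open>insert x U\<close> is not a face,
          so its monomial lies in the ideal and its jets are available.\<close>
        have "x \<notin> U" "insert x U \<notin> \<Delta>" using x by (auto simp: A_def)
        have "power_product (face_monomial (insert x U)) \<in> ?I"
          using x U \<open>insert x U \<notin> \<Delta>\<close>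
          by (simp add: nonface_ideal_def keys_face_monomial polys_power_product)
        then have "mvar x * power_product (face_monomial U) \<in> ?I"
          using U \<open>x \<notin> U\<close> by (simp add: power_product_face_monomial)
        then show "Polynomial.coeff (jet_subst s (mvar x * power_product (face_monomial U))) j \<in> Q" if "j \<le> s" for j
          using jets that by blast
      qed
      show "f \<in> Q"
      proof (rule in_ideal_if_monomials[OF Qi])
        fix m assume "m \<in> keys f"
        then have mV: "keys m \<subseteq> ?V" "fst ` keys m \<notin> \<Delta>" using f by (auto simp: nonface_ideal_def polys_def jet_complex_def)
        \<comment> \<open>The projected support is no face whereas \<open>A\<close> is one, so the
          support contains a variable lying over a vertex outside \<open>A\<close>.\<close>
        then have "\<not> fst ` keys m \<subseteq> A" using A \<Delta> unfolding simplicial_complex_def by blast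
        then obtain z where z: "z \<in> keys m" "fst z \<notin> A" by blast
        then have "z \<in> ?V" using mV(1) by blast
        then have "mvar z \<in> Q" using var[of "fst z" "snd z"] z(2) by (auto simp: jet_vars_def)
        then show "power_product m \<in> Q" by (rule power_product_in_ideal[OF Qi mV(1) z(1)])
      qed
    qed
    then show "f \<in> vanishing_ideal ?T W" using f by (simp add: vanishing_ideal_def nonface_ideal_def)
  qed
qed

section \<open>Face numbers\<close>

lemma finite_compositions: "finite {a :: nat list. length a = j \<and> (\<forall>h\<in>set a. 0 < h) \<and> sum_list a = k}"
proof (rule finite_subset)
  show "{a :: nat list. length a = j \<and> (\<forall>h\<in>set a. 0 < h) \<and> sum_list a = k} \<subseteq> {a. set a \<subseteq> {..k} \<and> length a = j}"
    using member_le_sum_list by fastforce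
qed (simp add: finite_lists_length_eq)

lemma lifting_matrix_0: "lifting_matrix s 0 k = (if k = 0 then 1 else 0)"
proof -
  have "{a :: nat list. length a = 0 \<and> (\<forall>h\<in>set a. 0 < h) \<and> sum_list a = k} = (if k = 0 then {[]} else {})"
    by auto
  then show ?thesis unfolding lifting_matrix_def by simp
qed

text \<open>The first part \<open>h\<close> is split off, leaving a composition of
  \<open>k - h\<close> into \<open>j\<close> positive parts.\<close>

lemma lifting_matrix_Suc:
  "lifting_matrix s (Suc j) k = (\<Sum>h\<in>{1..k}. (Suc s choose h) * lifting_matrix s j (k - h))"
proof -
  let ?L = "\<lambda>j k. {a :: nat list. length a = j \<and> (\<forall>h\<in>set a. 0 < h) \<and> sum_list a = k}"
  let ?f = "\<lambda>a. prod_list (map (\<lambda>h. (s + 1) choose h) a)"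
  have "(\<Sum>h\<in>{1..k}. (Suc s choose h) * lifting_matrix s j (k - h))
      = (\<Sum>h\<in>{1..k}. \<Sum>t\<in>?L j (k - h). ?f (h # t))"
    by (simp add: lifting_matrix_def sum_distrib_left)
  also have "\<dots> = (\<Sum>(h, t)\<in>Sigma {1..k} (\<lambda>h. ?L j (k - h)). ?f (h # t))"
    by (rule sum.Sigma) (auto intro: finite_compositions)
  also have "\<dots> = (\<Sum>a\<in>?L (Suc j) k. ?f a)"
    by (rule sum.reindex_bij_witness[of _ "\<lambda>a. (hd a, tl a)" "\<lambda>(h, t). h # t"])
       (auto simp: length_Suc_conv)
  finally show ?thesis by (simp add: lifting_matrix_def)
qed

text \<open>A lift of \<open>insert x F\<close> consists of its fibre over \<open>x\<close>, a
  nonempty subset of the \<open>s + 1\<close> jet orders, and a lift of \<open>F\<close>. The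
  positive parts in the lifting matrix are the sizes of the fibres.\<close>

lemma card_lifts:
  assumes "finite F"
  shows "card {G. G \<subseteq> F \<times> {..s} \<and> fst ` G = F \<and> card G = k} = lifting_matrix s (card F) k"
  using assms
proof (induction F arbitrary: k rule: finite_induct)
  case empty
  have "{G :: ('a \<times> nat) set. G \<subseteq> {} \<times> {..s} \<and> fst ` G = {} \<and> card G = k} = (if k = 0 then {{}} else {})"
    by auto
  then show ?case by (simp add: lifting_matrix_0)
next
  case (insert x F)
  let ?S = "\<lambda>F k. {G. G \<subseteq> F \<times> {..s} \<and> fst ` G = F \<and> card G = k}"
  let ?H = "\<lambda>h. {H. H \<subseteq> {..s} \<and> card H = h}"
  let ?D = "Sigma {1..k} (\<lambda>h. ?H h \<times> ?S F (k - h))"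
  let ?to = "\<lambda>G. (card {i. (x, i) \<in> G}, {i. (x, i) \<in> G}, {z \<in> G. fst z \<noteq> x})"
  let ?from = "\<lambda>(h, H, G). Pair x ` H \<union> G"
  have finG: "finite G" if "G \<subseteq> F \<times> {..s}" for G
    using that insert.hyps(1) by (meson finite_SigmaI finite_atMost finite_subset)
  have finH: "finite H" if "H \<subseteq> {..s}" for H using that finite_subset by blast
  have split: "G = Pair x ` {i. (x, i) \<in> G} \<union> {z \<in> G. fst z \<noteq> x}" for G by force
  have split_card: "card G = card {i. (x, i) \<in> G} + card {z \<in> G. fst z \<noteq> x}"
    if G: "G \<subseteq> insert x F \<times> {..s}" for G
  proof -
    have "finite G" using G insert.hyps(1) by (meson finite_SigmaI finite_atMost finite_insert finite_subset)
    moreover have "finite {i. (x, i) \<in> G}" by (rule finH) (use G in auto)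
    ultimately have "card (Pair x ` {i. (x, i) \<in> G} \<union> {z \<in> G. fst z \<noteq> x}) = card (Pair x ` {i. (x, i) \<in> G}) + card {z \<in> G. fst z \<noteq> x}"
      by (intro card_Un_disjoint) auto
    then show ?thesis using split[of G] by (simp add: card_image inj_on_def)
  qed
  have "bij_betw ?to (?S (insert x F) k) ?D"
  proof (rule bij_betw_byWitness[where f' = ?from])
    show "\<forall>G\<in>?S (insert x F) k. ?from (?to G) = G"
      unfolding prod.case by (intro ballI split[symmetric])
    show "\<forall>d\<in>?D. ?to (?from d) = d"
    proof
      fix d assume "d \<in> ?D"
      then obtain h H G where d: "d = (h, H, G)" "card H = h" "G \<subseteq> F \<times> {..s}" by auto
      then have "{i. (x, i) \<in> Pair x ` H \<union> G} = H" "{z \<in> Pair x ` H \<union> G. fst z \<noteq> x} = G"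
        using insert.hyps(2) by auto
      then show "?to (?from d) = d" using d by simp
    qed
    show "?to ` ?S (insert x F) k \<subseteq> ?D"
    proof
      fix d assume "d \<in> ?to ` ?S (insert x F) k"
      then obtain G where d: "d = ?to G" and G: "G \<subseteq> insert x F \<times> {..s}" "fst ` G = insert x F" "card G = k" by blast
      have "x \<in> fst ` G" using G(2) by simp
      then have ne: "{i. (x, i) \<in> G} \<noteq> {}" by force
      have sub: "{i. (x, i) \<in> G} \<subseteq> {..s}" using G(1) by auto
      have "1 \<le> card {i. (x, i) \<in> G}" using ne finH[OF sub] by (simp add: Suc_le_eq card_gt_0_iff)
      moreover have "fst ` {z \<in> G. fst z \<noteq> x} = F" using G(2) insert.hyps(2) by force
      moreover have "{z \<in> G. fst z \<noteq> x} \<subseteq> F \<times> {..s}" using G(1) by auto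
      ultimately show "d \<in> ?D" using sub split_card[OF G(1)] G(3) by (auto simp: d)
    qed
    show "?from ` ?D \<subseteq> ?S (insert x F) k"
    proof
      fix G' assume "G' \<in> ?from ` ?D"
      then obtain h H G where G': "G' = Pair x ` H \<union> G" and h: "1 \<le> h" "h \<le> k" "H \<subseteq> {..s}" "card H = h"
        and G: "G \<subseteq> F \<times> {..s}" "fst ` G = F" "card G = k - h" by auto
      have "card G' = card (Pair x ` H) + card G"
        unfolding G' using finH[OF h(3)] finG[OF G(1)] G(1) insert.hyps(2) by (intro card_Un_disjoint) auto
      then have "card G' = k" using h G by (simp add: card_image inj_on_def)
      moreover have "H \<noteq> {}" using h by auto
      then have "fst ` G' = insert x F" using G(2) by (auto simp: G' image_Un image_image)
      moreover have "G' \<subseteq> insert x F \<times> {..s}" using h(3) G(1) by (auto simp: G')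
      ultimately show "G' \<in> ?S (insert x F) k" by simp
    qed
  qed
  then have "card (?S (insert x F) k) = card ?D" by (rule bij_betw_same_card)
  also have "\<dots> = (\<Sum>h\<in>{1..k}. card (?H h \<times> ?S F (k - h)))"
  proof (rule card_SigmaI)
    have "finite (?S F m)" for m
      by (rule finite_subset[of _ "Pow (F \<times> {..s})"]) (use insert.hyps(1) in auto)
    then show "\<forall>h\<in>{1..k}. finite (?H h \<times> ?S F (k - h))" by auto
  qed simp
  also have "\<dots> = (\<Sum>h\<in>{1..k}. (Suc s choose h) * lifting_matrix s (card F) (k - h))"
    using insert.IH n_subsets[of "{..s}"] by (simp add: card_cartesian_product)
  finally show ?case using insert.hyps by (simp add: lifting_matrix_Suc)
qed

text \<open>Here \<open>X\<close> is replaced by the projected face, which prepares for sorting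
  faces by their projection.\<close>

lemma jet_complex_iff:
  assumes "simplicial_complex X \<Delta>"
  shows "G \<in> jet_complex s X \<Delta> \<longleftrightarrow> fst ` G \<in> \<Delta> \<and> G \<subseteq> fst ` G \<times> {..s}"
proof
  assume "G \<in> jet_complex s X \<Delta>"
  then show "fst ` G \<in> \<Delta> \<and> G \<subseteq> fst ` G \<times> {..s}"
    by (auto simp: jet_complex_def jet_vars_def image_iff) force
next
  assume G: "fst ` G \<in> \<Delta> \<and> G \<subseteq> fst ` G \<times> {..s}"
  then have "fst ` G \<subseteq> X" using assms by (auto simp: simplicial_complex_def)
  then have "fst ` G \<times> {..s} \<subseteq> X \<times> {..s}" by (intro Sigma_mono) auto
  then show "G \<in> jet_complex s X \<Delta>" using G unfolding jet_complex_def jet_vars_def by blast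
qed

text \<open>Faces of the jet complex are partitioned by their projection, and the faces of
  \<open>\<Delta>\<close> are then grouped by cardinality.\<close>

theorem f_vector_jet_complex:
  assumes X: "finite X" and \<Delta>: "simplicial_complex X \<Delta>"
  shows "f_vector (jet_complex s X \<Delta>) = row_times_matrix (f_vector \<Delta>) (lifting_matrix s)"
proof
  fix k
  let ?S = "\<lambda>F. {G. G \<subseteq> F \<times> {..s} \<and> fst ` G = F \<and> card G = k}"
  note fin = finite_complex[OF X \<Delta>]
  have FX: "F \<subseteq> X" "finite F" "card F \<le> card X" if "F \<in> \<Delta>" for F
    using that \<Delta> X finite_subset card_mono[OF X, of F] by (auto simp: simplicial_complex_def)
  have "{G \<in> jet_complex s X \<Delta>. card G = k} = (\<Union>F\<in>\<Delta>. ?S F)"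
    by (auto simp: jet_complex_iff[OF \<Delta>])
  then have "f_vector (jet_complex s X \<Delta>) k = card (\<Union>F\<in>\<Delta>. ?S F)" by (simp add: f_vector_def)
  also have "\<dots> = (\<Sum>F\<in>\<Delta>. card (?S F))"
  proof (rule card_UN_disjoint[OF fin])
    show "\<forall>F\<in>\<Delta>. finite (?S F)"
      using FX(2) by (auto intro!: finite_subset[of "?S _" "Pow (_ \<times> {..s})"])
  qed auto
  also have "\<dots> = (\<Sum>F\<in>\<Delta>. lifting_matrix s (card F) k)"
    using FX(2) by (intro sum.cong card_lifts) auto
  also have "\<dots> = (\<Sum>j\<in>{..card X}. \<Sum>F\<in>{F \<in> \<Delta>. card F = j}. lifting_matrix s (card F) k)"
    by (rule sum.group[symmetric]) (use fin FX(3) in auto)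
  also have "\<dots> = (\<Sum>j\<in>{..card X}. f_vector \<Delta> j * lifting_matrix s j k)"
    by (intro sum.cong) (auto simp: f_vector_def)
  also have "\<dots> = Sum_any (\<lambda>j. f_vector \<Delta> j * lifting_matrix s j k)"
  proof (rule Sum_any.expand_superset[symmetric])
    show "{j. f_vector \<Delta> j * lifting_matrix s j k \<noteq> 0} \<subseteq> {..card X}"
    proof
      fix j assume "j \<in> {j. f_vector \<Delta> j * lifting_matrix s j k \<noteq> 0}"
      then have "card {F \<in> \<Delta>. card F = j} \<noteq> 0" by (simp add: f_vector_def)
      then have "{F \<in> \<Delta>. card F = j} \<noteq> {}" by (metis card.empty)
      then show "j \<in> {..card X}" using FX(3) by auto
    qed
  qed simp
  finally show "f_vector (jet_complex s X \<Delta>) k = row_times_matrix (f_vector \<Delta>) (lifting_matrix s) k"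
    by (simp add: row_times_matrix_def)
qed

text \<open>A set over a face \<open>F\<close> has at most \<open>s + 1\<close> elements per vertex,
  and the maximum is reached only by \<open>F \<times> {..s}\<close>. This underlies both the
  dimension and the equality of multiplicities.\<close>

lemma jet_complex_top:
  assumes X: "finite X" and \<Delta>: "simplicial_complex X \<Delta>" and d: "\<And>F. F \<in> \<Delta> \<Longrightarrow> card F \<le> d"
  shows "G \<in> jet_complex s X \<Delta> \<Longrightarrow> card G \<le> (s + 1) * d"
    and "f_vector (jet_complex s X \<Delta>) ((s + 1) * d) = f_vector \<Delta> d"
proof -
  have FX: "F \<subseteq> X" "finite F" if "F \<in> \<Delta>" for F
    using that \<Delta> X finite_subset by (auto simp: simplicial_complex_def)
  have sub: "G \<subseteq> fst ` G \<times> {..s}" and face: "fst ` G \<in> \<Delta>" if "G \<in> jet_complex s X \<Delta>" for G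
    using that by (auto simp only: jet_complex_iff[OF \<Delta>])
  have le: "card G \<le> (s + 1) * card (fst ` G)" if "G \<in> jet_complex s X \<Delta>" for G
    using card_mono[OF _ sub[OF that]] FX(2)[OF face[OF that]] by (simp add: card_cartesian_product mult.commute)
  show "card G \<le> (s + 1) * d" if "G \<in> jet_complex s X \<Delta>"
    using le[OF that] mult_le_mono2[OF d[OF face[OF that]], of "s + 1"] by (rule order_trans)
  have "{G \<in> jet_complex s X \<Delta>. card G = (s + 1) * d} = (\<lambda>F. F \<times> {..s}) ` {F \<in> \<Delta>. card F = d}"
  proof (intro equalityI subsetI)
    fix G assume "G \<in> {G \<in> jet_complex s X \<Delta>. card G = (s + 1) * d}"
    then have G: "G \<in> jet_complex s X \<Delta>" "card G = (s + 1) * d" by auto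
    have "(s + 1) * d \<le> (s + 1) * card (fst ` G)" using le[OF G(1)] G(2) by simp
    then have "d \<le> card (fst ` G)" by (rule mult_left_le_imp_le) simp
    then have eq: "card (fst ` G) = d" using d[OF face[OF G(1)]] by simp
    then have "G = fst ` G \<times> {..s}"
      using G FX(2)[OF face[OF G(1)]] by (intro card_subset_eq sub[OF G(1)]) (auto simp: card_cartesian_product)
    then show "G \<in> (\<lambda>F. F \<times> {..s}) ` {F \<in> \<Delta>. card F = d}" using eq face[OF G(1)] by blast
  next
    fix G assume "G \<in> (\<lambda>F. F \<times> {..s}) ` {F \<in> \<Delta>. card F = d}"
    then obtain F where F: "F \<in> \<Delta>" "card F = d" "G = F \<times> {..s}" by blast
    then show "G \<in> {G \<in> jet_complex s X \<Delta>. card G = (s + 1) * d}"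
      using FX[OF F(1)] by (auto simp: jet_complex_def jet_vars_def card_cartesian_product)
  qed
  moreover have "inj_on (\<lambda>F. F \<times> {..s}) {F \<in> \<Delta>. card F = d}" by (auto simp: inj_on_def)
  ultimately show "f_vector (jet_complex s X \<Delta>) ((s + 1) * d) = f_vector \<Delta> d"
    by (simp add: f_vector_def card_image)
qed

section \<open>Dimension\<close>

lemma face_ideal_strict_antimono:
  "B \<subset> A \<Longrightarrow> A \<subseteq> X \<Longrightarrow> (face_ideal X A :: ('x, 'k::comm_ring_1) mpoly set) \<subset> face_ideal X B"
proof -
  assume BA: "B \<subset> A" and A: "A \<subseteq> X"
  obtain x where x: "x \<in> A" "x \<notin> B" using BA by blast
  have "(mvar x :: ('x, 'k) mpoly) \<in> face_ideal X B" using x A by (intro mvar_in_face_ideal) auto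
  moreover have "(mvar x :: ('x, 'k) mpoly) \<notin> face_ideal X A" using x by (simp add: face_ideal_def mvar_def)
  moreover have "(face_ideal X A :: ('x, 'k) mpoly set) \<subseteq> face_ideal X B" using BA by (auto simp: face_ideal_def)
  ultimately show ?thesis by blast
qed

text \<open>For the upper bound, a chain above the ideal starts above some face prime, whose growth
  degree limits its length. For the lower bound, the vertices of a largest face are removed one at a
  time.\<close>

theorem krull_dim_stanley_reisner:
  fixes X :: "'x set" and \<Delta> :: "'x set set"
  assumes X: "finite X" and \<Delta>: "simplicial_complex X \<Delta>"
    and F: "F \<in> \<Delta>" "card F = d" and d: "\<And>G. G \<in> \<Delta> \<Longrightarrow> card G \<le> d"
  shows "krull_dim (mpoly_ring X Quot (nonface_ideal X \<Delta> :: ('x, 'k::field) mpoly set)) = enat d"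
  unfolding krull_dim_Quot[OF ideal_nonface_complex[OF \<Delta>]]
proof (rule antisym)
  let ?I = "nonface_ideal X \<Delta> :: ('x, 'k) mpoly set"
  have GX: "G \<subseteq> X" if "G \<in> \<Delta>" for G using that \<Delta> by (auto simp: simplicial_complex_def)
  show "chain_length {P. primeideal P (mpoly_ring X) \<and> ?I \<subseteq> P} \<le> enat d"
  proof (rule chain_length_le)
    fix n C
    assume "\<And>i. i \<le> n \<Longrightarrow> C i \<in> {P. primeideal P (mpoly_ring X) \<and> ?I \<subseteq> P}" and strict: "\<And>i. i < n \<Longrightarrow> C i \<subset> C (Suc i)"
    then have C: "\<And>i. i \<le> n \<Longrightarrow> primeideal (C i) (mpoly_ring X)" "?I \<subseteq> C 0" by auto
    obtain G where G: "G \<in> \<Delta>" "face_ideal X G \<subseteq> C 0"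
      using prime_contains_face_ideal[OF X \<Delta> C(1)[of 0] C(2)] by auto
    have "growth_le X (C 0) (card G)"
      by (rule growth_le_mono[OF X lin_subspace_ideal[OF ideal_face_ideal]
            lin_subspace_ideal[OF primeideal_mpoly_ideal[OF C(1)[of 0]]] G(2) growth_le_face_ideal[OF X GX[OF G(1)]]]) simp
    then have "n \<le> card G \<and> growth_le X (C n) (card G - n)"
      by (rule growth_chain[OF X, where Q = C, rotated 2]) (use C(1) strict in auto)
    then show "n \<le> d" using d[OF G(1)] by linarith
  qed
  have finF: "finite F" using GX[OF F(1)] X finite_subset by blast
  obtain f where f: "bij_betw f {..<d} F" using ex_enumeration[OF finF] F(2) by blast
  show "enat d \<le> chain_length {P. primeideal P (mpoly_ring X) \<and> ?I \<subseteq> P}"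
  proof (rule chain_length_ge[where C = "\<lambda>i. face_ideal X (f ` {..<d - i})"])
    fix i
    have sub: "f ` {..<d - j} \<subseteq> F" for j using f by (auto simp: bij_betw_def)
    then have "f ` {..<d - i} \<in> \<Delta>" using F(1) \<Delta> unfolding simplicial_complex_def by blast
    then show "(face_ideal X (f ` {..<d - i}) :: ('x, 'k) mpoly set) \<in> {P. primeideal P (mpoly_ring X) \<and> ?I \<subseteq> P}"
      using primeideal_face_ideal[OF X] nonface_subset_face_ideal[OF \<Delta>] by blast
    assume i: "i < d"
    have inj: "inj_on f {..<d}" using f by (rule bij_betw_imp_inj_on)
    have "f (d - Suc i) \<notin> f ` {..<d - Suc i}" using inj i by (auto dest!: inj_onD)
    moreover have "f (d - Suc i) \<in> f ` {..<d - i}" using i by auto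
    moreover have "f ` {..<d - Suc i} \<subseteq> f ` {..<d - i}" by auto
    ultimately have "f ` {..<d - Suc i} \<subset> f ` {..<d - i}" by blast
    then show "(face_ideal X (f ` {..<d - i}) :: ('x, 'k) mpoly set) \<subset> face_ideal X (f ` {..<d - Suc i})"
      using sub GX[OF F(1)] by (intro face_ideal_strict_antimono) auto
  qed
qed

section \<open>Multiplicity\<close>

text \<open>The preimage in \<open>k[X]\<close> of the \<open>n\<close>-th power of the graded
  maximal ideal of the Stanley-Reisner ring, as \<open>ideal_power_eq\<close> confirms.\<close>

definition degree_ideal :: "'x set \<Rightarrow> 'x set set \<Rightarrow> nat \<Rightarrow> ('x, 'k::comm_ring_1) mpoly set" where
  "degree_ideal X \<Delta> n = {p \<in> polys X. \<forall>m\<in>keys p. keys m \<notin> \<Delta> \<or> n \<le> mdeg m}"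

lemma ideal_degree_ideal:
  fixes X :: "'x set"
  assumes \<Delta>: "simplicial_complex X \<Delta>"
  shows "ideal (degree_ideal X \<Delta> n :: ('x, 'k::comm_ring_1) mpoly set) (mpoly_ring X)"
proof -
  have eq: "degree_ideal X \<Delta> n = {p :: ('x, 'k) mpoly. p \<in> polys X \<and> keys p \<subseteq> {m. keys m \<notin> \<Delta> \<or> n \<le> mdeg m}}"
    by (auto simp: degree_ideal_def)
  have "b + a \<in> {m. keys m \<notin> \<Delta> \<or> n \<le> mdeg m}" if "a \<in> {m. keys m \<notin> \<Delta> \<or> n \<le> mdeg m}" for a b :: "'x \<Rightarrow>\<^sub>0 nat"
  proof -
    have "keys a \<in> \<Delta>" if "keys (b + a) \<in> \<Delta>"
      using that \<Delta> unfolding keys_add_nat simplicial_complex_def by blast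
    then show ?thesis using that by (auto simp: mdeg_add)
  qed
  then show ?thesis unfolding eq by (intro ideal_monomials)
qed

lemma nonface_subset_degree_ideal: "nonface_ideal X \<Delta> \<subseteq> degree_ideal X \<Delta> n"
  by (auto simp: nonface_ideal_def degree_ideal_def)

lemma power_product_in_degree_ideal:
  "keys m \<subseteq> X \<Longrightarrow> keys m \<notin> \<Delta> \<or> n \<le> mdeg m \<Longrightarrow> power_product m \<in> degree_ideal X \<Delta> n"
  by (simp add: degree_ideal_def polys_power_product)

definition face_monomials :: "'x set set \<Rightarrow> nat \<Rightarrow> ('x \<Rightarrow>\<^sub>0 nat) set" where
  "face_monomials \<Delta> n = {m. keys m \<in> \<Delta> \<and> mdeg m < n}"

lemma finite_face_monomials:
  assumes X: "finite X" and \<Delta>: "simplicial_complex X \<Delta>"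
  shows "finite (face_monomials \<Delta> n)"
proof (rule finite_subset[OF _ finite_box[OF X]])
  have "lookup m x \<le> n" if "mdeg m < n" for m :: "'a \<Rightarrow>\<^sub>0 nat" and x using lookup_le_mdeg[of m x] that by simp
  then show "face_monomials \<Delta> n \<subseteq> box X n" using \<Delta> by (auto simp: face_monomials_def box_def simplicial_complex_def)
qed

locale stanley_reisner =
  fixes X :: "'x set" and \<Delta> :: "'x set set" and I :: "('x, 'k::field) mpoly set"
  assumes X: "finite X" and \<Delta>: "simplicial_complex X \<Delta>" and I_def: "I = nonface_ideal X \<Delta>"
begin

abbreviation (input) A where "A \<equiv> mpoly_ring X Quot I"
abbreviation (input) dideal where "dideal n \<equiv> cls X I ` degree_ideal X \<Delta> n"

lemma I_ideal: "ideal I (mpoly_ring X)"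
  unfolding I_def by (rule ideal_nonface_complex[OF \<Delta>])

lemma ring_A: "ring A"
  using cring_Quot[OF I_ideal] by (rule cring.axioms)

lemma I_sub: "I \<subseteq> degree_ideal X \<Delta> n"
  unfolding I_def by (rule nonface_subset_degree_ideal)

lemma ideal_dideal: "ideal (dideal n) A"
  by (rule ideal_image_cls[OF I_ideal ideal_degree_ideal[OF \<Delta>]])

text \<open>Monomials supported on nonfaces are zero in the quotient, so only those of degree at
  least \<open>n\<close> have to be checked.\<close>

lemma image_subset_if_monomials:
  assumes K: "ideal K A" and m: "\<And>m. keys m \<subseteq> X \<Longrightarrow> n \<le> mdeg m \<Longrightarrow> cls X I (power_product m) \<in> K"
  shows "dideal n \<subseteq> K"
proof
  fix x assume "x \<in> dideal n"
  then obtain p where p: "p \<in> degree_ideal X \<Delta> n" "x = cls X I p" by blast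
  have "p \<in> pull X I K"
  proof (rule in_ideal_if_monomials[OF ideal_pull[OF I_ideal K]])
    fix m' assume m': "m' \<in> keys p"
    then have mX: "keys m' \<subseteq> X" using p(1) by (simp add: degree_ideal_def polys_def)
    have "keys m' \<notin> \<Delta> \<or> n \<le> mdeg m'" using p(1) m' by (simp add: degree_ideal_def)
    then show "power_product m' \<in> pull X I K"
    proof
      assume "keys m' \<notin> \<Delta>"
      then have "power_product m' \<in> I" using mX by (simp add: I_def nonface_ideal_def polys_power_product)
      then show ?thesis using pull_superset[OF I_ideal K] by blast
    next
      assume "n \<le> mdeg m'"
      then show ?thesis using m[OF mX] mX by (simp add: pull_def polys_power_product)
    qed
  qed
  then show "x \<in> K" using p(2) by (simp add: pull_def)
qed

lemma graded_ideal_eq: "genideal A ((\<lambda>x. cls X I (mvar x)) ` X) = dideal 1"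
proof
  have sub: "(\<lambda>x. cls X I (mvar x)) ` X \<subseteq> carrier A" by (auto intro: cls_closed[OF I_ideal] polys_mvar)
  have "mvar x \<in> degree_ideal X \<Delta> 1" if "x \<in> X" for x
    unfolding mvar_def using that by (intro power_product_in_degree_ideal) auto
  then show "genideal A ((\<lambda>x. cls X I (mvar x)) ` X) \<subseteq> dideal 1"
    by (intro ring.genideal_minimal[OF ring_A ideal_dideal]) auto
  note K = ring.genideal_ideal[OF ring_A sub]
  show "dideal 1 \<subseteq> genideal A ((\<lambda>x. cls X I (mvar x)) ` X)"
  proof (rule image_subset_if_monomials[OF K])
    fix m assume m: "keys m \<subseteq> X" "1 \<le> mdeg m"
    then have "m \<noteq> 0" by auto
    then obtain x where x: "x \<in> keys m" by (auto simp: poly_mapping_eq_iff fun_eq_iff in_keys_iff)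
    have "mvar x \<in> pull X I (genideal A ((\<lambda>x. cls X I (mvar x)) ` X))"
      using x m ring.genideal_self[OF ring_A sub] by (auto simp: pull_def polys_mvar)
    then have "power_product m \<in> pull X I (genideal A ((\<lambda>x. cls X I (mvar x)) ` X))"
      by (rule power_product_in_ideal[OF ideal_pull[OF I_ideal K] m(1) x])
    then show "cls X I (power_product m) \<in> genideal A ((\<lambda>x. cls X I (mvar x)) ` X)" by (simp add: pull_def)
  qed
qed

lemma degree_ideal_mult:
  assumes p: "p \<in> degree_ideal X \<Delta> 1" and q: "q \<in> degree_ideal X \<Delta> n"
  shows "p * q \<in> degree_ideal X \<Delta> (Suc n)"
proof -
  have "keys m \<notin> \<Delta> \<or> Suc n \<le> mdeg m" if m: "m \<in> keys (p * q)" for m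
  proof -
    obtain a b where ab: "m = a + b" "a \<in> keys p" "b \<in> keys q"
      using m Poly_Mapping.keys_mult[of p q] by auto
    have sub: "keys a \<in> \<Delta>" "keys b \<in> \<Delta>" if "keys m \<in> \<Delta>"
      using that \<Delta> unfolding ab(1) keys_add_nat simplicial_complex_def by blast+
    have "keys a \<notin> \<Delta> \<or> 1 \<le> mdeg a" "keys b \<notin> \<Delta> \<or> n \<le> mdeg b"
      using p q ab(2,3) by (auto simp: degree_ideal_def)
    then show ?thesis using sub unfolding ab(1) mdeg_add by linarith
  qed
  then show ?thesis using p q by (auto simp: degree_ideal_def intro: polys_mult)
qed

text \<open>One inclusion is additivity of degrees. For the other, a variable is split off from a
  monomial of degree at least \<open>n + 1\<close>.\<close>

lemma ideal_power_eq: "ideal_power A (dideal 1) n = dideal n"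
proof (induction n)
  case 0
  have "degree_ideal X \<Delta> 0 = (polys X :: ('x, 'k) mpoly set)" by (auto simp: degree_ideal_def)
  then show ?case by (simp add: carrier_Quot)
next
  case (Suc n)
  have "ideal_prod A (dideal 1) (dideal n) = dideal (Suc n)"
  proof
    show "ideal_prod A (dideal 1) (dideal n) \<subseteq> dideal (Suc n)"
    proof
      fix x assume "x \<in> ideal_prod A (dideal 1) (dideal n)"
      then show "x \<in> dideal (Suc n)"
      proof (induction x rule: ideal_prod.induct)
        case (prod i j)
        then obtain p q where pq: "p \<in> degree_ideal X \<Delta> 1" "q \<in> degree_ideal X \<Delta> n" "i = cls X I p" "j = cls X I q" by blast
        then have "p \<in> polys X" "q \<in> polys X" by (auto simp: degree_ideal_def)
        then have "i \<otimes>\<^bsub>A\<^esub> j = cls X I (p * q)" using pq by (simp add: cls_mult[OF I_ideal])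
        then show ?case using degree_ideal_mult[OF pq(1,2)] by blast
      next
        case (sum s1 s2)
        then show ?case using additive_subgroup.a_closed[OF ideal.axioms(1)[OF ideal_dideal]] by blast
      qed
    qed
    note P = ring.ideal_prod_is_ideal[OF ring_A ideal_dideal[of 1] ideal_dideal[of n]]
    show "dideal (Suc n) \<subseteq> ideal_prod A (dideal 1) (dideal n)"
    proof (rule image_subset_if_monomials[OF P])
      fix m assume m: "keys m \<subseteq> X" "Suc n \<le> mdeg m"
      then have "m \<noteq> 0" by auto
      then obtain x where x: "x \<in> keys m" by (auto simp: poly_mapping_eq_iff fun_eq_iff in_keys_iff)
      let ?m = "m - Poly_Mapping.single x 1"
      have m': "keys ?m \<subseteq> X" using power_product_dvd_mvar(3)[OF x] m(1) by blast
      have "mdeg m = mdeg ?m + 1" using arg_cong[OF power_product_dvd_mvar(1)[OF x], of mdeg] by (simp only: mdeg_add mdeg_single)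
      then have "n \<le> mdeg ?m" using m(2) by simp
      then have "power_product ?m \<in> (degree_ideal X \<Delta> n :: ('x, 'k) mpoly set)" using m' by (simp add: power_product_in_degree_ideal)
      moreover have "mvar x \<in> (degree_ideal X \<Delta> 1 :: ('x, 'k) mpoly set)"
        unfolding mvar_def using x m(1) by (intro power_product_in_degree_ideal) auto
      ultimately have "cls X I (mvar x) \<otimes>\<^bsub>A\<^esub> cls X I (power_product ?m) \<in> ideal_prod A (dideal 1) (dideal n)"
        by (intro ideal_prod.prod) auto
      moreover have "cls X I (mvar x) \<otimes>\<^bsub>A\<^esub> cls X I (power_product ?m) = cls X I (mvar x * power_product ?m)"
        using x m(1) m' by (intro cls_mult[OF I_ideal, symmetric] polys_mvar polys_power_product) auto
      ultimately show "cls X I (power_product m) \<in> ideal_prod A (dideal 1) (dideal n)"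
        by (simp only: power_product_dvd_mvar(2)[OF x, where 'b = 'k] mult.commute)
    qed
  qed
  then show ?case using Suc by simp
qed

text \<open>The monomials of degree below \<open>n\<close> supported on faces form a basis of the
  quotient. Chains of ideals are chains of subspaces, and adding these monomials in order of
  decreasing degree gives a chain of ideals of that length.\<close>

lemma ring_length_Quot_dideal: "ring_length (A Quot dideal n) = enat (card (face_monomials \<Delta> n))"
proof (rule antisym)
  let ?B = "A Quot dideal n" and ?M = "card (face_monomials \<Delta> n)"
  let ?L = "degree_ideal X \<Delta> n :: ('x, 'k) mpoly set"
  note L = ideal_degree_ideal[OF \<Delta>, of n, where 'k = 'k]
  note hom2 = ideal.rcos_ring_hom_ring[OF ideal_dideal[of n]]
  have linL: "lin_subspace ?L" by (rule lin_subspace_ideal[OF L])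
  show "ring_length ?B \<le> enat ?M"
    unfolding ring_length_def
  proof (rule chain_length_le)
    fix c D assume "\<And>i. i \<le> c \<Longrightarrow> D i \<in> {J. ideal J ?B}" and strict: "\<And>i. i < c \<Longrightarrow> D i \<subset> D (Suc i)"
    then have D: "ideal (D i) ?B" if "i \<le> c" for i using that by blast
    \<comment> \<open>The ring is a quotient of a quotient, so its ideals are pulled back to
      \<open>k[X]\<close> in two stages.\<close>
    define D1 where "D1 i = {a \<in> carrier A. dideal n +>\<^bsub>A\<^esub> a \<in> D i}" for i
    have D1: "ideal (D1 i) A" if "i \<le> c" for i
      unfolding D1_def by (rule ring_hom_ring.ideal_vimage[OF hom2 D[OF that]])
    define K where "K i = pull X I (D1 i)" for i
    have K: "ideal (K i) (mpoly_ring X)" if "i \<le> c" for i unfolding K_def by (rule ideal_pull[OF I_ideal D1[OF that]])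
    have Kstrict: "K i \<subset> K (Suc i)" if i: "i < c" for i
    proof -
      obtain x where x: "x \<in> D (Suc i)" "x \<notin> D i" using strict[OF i] by blast
      have "x \<in> carrier ?B" using ideal.Icarr[OF D[of "Suc i"] x(1)] i by simp
      then obtain a where "a \<in> carrier A" "x = dideal n +>\<^bsub>A\<^esub> a" by (auto simp: FactRing_def A_RCOSETS_def')
      then have "a \<in> D1 (Suc i)" "a \<notin> D1 i" using x by (auto simp: D1_def)
      moreover have "D1 i \<subseteq> D1 (Suc i)" using strict[OF i] by (auto simp: D1_def)
      ultimately have "D1 i \<subset> D1 (Suc i)" by blast
      then show ?thesis unfolding K_def by (intro pull_strict[OF I_ideal D1]) (use i in auto)
    qed
    obtain b where b: "bij_betw b {..<?M} (face_monomials \<Delta> n)" using ex_enumeration[OF finite_face_monomials[OF X \<Delta>]] .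
    let ?w = "\<lambda>i. power_product (b i) :: ('x, 'k) mpoly"
    show "c \<le> ?M"
    proof (rule chain_le_span[OF linL, of c K ?M ?w])
      show "lin_subspace (K i)" if "i \<le> c" for i by (rule lin_subspace_ideal[OF K[OF that]])
      show "K i \<subset> K (Suc i)" if "i < c" for i by (rule Kstrict[OF that])
      show "?L \<subseteq> K 0"
      proof
        fix f assume f: "f \<in> ?L"
        then have fX: "f \<in> polys X" by (simp add: degree_ideal_def)
        have "cls X I f \<in> dideal n" using f by blast
        then have "dideal n +>\<^bsub>A\<^esub> cls X I f = \<zero>\<^bsub>?B\<^esub>"
          using ring.a_rcos_zero[OF ring_A ideal_dideal] by (simp add: FactRing_def)
        then have "cls X I f \<in> D1 0"
          using additive_subgroup.zero_closed[OF ideal.axioms(1)[OF D[of 0]]] cls_closed[OF I_ideal fX] by (simp add: D1_def)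
        then show "f \<in> K 0" using fX by (simp add: K_def pull_def)
      qed
      show "K c \<subseteq> lin_span_mod ?L ?M ?w"
      proof
        fix p assume "p \<in> K c"
        then have p: "p \<in> polys X" by (simp add: K_def pull_def)
        show "p \<in> lin_span_mod ?L ?M ?w"
        proof (rule in_span_monomials[OF linL, where A = "face_monomials \<Delta> n"])
          show "\<exists>i<?M. b i = m" if "m \<in> face_monomials \<Delta> n" for m by (rule bij_betw_lessThanD[OF b that])
          show "m \<in> face_monomials \<Delta> n \<or> power_product m \<in> ?L" if "m \<in> keys p" for m
          proof -
            have "keys m \<subseteq> X" using p that by (simp add: polys_def)
            then show ?thesis
              by (cases "m \<in> face_monomials \<Delta> n") (auto simp: face_monomials_def intro: power_product_in_degree_ideal)
          qed
        qed
      qed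
    qed
  qed
  obtain b where b: "bij_betw b {..<?M} (face_monomials \<Delta> n)"
    "\<And>i j. i \<le> j \<Longrightarrow> j < ?M \<Longrightarrow> mdeg (b i) \<le> mdeg (b j)"
    using ex_sorted_enumeration[OF finite_face_monomials[OF X \<Delta>], where w = mdeg] by blast
  \<comment> \<open>Besides the exponents that vanish in the quotient, \<open>T i\<close> admits the
    last \<open>i\<close> of the enumeration, which have the largest degrees.\<close>
  define T where "T i = {m. (keys m \<notin> \<Delta> \<or> n \<le> mdeg m) \<or> (\<exists>j<?M. ?M - i \<le> j \<and> b j = m)}" for i
  define K where "K i = {p :: ('x, 'k) mpoly. p \<in> polys X \<and> keys p \<subseteq> T i}" for i
  have K: "ideal (K i) (mpoly_ring X)" for i
    unfolding K_def
  proof (rule ideal_monomials)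
    fix a c :: "'x \<Rightarrow>\<^sub>0 nat" assume a: "a \<in> T i"
    show "c + a \<in> T i"
    proof (cases "keys (c + a) \<notin> \<Delta> \<or> n \<le> mdeg (c + a)")
      case False
      then have ca: "c + a \<in> face_monomials \<Delta> n" by (auto simp: face_monomials_def)
      then obtain k where k: "k < ?M" "b k = c + a" using bij_betw_lessThanD[OF b(1)] by blast
      have "keys a \<in> \<Delta>" using False \<Delta> unfolding keys_add_nat simplicial_complex_def by blast
      moreover have "\<not> n \<le> mdeg a" using False by (simp add: mdeg_add)
      ultimately obtain j where j: "j < ?M" "?M - i \<le> j" "b j = a" using a by (auto simp: T_def)
      \<comment> \<open>A multiple listed earlier would have no larger degree, so the cofactor would
        be trivial.\<close>
      have "j \<le> k"
      proof (rule ccontr)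
        assume "\<not> j \<le> k"
        then have "mdeg (c + a) \<le> mdeg a" using b(2)[of k j] j k by simp
        then have "c = 0" by (simp add: mdeg_add mdeg_eq_0_iff)
        then have "b k = b j" using j k by simp
        then show False using bij_betw_imp_inj_on[OF b(1)] j k \<open>\<not> j \<le> k\<close> by (auto dest: inj_onD)
      qed
      then show ?thesis using j k by (auto simp: T_def intro!: exI[of _ k])
    qed (simp add: T_def)
  qed
  have LK: "?L \<subseteq> K i" for i by (auto simp: K_def T_def degree_ideal_def)
  have IK: "I \<subseteq> K i" for i using I_sub[of n] LK[of i] by blast
  note K1 = ideal_image_cls[OF I_ideal K]
  have sub1: "dideal n \<subseteq> cls X I ` K i" for i using LK by blast
  show "enat ?M \<le> ring_length ?B"
    unfolding ring_length_def
  proof (rule chain_length_ge[where C = "\<lambda>i. (\<lambda>a. dideal n +>\<^bsub>A\<^esub> a) ` (cls X I ` K i)"])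
    fix i
    show "(\<lambda>a. dideal n +>\<^bsub>A\<^esub> a) ` (cls X I ` K i) \<in> {J. ideal J ?B}"
      using ring.ring_ideal_imp_quot_ideal[OF ring_A ideal_dideal K1] by simp
    assume i: "i < ?M"
    let ?p = "power_product (b (?M - Suc i)) :: ('x, 'k) mpoly"
    have bM: "b (?M - Suc i) \<in> face_monomials \<Delta> n" using bij_betwE[OF b(1)] i by simp
    then have pX: "?p \<in> polys X" using \<Delta> by (intro polys_power_product) (auto simp: face_monomials_def simplicial_complex_def)
    have "b (?M - Suc i) \<in> T (Suc i)" using i by (auto simp: T_def intro!: exI[of _ "?M - Suc i"])
    then have "?p \<in> K (Suc i)" using pX by (simp add: K_def)
    moreover have "b (?M - Suc i) \<notin> T i"
    proof
      assume "b (?M - Suc i) \<in> T i"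
      then obtain j where j: "j < ?M" "?M - i \<le> j" "b j = b (?M - Suc i)" using bM by (auto simp: T_def face_monomials_def)
      then have "j = ?M - Suc i" using bij_betw_imp_inj_on[OF b(1)] i by (auto dest!: inj_onD)
      then show False using j(2) i by simp
    qed
    then have "?p \<notin> K i" by (simp add: K_def)
    then have "cls X I ?p \<notin> cls X I ` K i" using cls_mem_image_iff[OF I_ideal K IK pX] by blast
    then have "dideal n +>\<^bsub>A\<^esub> cls X I ?p \<notin> (\<lambda>a. dideal n +>\<^bsub>A\<^esub> a) ` (cls X I ` K i)"
      using ring.rcos_mem_image_iff[OF ring_A ideal_dideal K1 sub1 cls_closed[OF I_ideal pX]] by blast
    moreover have "K i \<subseteq> K (Suc i)" by (fastforce simp: K_def T_def)
    ultimately show "(\<lambda>a. dideal n +>\<^bsub>A\<^esub> a) ` (cls X I ` K i) \<subset> (\<lambda>a. dideal n +>\<^bsub>A\<^esub> a) ` (cls X I ` K (Suc i))"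
      by blast
  qed
qed

end

text \<open>Fixing the positive exponent of \<open>x\<close> leaves a bound \<open>h < n\<close> for
  the rest; the sum of \<open>h choose card F\<close> over \<open>h < n\<close> is evaluated by the
  hockey-stick identity.\<close>

lemma card_monomials_support:
  assumes "finite F"
  shows "card {m :: 'x \<Rightarrow>\<^sub>0 nat. keys m = F \<and> mdeg m < Suc n} = n choose card F"
  using assms
proof (induction F arbitrary: n rule: finite_induct)
  case empty
  have "{m :: 'x \<Rightarrow>\<^sub>0 nat. keys m = {} \<and> mdeg m < Suc n} = {0}" by auto
  then show ?case by simp
next
  case (insert x F)
  let ?S = "\<lambda>F n. {m :: 'x \<Rightarrow>\<^sub>0 nat. keys m = F \<and> mdeg m < Suc n}"
  let ?s = "\<lambda>h. Poly_Mapping.single x (h::nat)"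
  let ?D = "Sigma {..<n} (\<lambda>h. ?S F h)"
  have fin: "finite (?S F h)" for h
  proof (rule finite_subset[OF _ finite_box[OF insert.hyps(1)]])
    have "lookup m y \<le> h" if "mdeg m < Suc h" for m :: "'x \<Rightarrow>\<^sub>0 nat" and y using lookup_le_mdeg[of m y] that by simp
    then show "?S F h \<subseteq> box F h" by (auto simp: box_def)
  qed
  have decomp: "m - ?s (lookup m x) + ?s (lookup m x) = m" for m :: "'x \<Rightarrow>\<^sub>0 nat"
    by (rule poly_mapping_eqI) (auto simp: lookup_add lookup_minus lookup_single when_def)
  have keys_rest: "keys (m - ?s (lookup m x)) = keys m - {x}" for m :: "'x \<Rightarrow>\<^sub>0 nat"
    by (auto simp: in_keys_iff lookup_minus lookup_single when_def split: if_splits)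
  have deg_rest: "mdeg m = mdeg (m - ?s (lookup m x)) + lookup m x" for m :: "'x \<Rightarrow>\<^sub>0 nat"
    using arg_cong[OF decomp[of m], of mdeg] by (simp only: mdeg_add mdeg_single)
  have "bij_betw (\<lambda>m. (n - lookup m x, m - ?s (lookup m x))) (?S (insert x F) n) ?D"
  proof (rule bij_betw_byWitness[where f' = "\<lambda>(h, m). m + ?s (n - h)"])
    show "\<forall>m\<in>?S (insert x F) n. (\<lambda>(h, m). m + ?s (n - h)) (n - lookup m x, m - ?s (lookup m x)) = m"
    proof
      fix m assume "m \<in> ?S (insert x F) n"
      then have "lookup m x \<le> n" using lookup_le_mdeg[of m x] by simp
      then show "(\<lambda>(h, m). m + ?s (n - h)) (n - lookup m x, m - ?s (lookup m x)) = m" using decomp by simp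
    qed
    show "\<forall>d\<in>?D. (\<lambda>m. (n - lookup m x, m - ?s (lookup m x))) ((\<lambda>(h, m). m + ?s (n - h)) d) = d"
    proof
      fix d assume "d \<in> ?D"
      then obtain h m where d: "d = (h, m)" "h < n" "keys m = F" by auto
      have "lookup m x = 0" using d(3) insert.hyps(2) by (simp add: in_keys_iff[symmetric] not_in_keys_iff_lookup_eq_zero[symmetric])
      then have "lookup (m + ?s (n - h)) x = n - h" by (simp add: lookup_add)
      then show "(\<lambda>m. (n - lookup m x, m - ?s (lookup m x))) ((\<lambda>(h, m). m + ?s (n - h)) d) = d" using d by simp
    qed
    show "(\<lambda>m. (n - lookup m x, m - ?s (lookup m x))) ` ?S (insert x F) n \<subseteq> ?D"
    proof
      fix d assume "d \<in> (\<lambda>m. (n - lookup m x, m - ?s (lookup m x))) ` ?S (insert x F) n"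
      then obtain m where d: "d = (n - lookup m x, m - ?s (lookup m x))" and m: "keys m = insert x F" "mdeg m < Suc n" by blast
      have "x \<in> keys m" using m(1) by simp
      then have "lookup m x \<noteq> 0" by (simp add: in_keys_iff)
      then show "d \<in> ?D" using deg_rest[of m] keys_rest[of m] m insert.hyps(2) by (auto simp: d)
    qed
    show "(\<lambda>(h, m). m + ?s (n - h)) ` ?D \<subseteq> ?S (insert x F) n"
      using insert.hyps(2) by (auto simp: keys_add_nat mdeg_add split: if_splits)
  qed
  then have "card (?S (insert x F) n) = card ?D" by (rule bij_betw_same_card)
  also have "\<dots> = (\<Sum>h<n. h choose card F)"
    using fin insert.IH by (simp add: card_SigmaI)
  also have "\<dots> = n choose Suc (card F)"
    by (cases n) (simp_all add: sum_choose_upper lessThan_Suc_atMost del: binomial_Suc_Suc)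
  finally show ?case using insert.hyps by simp
qed

lemma card_face_monomials:
  assumes X: "finite X" and \<Delta>: "simplicial_complex X \<Delta>"
  shows "card (face_monomials \<Delta> (Suc n)) = (\<Sum>F\<in>\<Delta>. n choose card F)"
proof -
  have F: "finite F" if "F \<in> \<Delta>" for F using that \<Delta> X finite_subset by (auto simp: simplicial_complex_def)
  have eq: "face_monomials \<Delta> (Suc n) = (\<Union>F\<in>\<Delta>. {m. keys m = F \<and> mdeg m < Suc n})"
    by (auto simp: face_monomials_def)
  have "card (face_monomials \<Delta> (Suc n)) = (\<Sum>F\<in>\<Delta>. card {m. keys m = F \<and> mdeg m < Suc n})"
    unfolding eq
  proof (rule card_UN_disjoint[OF finite_complex[OF X \<Delta>]])
    show "\<forall>F\<in>\<Delta>. finite {m. keys m = F \<and> mdeg m < Suc n}"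
      using finite_face_monomials[OF X \<Delta>, of "Suc n"] unfolding eq by (auto intro: finite_subset[rotated])
  qed auto
  also have "\<dots> = (\<Sum>F\<in>\<Delta>. n choose card F)"
    by (intro sum.cong card_monomials_support) (auto intro: F)
  finally show ?thesis .
qed

text \<open>The argument \<open>n - 1\<close> reflects that the length at \<open>n\<close> counts
  degrees below \<open>n\<close>. Passing from \<open>k\<close> to \<open>k + 1\<close> multiplies
  the ratio by \<open>1 - (k + 1) / n\<close>.\<close>

lemma binomial_ratio_limit:
  "(\<lambda>n. real ((n - 1) choose k) * fact k / real n ^ k) \<longlonglongrightarrow> 1"
proof (induction k)
  case (Suc k)
  have "(\<lambda>n. real ((n - 1) choose k) * fact k / real n ^ k * (1 - real (k + 1) * inverse (real n))) \<longlonglongrightarrow> 1 * (1 - real (k + 1) * 0)"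
    by (intro tendsto_mult tendsto_diff tendsto_const Suc lim_inverse_n)
  moreover have "\<forall>\<^sub>F n in sequentially. real ((n - 1) choose k) * fact k / real n ^ k * (1 - real (k + 1) * inverse (real n))
      = real ((n - 1) choose Suc k) * fact (Suc k) / real n ^ Suc k"
    using eventually_ge_at_top[of "k + 1"]
  proof eventually_elim
    case (elim n)
    have "((n - 1) choose Suc k) * Suc k = ((n - 1) choose k) * (n - 1 - k)"
      using binomial_absorb_comp[of "n - 1" k] binomial_absorption[of k "n - 1"] by (simp add: mult.commute) 
    then have "real ((n - 1) choose Suc k) * real (Suc k) = real ((n - 1) choose k) * real (n - 1 - k)"
      by (metis of_nat_mult)
    also have "real (n - 1 - k) = real n - real (k + 1)" using elim by simp
    finally have eq: "real ((n - 1) choose Suc k) * real (Suc k) = real ((n - 1) choose k) * (real n - real (k + 1))" .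
    have "real ((n - 1) choose Suc k) * fact (Suc k) / real n ^ Suc k
        = (real ((n - 1) choose Suc k) * real (Suc k)) * fact k / real n ^ Suc k" by (simp add: algebra_simps)
    also have "\<dots> = real ((n - 1) choose k) * fact k / real n ^ k * (1 - real (k + 1) * inverse (real n))"
      unfolding eq using elim by (simp add: field_simps)
    finally show ?case ..
  qed
  ultimately show ?case by (simp add: Lim_transform_eventually)
qed simp

text \<open>For \<open>k < d\<close> a factor \<open>n ^ (d - k)\<close> is left in the denominator,
  so smaller faces disappear in the limit.\<close>

lemma binomial_multiplicity_limit:
  assumes "k \<le> d"
  shows "(\<lambda>n. fact d / real n ^ d * real ((n - 1) choose k)) \<longlonglongrightarrow> (if k = d then 1 else 0)"
proof (cases "k = d")
  case True
  then show ?thesis using binomial_ratio_limit[of d] by (simp add: mult.commute)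
next
  case False
  have "(\<lambda>n. (fact d / fact k) * (real ((n - 1) choose k) * fact k / real n ^ k) * inverse (real n) ^ (d - k)) \<longlonglongrightarrow> (fact d / fact k) * 1 * 0 ^ (d - k)"
    by (intro tendsto_mult tendsto_const tendsto_power lim_inverse_n binomial_ratio_limit)
  moreover have "\<forall>\<^sub>F n in sequentially. (fact d / fact k) * (real ((n - 1) choose k) * fact k / real n ^ k) * inverse (real n) ^ (d - k)
      = fact d / real n ^ d * real ((n - 1) choose k)"
    using eventually_ge_at_top[of 1]
  proof eventually_elim
    case (elim n)
    have "real n ^ d = real n ^ k * real n ^ (d - k)" using assms by (simp add: power_add[symmetric])
    then show ?case using elim by (simp add: field_simps)
  qed
  ultimately have "(\<lambda>n. fact d / real n ^ d * real ((n - 1) choose k)) \<longlonglongrightarrow> (fact d / fact k) * 1 * 0 ^ (d - k)"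
    by (rule Lim_transform_eventually)
  moreover have "(0 :: real) ^ (d - k) = 0" using False assms by (simp add: power_0_left)
  ultimately show ?thesis using False by (simp only: mult_zero_right if_False)
qed

text \<open>For \<open>n \<ge> 1\<close> the length at \<open>n\<close> is the sum of
  \<open>(n - 1) choose card F\<close> over all faces, so after scaling each face of cardinality
  \<open>d\<close> contributes \<open>1\<close> to the limit and every other face
  \<open>0\<close>.\<close>

theorem multiplicity_stanley_reisner:
  fixes X :: "'x set" and \<Delta> :: "'x set set"
  assumes X: "finite X" and \<Delta>: "simplicial_complex X \<Delta>"
    and F: "F \<in> \<Delta>" "card F = d" and d: "\<And>G. G \<in> \<Delta> \<Longrightarrow> card G \<le> d"
  shows "has_graded_multiplicity X (nonface_ideal X \<Delta> :: ('x, 'k::field) mpoly set) (real (f_vector \<Delta> d))"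
proof -
  let ?I = "nonface_ideal X \<Delta> :: ('x, 'k) mpoly set"
  let ?A = "mpoly_ring X Quot ?I"
  let ?m = "genideal ?A ((\<lambda>x. cls X ?I (mvar x)) ` X)"
  interpret stanley_reisner X \<Delta> ?I by (intro stanley_reisner.intro X \<Delta> refl)
  have len: "ring_length (?A Quot ideal_power ?A ?m n) = enat (card (face_monomials \<Delta> n))" for n
    unfolding graded_ideal_eq ideal_power_eq by (rule ring_length_Quot_dideal)
  have "(\<lambda>n. \<Sum>F\<in>\<Delta>. fact d / real n ^ d * real ((n - 1) choose card F)) \<longlonglongrightarrow> (\<Sum>F\<in>\<Delta>. if card F = d then 1 else 0)"
    by (intro tendsto_sum binomial_multiplicity_limit d)
  also have "(\<Sum>F\<in>\<Delta>. if card F = d then 1 else 0) = real (f_vector \<Delta> d)"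
    using finite_complex[OF X \<Delta>] by (simp add: f_vector_def sum.If_cases Int_def)
  finally have "(\<lambda>n. \<Sum>F\<in>\<Delta>. fact d / real n ^ d * real ((n - 1) choose card F)) \<longlonglongrightarrow> real (f_vector \<Delta> d)" .
  moreover have "\<forall>\<^sub>F n in sequentially. (\<Sum>F\<in>\<Delta>. fact d / real n ^ d * real ((n - 1) choose card F))
      = fact d / real n ^ d * real (card (face_monomials \<Delta> n))"
    using eventually_ge_at_top[of 1]
  proof eventually_elim
    case (elim n)
    then show ?case
      using card_face_monomials[OF X \<Delta>, of "n - 1"] by (simp add: sum_distrib_left)
  qed
  ultimately have "(\<lambda>n. fact d / real n ^ d * real (card (face_monomials \<Delta> n))) \<longlonglongrightarrow> real (f_vector \<Delta> d)"
    by (rule Lim_transform_eventually)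
  then have "(\<lambda>n. ereal (fact d / real n ^ d) * ereal_of_enat (ring_length (?A Quot ideal_power ?A ?m n))) \<longlonglongrightarrow> ereal (real (f_vector \<Delta> d))"
    unfolding len by (simp add: tendsto_ereal)
  then show ?thesis
    unfolding has_graded_multiplicity_def has_multiplicity_def Let_def
    using krull_dim_stanley_reisner[OF X \<Delta> F d] by blast
qed

theorem theorem7p3:
  fixes X :: "'x set"
    and \<Delta> :: "'x set set"
    and I :: "('x, 'k::field) mpoly set"
    and s :: nat
  assumes "finite X"
    and "simplicial_complex X \<Delta>"
    and "stanley_reisner_ideal X \<Delta> I"
  shows "(\<exists>\<Gamma>. simplicial_complex (jet_vars s X) \<Gamma> \<and>
             stanley_reisner_ideal (jet_vars s X) \<Gamma> (principal_jet_ideal s X I) \<and>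
             f_vector \<Gamma> = row_times_matrix (f_vector \<Delta>) (lifting_matrix s)) \<and>
         (\<forall>d. krull_dim (mpoly_ring X Quot I) = enat d \<longrightarrow>
             krull_dim (mpoly_ring (jet_vars s X) Quot principal_jet_ideal s X I)
               = enat ((s + 1) * d) \<and>
             has_graded_multiplicity (jet_vars s X) (principal_jet_ideal s X I)
               (real (f_vector \<Delta> d)) \<and>
             has_graded_multiplicity X I (real (f_vector \<Delta> d)))"
proof -
  note fin = assms(1) and \<Delta> = assms(2)
  let ?\<Gamma> = "jet_complex s X \<Delta>"
  have I: "I = nonface_ideal X \<Delta>" by (rule stanley_reisner_eq(1)[OF assms(3)])
  have V: "finite (jet_vars s X)" using fin by (simp add: jet_vars_def)
  note \<Gamma> = simplicial_jet_complex[OF \<Delta>, of s]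
  have P: "principal_jet_ideal s X I = nonface_ideal (jet_vars s X) ?\<Gamma>"
    unfolding I by (rule principal_jet_ideal_eq[OF fin \<Delta>])
  have "finite (card ` \<Delta>)" "card ` \<Delta> \<noteq> {}"
    using finite_complex[OF fin \<Delta>] \<Delta> by (auto simp: simplicial_complex_def)
  then obtain F where F: "F \<in> \<Delta>" "card F = Max (card ` \<Delta>)" and max: "\<And>G. G \<in> \<Delta> \<Longrightarrow> card G \<le> Max (card ` \<Delta>)"
    by (metis (no_types, lifting) Max_in Max_ge imageE imageI)
  have dim: "krull_dim (mpoly_ring X Quot I) = enat (Max (card ` \<Delta>))"
    unfolding I by (rule krull_dim_stanley_reisner[OF fin \<Delta> F max])
  show ?thesis
  proof (intro conjI exI[of _ ?\<Gamma>] allI impI)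
    show "simplicial_complex (jet_vars s X) ?\<Gamma>" by (rule \<Gamma>)
    show "stanley_reisner_ideal (jet_vars s X) ?\<Gamma> (principal_jet_ideal s X I)"
      unfolding P by (rule stanley_reisner_nonface_ideal[OF V \<Gamma>])
    show "f_vector ?\<Gamma> = row_times_matrix (f_vector \<Delta>) (lifting_matrix s)"
      by (rule f_vector_jet_complex[OF fin \<Delta>])
  next
    fix d assume "krull_dim (mpoly_ring X Quot I) = enat d"
    \<comment> \<open>Being determined by the ring, the given \<open>d\<close> is the largest face
      cardinality, so the results on both complexes apply to it.\<close>
    then have d: "d = Max (card ` \<Delta>)" using dim by simp
    have cardF: "card F = d" and le: "\<And>G. G \<in> \<Delta> \<Longrightarrow> card G \<le> d" using F(2) max by (simp_all add: d)
    note top = jet_complex_top[OF fin \<Delta> le, where s = s]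
    have FX: "F \<subseteq> X" using F(1) \<Delta> by (auto simp: simplicial_complex_def)
    \<comment> \<open>This face shows that the bound \<open>(s + 1) * d\<close> for the jet complex
      is attained.\<close>
    have G: "F \<times> {..s} \<in> ?\<Gamma>" "card (F \<times> {..s}) = (s + 1) * d"
      using F(1) FX cardF by (auto simp: jet_complex_iff[OF \<Delta>] card_cartesian_product)
    show "krull_dim (mpoly_ring (jet_vars s X) Quot principal_jet_ideal s X I) = enat ((s + 1) * d)"
      unfolding P by (rule krull_dim_stanley_reisner[OF V \<Gamma> G top(1)])
    show "has_graded_multiplicity (jet_vars s X) (principal_jet_ideal s X I) (real (f_vector \<Delta> d))"
      using multiplicity_stanley_reisner[OF V \<Gamma> G top(1), where 'k = 'k] by (simp only: P top(2))
    show "has_graded_multiplicity X I (real (f_vector \<Delta> d))"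
      unfolding I by (rule multiplicity_stanley_reisner[OF fin \<Delta> F(1) cardF le])
  qed
qed

end
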